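(* Let $G \in \mathscr{S}$. Then $G$ is of exactly one of the following types: - locally h.j.i.: $\mathcal{LN}(G) = \{0,\infty\}$, or equivalently, every compact open subgroup of $G$ is hereditarily just-infinite; - atomic type: $|\mathcal{LN}(G)| > 2$ but $\mathcal{LC}(G) = \{0,\infty\}$, there is a unique least element of $\mathcal{LN}(G) \smallsetminus \{0\}$, the action of $G$ on $\mathcal{LN}(G)$ is trivial, and $G$ is not abstractly simple; - non-principal filter (NPF) type: the set $\mathcal{LN}(G) \smallsetminus \{0\}$ is a non-principal filter in $\mathcal{LN}(G)$ and $\mathcal{LC}(G) = \{0,\infty\}$; - (strictly) weakly decomposable: $|\mathcal{LC}(G)| > 2$, but $\mathcal{LD}(G) = \{0,\infty\}$; - locally decomposable: $|\mathcal{LD}(G)| > 2$. Moreover, the type of $G$ is completely determined by the isomorphism type of $\mathcal{LN}(G)$ as a poset. In particular, if $G, H \in \mathscr{S}$ have isomorphic open subgroups, then $G$ and $H$ are of the same type.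
   Context: $\mathscr{S}$ is the class of non-discrete, compactly generated, topologically simple, totally disconnected locally compact groups (topologically simple: the only closed normal subgroups are $\{1\}$ and the whole group, and the group is non-trivial). A group is abstractly simple if it has no proper non-trivial normal subgroup at all. Let $G$ be a totally disconnected locally compact group. A subgroup of $G$ is locally normal if its normaliser in $G$ is open. The structure lattice $\mathcal{LN}(G)$ is the set of closed locally normal subgroups of $G$ modulo the equivalence relation $H \sim K$ iff $H \cap K$ is open in both $H$ and $K$; the class of $H$ is written $[H]$. It is a (modular) lattice for the order $\alpha \le \beta$ iff there are $H \in \alpha$, $K \in \beta$ with $H \le K$. Here $0$ denotes the class of the trivial group and $\infty$ the class of the compact open subgroups. $G$ acts on $\mathcal{LN}(G)$ by conjugation: $g[H] = [gHg^{-1}]$. For $G \in \mathscr{S}$, the centraliser lattice is $\mathcal{LC}(G) = \{[\mathrm{C}_G(K)] : K \text{ a closed locally normal subgroup of } G\} \subseteq \mathcal{LN}(G)$, and the local decomposition lattice $\mathcal{LD}(G) \subseteq \mathcal{LN}(G)$ is the set of classes $[K]$ where $K$ is a closed direct factor of some compact open subgroup of $G$. One has $\{0,\infty\} \subseteq \mathcal{LD}(G) \subseteq \mathcal{LC}(G) \subseteq \mathcal{LN}(G)$. A profinite group is hereditarily just-infinite (h.j.i.) if every non-trivial closed locally normal subgroup of it is open. A filter of a lattice is a subset that is upward closed and closed under meets; it is principal if it has a least element. *)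

theory Defs
  imports "HOL-Analysis.Analysis" "HOL-Algebra.Group_Action" "HOL-Algebra.Generated_Groups"
    "HOL-Algebra.Lattice"
begin

section \<open>Totally disconnected locally compact groups\<close>

locale topological_group = group G for G (structure) +
  fixes T :: "'a topology"
  assumes topspace_eq: "topspace T = carrier G"
    and continuous_mult: "continuous_map (prod_topology T T) T (\<lambda>(x, y). x \<otimes> y)"
    and continuous_inv: "continuous_map T T (\<lambda>x. inv x)"

definition totally_disconnected :: "'a topology \<Rightarrow> bool" where
  "totally_disconnected T \<longleftrightarrow> (\<forall>x\<in>topspace T. connected_component_of_set T x = {x})"

text \<open>No Hausdorff axiom is needed below: in a totally disconnected space points are closed, and
  a topological group whose points are closed is Hausdorff.\<close>

definition tdlc_group :: "('a, 'm) monoid_scheme \<Rightarrow> 'a topology \<Rightarrow> bool" where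
  "tdlc_group G T \<longleftrightarrow>
     topological_group G T \<and> totally_disconnected T \<and> locally_compact_space T"

definition profinite_group :: "('a, 'm) monoid_scheme \<Rightarrow> 'a topology \<Rightarrow> bool" where
  "profinite_group G T \<longleftrightarrow>
     topological_group G T \<and> totally_disconnected T \<and> compact_space T"

definition compactly_generated :: "('a, 'm) monoid_scheme \<Rightarrow> 'a topology \<Rightarrow> bool" where
  "compactly_generated G T \<longleftrightarrow> (\<exists>K. compactin T K \<and> generate G K = carrier G)"

definition topologically_simple :: "('a, 'm) monoid_scheme \<Rightarrow> 'a topology \<Rightarrow> bool" where
  "topologically_simple G T \<longleftrightarrow>
     carrier G \<noteq> {\<one>\<^bsub>G\<^esub>} \<and>
     (\<forall>N. N \<lhd> G \<and> closedin T N \<longrightarrow> N = {\<one>\<^bsub>G\<^esub>} \<or> N = carrier G)"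

text \<open>The library's \<open>simple_group\<close> demands \<open>order G > 1\<close> and therefore excludes infinite groups.\<close>

definition abstractly_simple :: "('a, 'm) monoid_scheme \<Rightarrow> bool" where
  "abstractly_simple G \<longleftrightarrow> (\<forall>N. N \<lhd> G \<longrightarrow> N = {\<one>\<^bsub>G\<^esub>} \<or> N = carrier G)"

definition class_S :: "('a, 'm) monoid_scheme \<Rightarrow> 'a topology \<Rightarrow> bool" where
  "class_S G T \<longleftrightarrow>
     tdlc_group G T \<and> T \<noteq> discrete_topology (carrier G) \<and>
     compactly_generated G T \<and> topologically_simple G T"

definition compact_open_subgroup ::
  "('a, 'm) monoid_scheme \<Rightarrow> 'a topology \<Rightarrow> 'a set \<Rightarrow> bool" where
  "compact_open_subgroup G T U \<longleftrightarrow> subgroup U G \<and> compactin T U \<and> openin T U"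

section \<open>The structure lattice\<close>

definition closed_locally_normal ::
  "('a, 'm) monoid_scheme \<Rightarrow> 'a topology \<Rightarrow> 'a set \<Rightarrow> bool" where
  "closed_locally_normal G T H \<longleftrightarrow>
     subgroup H G \<and> closedin T H \<and> openin T (normalizer G H)"

definition hereditarily_just_infinite ::
  "('a, 'm) monoid_scheme \<Rightarrow> 'a topology \<Rightarrow> bool" where
  "hereditarily_just_infinite G T \<longleftrightarrow>
     profinite_group G T \<and>
     (\<forall>K. closed_locally_normal G T K \<and> K \<noteq> {\<one>\<^bsub>G\<^esub>} \<longrightarrow> openin T K)"

definition commensurability ::
  "('a, 'm) monoid_scheme \<Rightarrow> 'a topology \<Rightarrow> ('a set \<times> 'a set) set" where
  "commensurability G T =
     {(H, K). closed_locally_normal G T H \<and> closed_locally_normal G T K \<and>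
        openin (subtopology T H) (H \<inter> K) \<and> openin (subtopology T K) (H \<inter> K)}"

definition local_class ::
  "('a, 'm) monoid_scheme \<Rightarrow> 'a topology \<Rightarrow> 'a set \<Rightarrow> 'a set set" where
  "local_class G T H = commensurability G T `` {H}"

definition LN :: "('a, 'm) monoid_scheme \<Rightarrow> 'a topology \<Rightarrow> 'a set set gorder" where
  "LN G T =
     \<lparr>carrier = {H. closed_locally_normal G T H} // commensurability G T,
      eq = (=),
      le = (\<lambda>\<alpha> \<beta>. \<exists>H\<in>\<alpha>. \<exists>K\<in>\<beta>. H \<subseteq> K)\<rparr>"

definition LN_zero :: "('a, 'm) monoid_scheme \<Rightarrow> 'a topology \<Rightarrow> 'a set set" where
  "LN_zero G T = local_class G T {\<one>\<^bsub>G\<^esub>}"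

text \<open>All compact open subgroups lie in the same class, and by van Dantzig's theorem a totally
  disconnected locally compact group has such a subgroup.\<close>

definition LN_infty :: "('a, 'm) monoid_scheme \<Rightarrow> 'a topology \<Rightarrow> 'a set set" where
  "LN_infty G T = (THE \<alpha>. \<exists>U. compact_open_subgroup G T U \<and> \<alpha> = local_class G T U)"

definition centraliser :: "('a, 'm) monoid_scheme \<Rightarrow> 'a set \<Rightarrow> 'a set" where
  "centraliser G K = {g \<in> carrier G. \<forall>k\<in>K. g \<otimes>\<^bsub>G\<^esub> k = k \<otimes>\<^bsub>G\<^esub> g}"

definition LC :: "('a, 'm) monoid_scheme \<Rightarrow> 'a topology \<Rightarrow> 'a set set set" where
  "LC G T = {local_class G T (centraliser G K) |K. closed_locally_normal G T K}"

definition direct_factor :: "('a, 'm) monoid_scheme \<Rightarrow> 'a set \<Rightarrow> bool" where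
  "direct_factor G K \<longleftrightarrow>
     K \<lhd> G \<and> (\<exists>L. L \<lhd> G \<and> K \<inter> L = {\<one>\<^bsub>G\<^esub>} \<and> K <#>\<^bsub>G\<^esub> L = carrier G)"

definition LD :: "('a, 'm) monoid_scheme \<Rightarrow> 'a topology \<Rightarrow> 'a set set set" where
  "LD G T =
     {local_class G T K |K. \<exists>U. compact_open_subgroup G T U \<and>
        closedin T K \<and> direct_factor (G\<lparr>carrier := U\<rparr>) K}"

definition trivial_conjugation_action ::
  "('a, 'm) monoid_scheme \<Rightarrow> 'a topology \<Rightarrow> bool" where
  "trivial_conjugation_action G T \<longleftrightarrow>
     (\<forall>g\<in>carrier G. \<forall>H. closed_locally_normal G T H \<longrightarrow>
        local_class G T (g <#\<^bsub>G\<^esub> H #>\<^bsub>G\<^esub> inv\<^bsub>G\<^esub> g) = local_class G T H)"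

definition order_filter :: "('a, 'l) gorder_scheme \<Rightarrow> 'a set \<Rightarrow> bool" where
  "order_filter L F \<longleftrightarrow>
     F \<subseteq> carrier L \<and>
     (\<forall>x\<in>F. \<forall>y\<in>carrier L. x \<sqsubseteq>\<^bsub>L\<^esub> y \<longrightarrow> y \<in> F) \<and>
     (\<forall>x\<in>F. \<forall>y\<in>F. x \<sqinter>\<^bsub>L\<^esub> y \<in> F)"

definition principal_filter :: "('a, 'l) gorder_scheme \<Rightarrow> 'a set \<Rightarrow> bool" where
  "principal_filter L F \<longleftrightarrow> order_filter L F \<and> (\<exists>x. least L x F)"

definition more_than_two :: "'a set \<Rightarrow> bool" where
  "more_than_two A \<longleftrightarrow> infinite A \<or> card A > 2"

section \<open>The five types\<close>

datatype local_type =
  Locally_HJI | Atomic | NPF | Weakly_Decomposable | Locally_Decomposable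

fun of_type :: "('a, 'm) monoid_scheme \<Rightarrow> 'a topology \<Rightarrow> local_type \<Rightarrow> bool" where
  "of_type G T Locally_HJI \<longleftrightarrow>
     carrier (LN G T) = {LN_zero G T, LN_infty G T}"
| "of_type G T Atomic \<longleftrightarrow>
     more_than_two (carrier (LN G T)) \<and>
     LC G T = {LN_zero G T, LN_infty G T} \<and>
     (\<exists>!\<alpha>. least (LN G T) \<alpha> (carrier (LN G T) - {LN_zero G T})) \<and>
     trivial_conjugation_action G T \<and>
     \<not> abstractly_simple G"
| "of_type G T NPF \<longleftrightarrow>
     order_filter (LN G T) (carrier (LN G T) - {LN_zero G T}) \<and>
     \<not> principal_filter (LN G T) (carrier (LN G T) - {LN_zero G T}) \<and>
     LC G T = {LN_zero G T, LN_infty G T}"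
| "of_type G T Weakly_Decomposable \<longleftrightarrow>
     more_than_two (LC G T) \<and> LD G T = {LN_zero G T, LN_infty G T}"
| "of_type G T Locally_Decomposable \<longleftrightarrow>
     more_than_two (LD G T)"

section \<open>Comparing two groups\<close>

definition poset_isomorphic ::
  "('a, 'l) gorder_scheme \<Rightarrow> ('b, 'k) gorder_scheme \<Rightarrow> bool" where
  "poset_isomorphic L M \<longleftrightarrow>
     (\<exists>f. bij_betw f (carrier L) (carrier M) \<and>
        (\<forall>x\<in>carrier L. \<forall>y\<in>carrier L. x \<sqsubseteq>\<^bsub>L\<^esub> y \<longleftrightarrow> f x \<sqsubseteq>\<^bsub>M\<^esub> f y))"

definition isomorphic_open_subgroups ::
  "('a, 'm) monoid_scheme \<Rightarrow> 'a topology \<Rightarrow> ('b, 'n) monoid_scheme \<Rightarrow> 'b topology \<Rightarrow> bool" where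
  "isomorphic_open_subgroups G T H S \<longleftrightarrow>
     (\<exists>U V f. subgroup U G \<and> openin T U \<and> subgroup V H \<and> openin S V \<and>
        f \<in> iso (G\<lparr>carrier := U\<rparr>) (H\<lparr>carrier := V\<rparr>) \<and>
        homeomorphic_map (subtopology T U) (subtopology S V) f)"

end

theory Submission
  imports Defs
begin

text \<open>The engine is the following observation. Let \<open>\<B>\<close> be a conjugation invariant family of
  non-trivial closed locally normal subgroups that is closed under intersection and contains the
  compact open subgroups. The centralisers of its members form a directed union, hence a normal
  subgroup, and if that subgroup were dense, compact generation would yield a non-trivial compact
  normal subgroup; so all these centralisers are trivial. For the family of open subgroups this says
  that \<open>G\<close> has trivial quasi-centre, hence that discrete locally normal subgroups are trivial. For
  the family of all non-trivial closed locally normal subgroups it shows that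
  \<open>\<L>\<C>(G) = {0, \<infinity>}\<close> if and only if any two non-zero elements of \<open>\<L>\<N>(G)\<close> have non-zero meet.
  Moreover \<open>\<L>\<D>(G)\<close> consists of the complemented elements of \<open>\<L>\<N>(G)\<close>, so both sets can be read
  off the poset.

  In the atomic case let \<open>[K]\<close> be the least non-zero class. An element \<open>d\<close> of \<open>K\<close> fixes every
  \<open>[H] \<ge> [K]\<close>, because \<open>[d, h]\<close> lies in \<open>K \<inter> H\<close> for all \<open>h\<close> close to \<open>1\<close>. So the kernel of the action
  on \<open>\<L>\<N>(G)\<close>, a closed normal subgroup, is non-trivial and hence equal to \<open>G\<close>. The abstract normal
  subgroup generated by \<open>K\<close> is a countable union of cosets of \<open>K\<close>, so it is proper by the Baire
  category theorem.\<close>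

section \<open>Topological groups\<close>

text \<open>Two difficulties shape the argument. The types mix lattice conditions with conditions on
  centralisers, direct factors, the action and abstract simplicity, while the comparison of two
  groups must use the order alone. Each such condition is therefore traded for, or derived from, one
  in terms of \<le>, the bottom and the top of the lattice; an order isomorphism preserves these two
  elements because they are least and greatest. Moreover, elements of the lattice are classes, and
  different subgroups may share a class. Triviality of discrete locally normal subgroups makes
  \<open>{\<one>}\<close> the only representative of 0, and openness characterises the
  representatives of \<infinity>, so statements about classes become statements about subgroups near
  the identity. In the engine, the compact open subgroups belong to the family so that finite
  intersections of members can be cut down into a compact \<open>U\<close>. The resulting normal
  subgroup is proper, since a compact group of this kind would have small open normal
  subgroups.\<close>

lemma (in group) inv_mult_cancel:
  assumes "x \<in> carrier G" "y \<in> carrier G"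
  shows "inv x \<otimes> (x \<otimes> y) = y" "x \<otimes> (inv x \<otimes> y) = y"
  using assms by (simp_all flip: m_assoc)

text \<open>The image form of the product of cosets \<open>g <# H #> inv g\<close>, which suits
  continuity and injectivity arguments.\<close>

definition conjugate :: "('a, 'm) monoid_scheme \<Rightarrow> 'a \<Rightarrow> 'a set \<Rightarrow> 'a set" where
  "conjugate G g H = (\<lambda>h. g \<otimes>\<^bsub>G\<^esub> h \<otimes>\<^bsub>G\<^esub> inv\<^bsub>G\<^esub> g) ` H"

text \<open>Only an inclusion, and \<open>V\<close> may be any set, so that a mere neighbourhood of
  the identity can be tested. For a subgroup \<open>V\<close> the inclusion is an equality, because
  it also holds for inverses.\<close>

definition normalises :: "('a, 'm) monoid_scheme \<Rightarrow> 'a set \<Rightarrow> 'a set \<Rightarrow> bool" where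
  "normalises G V H \<longleftrightarrow> (\<forall>v\<in>V. \<forall>h\<in>H. v \<otimes>\<^bsub>G\<^esub> h \<otimes>\<^bsub>G\<^esub> inv\<^bsub>G\<^esub> v \<in> H)"

lemma conjugate_eq_cosets: "g <#\<^bsub>G\<^esub> H #>\<^bsub>G\<^esub> inv\<^bsub>G\<^esub> g = conjugate G g H"
  by (auto simp: conjugate_def l_coset_def r_coset_def)

lemma normalisesD:
  "normalises G V H \<Longrightarrow> v \<in> V \<Longrightarrow> h \<in> H \<Longrightarrow> v \<otimes>\<^bsub>G\<^esub> h \<otimes>\<^bsub>G\<^esub> inv\<^bsub>G\<^esub> v \<in> H"
  by (simp add: normalises_def)

no_notation (ASCII) subset_mset  (infix \<open><#\<close> 50)
no_notation eq_closure_of (\<open>closure'_of\<index>\<close>)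

section \<open>Conjugation and normalisation in abstract groups\<close>

context group
begin

lemma conjugate_in_carrier: "g \<in> carrier G \<Longrightarrow> H \<subseteq> carrier G \<Longrightarrow> conjugate G g H \<subseteq> carrier G"
  by (auto simp: conjugate_def)

lemma conjugate_mult:
  assumes "g \<in> carrier G" "h \<in> carrier G" "H \<subseteq> carrier G"
  shows "conjugate G (g \<otimes> h) H = conjugate G g (conjugate G h H)"
  unfolding conjugate_def image_image
  using assms by (intro image_cong) (auto simp: m_assoc inv_mult_group subset_iff)

lemma conjugate_one: "H \<subseteq> carrier G \<Longrightarrow> conjugate G \<one> H = H"
  by (auto simp: conjugate_def subset_iff image_iff)

lemma conjugate_inv_cancel:
  assumes "g \<in> carrier G" "H \<subseteq> carrier G"
  shows "conjugate G (inv g) (conjugate G g H) = H" "conjugate G g (conjugate G (inv g) H) = H"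
  using assms by (simp_all add: conjugate_one flip: conjugate_mult)

lemma mem_conjugate_iff:
  assumes "g \<in> carrier G" "H \<subseteq> carrier G" "x \<in> carrier G"
  shows "x \<in> conjugate G g H \<longleftrightarrow> inv g \<otimes> x \<otimes> g \<in> H"
proof
  assume "x \<in> conjugate G g H"
  with assms show "inv g \<otimes> x \<otimes> g \<in> H"
    by (auto simp: conjugate_def m_assoc inv_mult_cancel subset_iff)
next
  assume "inv g \<otimes> x \<otimes> g \<in> H"
  moreover have "x = g \<otimes> (inv g \<otimes> x \<otimes> g) \<otimes> inv g"
    using assms by (simp add: m_assoc inv_mult_cancel)
  ultimately show "x \<in> conjugate G g H"
    unfolding conjugate_def by (rule rev_image_eqI)
qed

lemma mem_lcoset_iff:
  assumes "g \<in> carrier G" "H \<subseteq> carrier G" "x \<in> carrier G"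
  shows "x \<in> g <# H \<longleftrightarrow> inv g \<otimes> x \<in> H"
proof
  assume "x \<in> g <# H"
  with assms show "inv g \<otimes> x \<in> H"
    by (auto simp: l_coset_def inv_mult_cancel subset_iff)
next
  assume "inv g \<otimes> x \<in> H"
  moreover have "x = g \<otimes> (inv g \<otimes> x)"
    using assms by (simp add: inv_mult_cancel)
  ultimately show "x \<in> g <# H"
    unfolding l_coset_def by blast
qed

lemma conjugate_Int:
  assumes "g \<in> carrier G" "H \<subseteq> carrier G" "K \<subseteq> carrier G"
  shows "conjugate G g (H \<inter> K) = conjugate G g H \<inter> conjugate G g K"
proof -
  have "inj_on (\<lambda>h. g \<otimes> h \<otimes> inv g) (carrier G)"
    using assms(1) by (auto simp: inj_on_def)
  then show ?thesis
    unfolding conjugate_def using assms(2,3) by (rule inj_on_image_Int)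
qed

lemma conjugate_mono: "H \<subseteq> K \<Longrightarrow> conjugate G g H \<subseteq> conjugate G g K"
  by (auto simp: conjugate_def)

lemma conjugate_eqI:
  assumes "subgroup V G" "normalises G V H" "v \<in> V" "H \<subseteq> carrier G"
  shows "conjugate G v H = H"
proof
  show sub: "conjugate G v H \<subseteq> H"
    using assms by (auto simp: conjugate_def normalises_def)
  have v: "v \<in> carrier G" "inv v \<in> V"
    using assms by (auto simp: subgroup.mem_carrier subgroup.m_inv_closed)
  have "conjugate G (inv v) H \<subseteq> H"
    using assms v by (auto simp: conjugate_def normalises_def)
  then have "conjugate G v (conjugate G (inv v) H) \<subseteq> conjugate G v H"
    by (rule conjugate_mono)
  then show "H \<subseteq> conjugate G v H"
    using v assms by (simp add: conjugate_inv_cancel)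
qed

lemma conjugate_trivial: "g \<in> carrier G \<Longrightarrow> conjugate G g {\<one>} = {\<one>}"
  by (simp add: conjugate_def)

lemma subgroup_conjugate:
  assumes H: "subgroup H G" and g: "g \<in> carrier G"
  shows "subgroup (conjugate G g H) G"
proof (rule subgroupI)
  have sub: "H \<subseteq> carrier G"
    using H by (rule subgroup.subset)
  show "conjugate G g H \<subseteq> carrier G"
    using sub g by (rule conjugate_in_carrier[rotated])
  show "conjugate G g H \<noteq> {}"
    using subgroup.one_closed[OF H] by (auto simp: conjugate_def)
  show "inv a \<in> conjugate G g H" if a: "a \<in> conjugate G g H" for a
  proof -
    obtain h where h: "h \<in> H" "a = g \<otimes> h \<otimes> inv g"
      using a by (auto simp: conjugate_def)
    then have "inv a = g \<otimes> inv h \<otimes> inv g"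
      using g sub by (auto simp: m_assoc inv_mult_group subset_iff)
    then show ?thesis
      using subgroup.m_inv_closed[OF H h(1)] by (auto simp: conjugate_def)
  qed
  show "a \<otimes> b \<in> conjugate G g H" if a: "a \<in> conjugate G g H" and b: "b \<in> conjugate G g H" for a b
  proof -
    obtain h k where h: "h \<in> H" "a = g \<otimes> h \<otimes> inv g" "k \<in> H" "b = g \<otimes> k \<otimes> inv g"
      using a b by (auto simp: conjugate_def)
    then have "a \<otimes> b = g \<otimes> (h \<otimes> k) \<otimes> inv g"
      using g sub by (auto simp: m_assoc inv_mult_cancel subset_iff)
    then show ?thesis
      using subgroup.m_closed[OF H h(1,3)] by (auto simp: conjugate_def)
  qed
qed

lemma normaliser_subgroup:
  assumes H: "H \<subseteq> carrier G"
  shows "subgroup {g \<in> carrier G. conjugate G g H = H} G"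
proof (rule subgroupI)
  show "{g \<in> carrier G. conjugate G g H = H} \<noteq> {}"
    using conjugate_one[OF H] by blast
  show "inv a \<in> {g \<in> carrier G. conjugate G g H = H}" if "a \<in> {g \<in> carrier G. conjugate G g H = H}" for a
    using that conjugate_inv_cancel(1)[of a H] H by simp
qed (auto simp: conjugate_mult H)

lemma normalizer_eq:
  "H \<subseteq> carrier G \<Longrightarrow> normalizer G H = {g \<in> carrier G. conjugate G g H = H}"
  by (simp add: normalizer_def stabilizer_def conjugate_eq_cosets)

text \<open>The elements that fix \<open>N\<close> under conjugation form a subgroup, so it is
  enough to look at a generating set; this is how normality is obtained from compact
  generation.\<close>

lemma normal_if_generated:
  assumes gen: "generate G X = carrier G" and N: "subgroup N G"
    and X: "\<And>x. x \<in> X \<Longrightarrow> conjugate G x N = N"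
  shows "N \<lhd> G"
proof -
  let ?N = "{g \<in> carrier G. conjugate G g N = N}"
  have sub: "N \<subseteq> carrier G"
    using N by (rule subgroup.subset)
  have "X \<subseteq> carrier G"
    using generate.incl[of _ X G] gen by auto
  with X have "X \<subseteq> ?N"
    by blast
  then have "generate G X \<subseteq> ?N"
    using normaliser_subgroup[OF sub] by (rule generate_subgroup_incl)
  then have "\<And>x. x \<in> carrier G \<Longrightarrow> conjugate G x N = N"
    using gen by blast
  then have "\<And>x h. x \<in> carrier G \<Longrightarrow> h \<in> N \<Longrightarrow> x \<otimes> h \<otimes> inv x \<in> N"
    unfolding conjugate_def by blast
  with N show ?thesis
    by (rule normal_invI)
qed

text \<open>The commutator of \<open>h\<close> and \<open>k\<close> lies in \<open>K\<close> when
  read as \<open>h k (inv h)\<close> times \<open>inv k\<close>, and in \<open>H\<close> when read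
  as \<open>h\<close> times \<open>k (inv h) (inv k)\<close>, so it is trivial.\<close>

lemma commute_if_normalise_disjoint:
  assumes H: "subgroup H G" and K: "subgroup K G" and "H \<inter> K = {\<one>}"
    and HK: "normalises G H K" and KH: "normalises G K H" and h: "h \<in> H" and k: "k \<in> K"
  shows "h \<otimes> k = k \<otimes> h"
proof -
  have c: "h \<in> carrier G" "k \<in> carrier G"
    using H K h k by (auto simp: subgroup.mem_carrier)
  have "h \<otimes> k \<otimes> inv h \<otimes> inv k \<in> K"
    using normalisesD[OF HK h k] K k by (simp add: subgroup.m_closed subgroup.m_inv_closed)
  moreover have "h \<otimes> (k \<otimes> inv h \<otimes> inv k) \<in> H"
    using normalisesD[OF KH k] H h by (simp add: subgroup.m_closed subgroup.m_inv_closed)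
  ultimately have "h \<otimes> k \<otimes> inv h \<otimes> inv k = \<one>"
    using c assms(3) by (auto simp: m_assoc)
  then have "h \<otimes> k \<otimes> inv (k \<otimes> h) = \<one>"
    using c by (simp add: m_assoc inv_mult_group)
  then show ?thesis
    using c by (metis inv_equality inv_inv m_closed inv_closed)
qed

end

section \<open>Open subgroups, closures and compactness arguments\<close>

context topological_group
begin

lemma continuous_map_mult:
  assumes "continuous_map X T f" "continuous_map X T g"
  shows "continuous_map X T (\<lambda>x. f x \<otimes> g x)"
proof -
  have "continuous_map X (prod_topology T T) (\<lambda>x. (f x, g x))"
    using assms by (simp add: continuous_map_paired)
  from continuous_map_compose[OF this continuous_mult] show ?thesis
    by (simp add: o_def)
qed

lemma continuous_map_inv:
  assumes "continuous_map X T f"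
  shows "continuous_map X T (\<lambda>x. inv (f x))"
  using continuous_map_compose[OF assms continuous_inv] by (simp add: o_def)

lemma continuous_map_constant: "c \<in> carrier G \<Longrightarrow> continuous_map X T (\<lambda>x. c)"
  by (simp add: topspace_eq)

lemma continuous_map_identity: "continuous_map T T (\<lambda>x. x)"
  using continuous_map_id[of T] by (simp add: id_def)

lemmas continuous_group_intros =
  continuous_map_mult continuous_map_inv continuous_map_constant continuous_map_identity
  continuous_map_fst continuous_map_snd

lemma openin_carrier [simp]: "openin T (carrier G)"
  using openin_topspace[of T] by (simp add: topspace_eq)

lemma openin_subset_carrier: "openin T A \<Longrightarrow> A \<subseteq> carrier G"
  using openin_subset topspace_eq by blast

lemma openin_preimage:
  assumes "continuous_map T T f" "openin T A"
  shows "openin T {x \<in> carrier G. f x \<in> A}"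
  using openin_continuous_map_preimage[OF assms] by (simp add: topspace_eq)

lemma openin_lcoset:
  assumes "g \<in> carrier G" "openin T A"
  shows "openin T (g <# A)"
proof -
  have "g <# A = {x \<in> carrier G. inv g \<otimes> x \<in> A}"
    using mem_lcoset_iff[OF assms(1) openin_subset_carrier[OF assms(2)]]
      l_coset_subset_G[OF openin_subset_carrier[OF assms(2)] assms(1)] by blast
  also have "openin T \<dots>"
    using assms by (intro openin_preimage continuous_group_intros) auto
  finally show ?thesis .
qed

lemma openin_conjugate:
  assumes "g \<in> carrier G" "openin T A"
  shows "openin T (conjugate G g A)"
proof -
  have "conjugate G g A = {x \<in> carrier G. inv g \<otimes> x \<otimes> g \<in> A}"
    using mem_conjugate_iff[OF assms(1) openin_subset_carrier[OF assms(2)]]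
      conjugate_in_carrier[OF assms(1) openin_subset_carrier[OF assms(2)]] by blast
  also have "openin T \<dots>"
    using assms by (intro openin_preimage continuous_group_intros) auto
  finally show ?thesis .
qed

lemma closedin_preimage:
  assumes "continuous_map T T f" "closedin T A"
  shows "closedin T {x \<in> carrier G. f x \<in> A}"
  using closedin_continuous_map_preimage[OF assms] by (simp add: topspace_eq)

lemma closedin_subset_carrier: "closedin T A \<Longrightarrow> A \<subseteq> carrier G"
  using closedin_subset topspace_eq by blast

lemma closedin_lcoset:
  assumes "g \<in> carrier G" "closedin T A"
  shows "closedin T (g <# A)"
proof -
  have "g <# A = {x \<in> carrier G. inv g \<otimes> x \<in> A}"
    using mem_lcoset_iff[OF assms(1) closedin_subset_carrier[OF assms(2)]]
      l_coset_subset_G[OF closedin_subset_carrier[OF assms(2)] assms(1)] by blast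
  also have "closedin T \<dots>"
    using assms by (intro closedin_preimage continuous_group_intros) auto
  finally show ?thesis .
qed

lemma closedin_conjugate:
  assumes "g \<in> carrier G" "closedin T A"
  shows "closedin T (conjugate G g A)"
proof -
  have "conjugate G g A = {x \<in> carrier G. inv g \<otimes> x \<otimes> g \<in> A}"
    using mem_conjugate_iff[OF assms(1) closedin_subset_carrier[OF assms(2)]]
      conjugate_in_carrier[OF assms(1) closedin_subset_carrier[OF assms(2)]] by blast
  also have "closedin T \<dots>"
    using assms by (intro closedin_preimage continuous_group_intros) auto
  finally show ?thesis .
qed

text \<open>A subgroup containing \<open>O'\<close> is the union of the translates
  \<open>h <# O'\<close> by its own elements.\<close>

lemma open_subgroupI:
  assumes H: "subgroup H G" and "openin T O'" "\<one> \<in> O'" "O' \<subseteq> H"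
  shows "openin T H"
proof (subst openin_subopen, intro ballI)
  fix h assume h: "h \<in> H"
  then have "h \<in> carrier G"
    using H by (simp add: subgroup.mem_carrier)
  then show "\<exists>A. openin T A \<and> h \<in> A \<and> A \<subseteq> H"
    using assms h openin_lcoset[of h O']
    by (intro exI[of _ "h <# O'"]) (force simp: l_coset_def subset_iff subgroup.m_closed)
qed

lemma open_subgroup_closed:
  assumes H: "subgroup H G" and "openin T H"
  shows "closedin T H"
proof -
  have sub: "H \<subseteq> carrier G"
    using H by (rule subgroup.subset)
  have "openin T (carrier G - H)"
  proof (subst openin_subopen, intro ballI)
    fix g assume g: "g \<in> carrier G - H"
    have "g \<otimes> h \<notin> H" if h: "h \<in> H" for h
    proof
      assume "g \<otimes> h \<in> H"
      then have "g \<otimes> h \<otimes> inv h \<in> H"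
        using H h by (simp add: subgroup.m_closed subgroup.m_inv_closed)
      with g h sub show False
        by (auto simp: m_assoc subset_iff)
    qed
    then have "g <# H \<subseteq> carrier G - H"
      using g sub by (auto simp: l_coset_def)
    moreover have "g \<in> g <# H"
      using g subgroup.one_closed[OF H] by (force simp: l_coset_def)
    ultimately show "\<exists>A. openin T A \<and> g \<in> A \<and> A \<subseteq> carrier G - H"
      using openin_lcoset[of g H] assms g by blast
  qed
  then show ?thesis
    using sub by (simp add: closedin_def topspace_eq)
qed

text \<open>A condition quantified over a compact set of parameters stays open in the remaining
  variable, by the tube lemma. Stabilisers of compact open sets and cores under compact groups are
  open for this reason.\<close>

lemma tube:
  assumes C: "compactin T C" and A: "openin T A"
    and f: "continuous_map (prod_topology T T) T f"
  shows "openin T {g \<in> carrier G. \<forall>c\<in>C. f (g, c) \<in> A}"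
proof (subst openin_subopen, intro ballI)
  fix g assume g: "g \<in> {g \<in> carrier G. \<forall>c\<in>C. f (g, c) \<in> A}"
  let ?W = "{z \<in> carrier G \<times> carrier G. f z \<in> A}"
  have C': "C \<subseteq> carrier G"
    using compactin_subset_topspace[OF C] topspace_eq by simp
  have "openin (prod_topology T T) ?W"
    using openin_continuous_map_preimage[OF f A] by (simp add: topspace_eq)
  moreover have "{g} \<times> C \<subseteq> ?W"
    using g C' by auto
  ultimately obtain U V where UV: "openin T U" "openin T V" "g \<in> U" "C \<subseteq> V" "U \<times> V \<subseteq> ?W"
    using tube_lemma_right[of T T ?W C g] C g topspace_eq by blast
  then show "\<exists>U. openin T U \<and> g \<in> U \<and> U \<subseteq> {g \<in> carrier G. \<forall>c\<in>C. f (g, c) \<in> A}"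
    using openin_subset_carrier[OF UV(1)] by (intro exI[of _ U]) auto
qed

text \<open>The representatives are taken inside \<open>C\<close>; when \<open>C\<close> is a
  subgroup, this keeps the quotients \<open>inv f \<otimes> c\<close> inside
  \<open>C\<close>.\<close>

lemma finite_cosets_cover:
  assumes C: "compactin T C" and A: "openin T A" "\<one> \<in> A"
  shows "\<exists>F. finite F \<and> F \<subseteq> C \<and> C \<subseteq> (\<Union>f\<in>F. f <# A)"
proof -
  have C': "C \<subseteq> carrier G"
    using compactin_subset_topspace[OF C] topspace_eq by simp
  have o: "\<forall>U\<in>(\<lambda>c. c <# A) ` C. openin T U"
    using C' A openin_lcoset by blast
  have "C \<subseteq> \<Union>((\<lambda>c. c <# A) ` C)"
    using A C' by (force simp: l_coset_def)
  with o obtain \<F> where "finite \<F>" "\<F> \<subseteq> (\<lambda>c. c <# A) ` C" "C \<subseteq> \<Union>\<F>"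
    using C unfolding compactin_def by meson
  then obtain F where "finite F" "F \<subseteq> C" "\<F> = (\<lambda>c. c <# A) ` F"
    using finite_subset_image by metis
  with \<open>C \<subseteq> \<Union>\<F>\<close> show ?thesis
    by blast
qed

lemma compactin_set_mult:
  assumes "compactin T A" "compactin T B"
  shows "compactin T (A <#> B)"
proof -
  have "compactin (prod_topology T T) (A \<times> B)"
    using assms by (simp add: compactin_Times)
  from image_compactin[OF this continuous_mult]
  have "compactin T ((\<lambda>(x, y). x \<otimes> y) ` (A \<times> B))" .
  moreover have "(\<lambda>(x, y). x \<otimes> y) ` (A \<times> B) = A <#> B"
    unfolding set_mult_def by auto
  ultimately show ?thesis
    by simp
qed

lemma compactin_conjugate:
  assumes "compactin T A" "g \<in> carrier G"
  shows "compactin T (conjugate G g A)"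
  unfolding conjugate_def using assms
  by (intro image_compactin[of T] continuous_group_intros) auto

text \<open>Continuity of inversion and multiplication carries the closures of \<open>H\<close> and
  of \<open>H \<times> H\<close> into the closure of the image.\<close>

lemma subgroup_closure_of:
  assumes H: "subgroup H G"
  shows "subgroup (T closure_of H) G"
proof (rule subgroupI)
  have sub: "H \<subseteq> carrier G"
    using H by (rule subgroup.subset)
  then have "H \<subseteq> T closure_of H"
    by (simp add: closure_of_subset topspace_eq)
  then show "T closure_of H \<noteq> {}"
    using subgroup.one_closed[OF H] by blast
  show "T closure_of H \<subseteq> carrier G"
    using closure_of_subset_topspace topspace_eq by metis
  show "inv a \<in> T closure_of H" if "a \<in> T closure_of H" for a
  proof -
    have "inv a \<in> T closure_of ((\<lambda>x. inv x) ` H)"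
      using continuous_map_image_closure_subset[OF continuous_inv] that by blast
    moreover have "(\<lambda>x. inv x) ` H \<subseteq> H"
      using H by (auto simp: subgroup.m_inv_closed)
    ultimately show ?thesis
      using closure_of_mono by blast
  qed
  show "a \<otimes> b \<in> T closure_of H" if "a \<in> T closure_of H" "b \<in> T closure_of H" for a b
  proof -
    have "(\<lambda>(x, y). x \<otimes> y) (a, b) \<in> T closure_of ((\<lambda>(x, y). x \<otimes> y) ` (H \<times> H))"
      using continuous_map_image_closure_subset[OF continuous_mult, of "H \<times> H"] that
      by (force simp: closure_of_Times)
    moreover have "(\<lambda>(x, y). x \<otimes> y) ` (H \<times> H) \<subseteq> H"
      using H by (auto simp: subgroup.m_closed)
    ultimately show ?thesis
      using closure_of_mono[of _ H T] by auto
  qed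
qed

lemma normal_closure_of:
  assumes N: "N \<lhd> G"
  shows "T closure_of N \<lhd> G"
proof (rule normal_invI)
  show "subgroup (T closure_of N) G"
    using normal_imp_subgroup[OF N] by (rule subgroup_closure_of)
  fix x h assume x: "x \<in> carrier G" and h: "h \<in> T closure_of N"
  have "continuous_map T T (\<lambda>h. x \<otimes> h \<otimes> inv x)"
    using x by (intro continuous_group_intros) auto
  from continuous_map_image_closure_subset[OF this] h
  have "x \<otimes> h \<otimes> inv x \<in> T closure_of ((\<lambda>h. x \<otimes> h \<otimes> inv x) ` N)"
    by blast
  moreover have "(\<lambda>h. x \<otimes> h \<otimes> inv x) ` N \<subseteq> N"
    using normal_invE(2)[OF N x] by blast
  ultimately show "x \<otimes> h \<otimes> inv x \<in> T closure_of N"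
    using closure_of_mono by blast
qed

end

section \<open>Germs of subgroups at the identity\<close>

text \<open>Containment of germs at \<one>. On closed locally normal subgroups this preorder induces
  the order of the structure lattice, and the equivalence attached to it is
  commensurability.\<close>

definition virtually_contained :: "('a, 'm) monoid_scheme \<Rightarrow> 'a topology \<Rightarrow> 'a set \<Rightarrow> 'a set \<Rightarrow> bool"
  where "virtually_contained G T H K \<longleftrightarrow> (\<exists>A. openin T A \<and> \<one>\<^bsub>G\<^esub> \<in> A \<and> H \<inter> A \<subseteq> K)"

context topological_group
begin

lemma virtually_contained_subset: "H \<subseteq> K \<Longrightarrow> virtually_contained G T H K"
  unfolding virtually_contained_def by (intro exI[of _ "carrier G"]) auto

lemma virtually_contained_trans:
  assumes "virtually_contained G T H K" "virtually_contained G T K L"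
  shows "virtually_contained G T H L"
proof -
  obtain A B where "openin T A" "\<one> \<in> A" "H \<inter> A \<subseteq> K" "openin T B" "\<one> \<in> B" "K \<inter> B \<subseteq> L"
    using assms unfolding virtually_contained_def by blast
  then show ?thesis
    unfolding virtually_contained_def by (intro exI[of _ "A \<inter> B"]) auto
qed

lemma virtually_contained_Int:
  assumes "virtually_contained G T H K" "virtually_contained G T H L"
  shows "virtually_contained G T H (K \<inter> L)"
proof -
  obtain A B where "openin T A" "\<one> \<in> A" "H \<inter> A \<subseteq> K" "openin T B" "\<one> \<in> B" "H \<inter> B \<subseteq> L"
    using assms unfolding virtually_contained_def by blast
  then show ?thesis
    unfolding virtually_contained_def by (intro exI[of _ "A \<inter> B"]) auto
qed

lemma virtually_contained_Int_open:
  "openin T A \<Longrightarrow> \<one> \<in> A \<Longrightarrow> virtually_contained G T H (H \<inter> A)"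
  unfolding virtually_contained_def by blast

lemma virtually_contained_conjugate:
  assumes "virtually_contained G T H K" and g: "g \<in> carrier G"
    and H: "H \<subseteq> carrier G"
  shows "virtually_contained G T (conjugate G g H) (conjugate G g K)"
proof -
  obtain A where A: "openin T A" "\<one> \<in> A" "H \<inter> A \<subseteq> K"
    using assms unfolding virtually_contained_def by blast
  have "conjugate G g H \<inter> conjugate G g A \<subseteq> conjugate G g K"
    using conjugate_mono[OF A(3), of g] conjugate_Int[OF g H openin_subset_carrier[OF A(1)]] by simp
  moreover have "\<one> \<in> conjugate G g A"
    using A(2) conjugate_trivial[OF g] conjugate_mono[of "{\<one>}" A g] by auto
  ultimately show ?thesis
    using A openin_conjugate[OF g A(1)] unfolding virtually_contained_def by blast
qed

lemma openin_Int_iff_virtually_contained: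
  assumes H: "subgroup H G" and K: "subgroup K G"
  shows "openin (subtopology T H) (H \<inter> K) \<longleftrightarrow> virtually_contained G T H K"
proof
  assume "openin (subtopology T H) (H \<inter> K)"
  then obtain A where A: "openin T A" "H \<inter> K = A \<inter> H"
    by (auto simp: openin_subtopology)
  moreover have "\<one> \<in> H \<inter> K"
    using H K by (simp add: subgroup.one_closed)
  ultimately show "virtually_contained G T H K"
    unfolding virtually_contained_def by blast
next
  assume "virtually_contained G T H K"
  then obtain A where A: "openin T A" "\<one> \<in> A" "H \<inter> A \<subseteq> K"
    unfolding virtually_contained_def by blast
  have c: "H \<subseteq> carrier G" "K \<subseteq> carrier G" "A \<subseteq> carrier G"
    using H K A openin_subset_carrier by (auto simp: subgroup.subset)
  \<comment> \<open>Translating the neighbourhood \<open>A\<close> of \<one> by the elements of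
    \<open>H \<inter> K\<close> turns a condition at the identity into an open set that cuts
    \<open>H\<close> exactly in \<open>H \<inter> K\<close>.\<close>
  let ?B = "\<Union>k\<in>H \<inter> K. k <# A"
  have "openin T ?B"
    using c A openin_lcoset by blast
  moreover have "H \<inter> K = ?B \<inter> H"
  proof
    show "H \<inter> K \<subseteq> ?B \<inter> H"
      using A c by (force simp: l_coset_def)
    show "?B \<inter> H \<subseteq> H \<inter> K"
    proof
      fix h assume "h \<in> ?B \<inter> H"
      then obtain k a where h: "h \<in> H" "k \<in> H" "k \<in> K" "a \<in> A" "h = k \<otimes> a"
        by (auto simp: l_coset_def)
      then have "a = inv k \<otimes> h"
        using c by (auto simp: inv_mult_cancel subset_iff)
      moreover have "inv k \<otimes> h \<in> H"
        using h(1,2) H by (simp add: subgroup.m_closed subgroup.m_inv_closed)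
      ultimately have "a \<in> H"
        by simp
      with h A K show "h \<in> H \<inter> K"
        by (auto simp: subgroup.m_closed subset_iff)
    qed
  qed
  ultimately show "openin (subtopology T H) (H \<inter> K)"
    by (auto simp: openin_subtopology)
qed

lemma compact_open_subgroupD:
  assumes "compact_open_subgroup G T U"
  shows "subgroup U G" "compactin T U" "openin T U" "U \<subseteq> carrier G" "\<one> \<in> U" "closedin T U"
  using assms open_subgroup_closed
  by (auto simp: compact_open_subgroup_def subgroup.subset subgroup.one_closed)

text \<open>\<open>W\<close> is the intersection of all conjugates of \<open>U \<inter> V\<close>
  under \<open>U\<close>; it is open because \<open>U\<close> is compact. In a compact group this
  produces arbitrarily small open normal subgroups.\<close>

lemma open_core:
  assumes U: "compact_open_subgroup G T U" and V: "subgroup V G" "openin T V"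
  shows "\<exists>W. compact_open_subgroup G T W \<and> W \<subseteq> U \<inter> V \<and> normalises G U W"
proof -
  note U' = compact_open_subgroupD[OF U]
  define W where "W = {g \<in> carrier G. \<forall>u\<in>U. inv u \<otimes> g \<otimes> u \<in> U \<inter> V}"
  have UV: "subgroup (U \<inter> V) G"
    using U'(1) V(1) by (rule subgroups_Inter_pair)
  have "W \<subseteq> U \<inter> V"
    using U'(5) by (auto simp: W_def)
  have "openin T {g \<in> carrier G. \<forall>u\<in>U. (\<lambda>(g, u). inv u \<otimes> g \<otimes> u) (g, u) \<in> U \<inter> V}"
    unfolding case_prod_unfold using U' V
    by (intro tube openin_Int continuous_group_intros) auto
  then have oW: "openin T W"
    by (simp add: W_def)
  have sW: "subgroup W G"
  proof (rule subgroupI)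
    have "inv u \<otimes> \<one> \<otimes> u = \<one>" if "u \<in> U" for u
      using that U'(4) by auto
    then show "W \<noteq> {}"
      using subgroup.one_closed[OF UV] unfolding W_def by (auto intro!: exI[of _ \<one>])
    show "inv a \<in> W" if a: "a \<in> W" for a
    proof -
      have "inv u \<otimes> inv a \<otimes> u \<in> U \<inter> V" if u: "u \<in> U" for u
      proof -
        have "inv (inv u \<otimes> a \<otimes> u) \<in> U \<inter> V"
          using a u by (intro subgroup.m_inv_closed[OF UV]) (simp only: W_def mem_Collect_eq)
        then show ?thesis
          using a u U'(4) by (auto simp: W_def inv_mult_group m_assoc subset_iff)
      qed
      then show ?thesis
        using a by (auto simp: W_def)
    qed
    show "a \<otimes> b \<in> W" if ab: "a \<in> W" "b \<in> W" for a b
    proof -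
      have "inv u \<otimes> (a \<otimes> b) \<otimes> u \<in> U \<inter> V" if u: "u \<in> U" for u
      proof -
        have "inv u \<otimes> a \<otimes> u \<otimes> (inv u \<otimes> b \<otimes> u) \<in> U \<inter> V"
          using ab u by (intro subgroup.m_closed[OF UV, of "inv u \<otimes> a \<otimes> u" "inv u \<otimes> b \<otimes> u"])
            (simp_all only: W_def mem_Collect_eq)
        then show ?thesis
          using ab u U'(4) by (auto simp: W_def inv_mult_cancel m_assoc subset_iff)
      qed
      then show ?thesis
        using ab by (auto simp: W_def)
    qed
  qed (auto simp: W_def)
  have "normalises G U W"
    unfolding normalises_def
  proof (intro ballI)
    fix v w assume v: "v \<in> U" and w: "w \<in> W"
    have c: "v \<in> carrier G" "w \<in> carrier G"
      using v w U'(4) by (auto simp: W_def)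
    have "inv u \<otimes> (v \<otimes> w \<otimes> inv v) \<otimes> u \<in> U \<inter> V" if u: "u \<in> U" for u
    proof -
      have "inv v \<otimes> u \<in> U"
        using u v U'(1) by (simp add: subgroup.m_closed subgroup.m_inv_closed)
      then have "inv (inv v \<otimes> u) \<otimes> w \<otimes> (inv v \<otimes> u) \<in> U \<inter> V"
        using w by (auto simp: W_def)
      then show ?thesis
        using u c U'(4) by (auto simp: m_assoc inv_mult_group subset_iff)
    qed
    then show "v \<otimes> w \<otimes> inv v \<in> W"
      using c by (simp add: W_def)
  qed
  moreover have "compact_open_subgroup G T W"
    using sW oW open_subgroup_closed[OF sW oW] \<open>W \<subseteq> U \<inter> V\<close> U'(2) closed_compactin
    unfolding compact_open_subgroup_def by blast
  ultimately show ?thesis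
    using \<open>W \<subseteq> U \<inter> V\<close> by blast
qed

end

section \<open>Locally normal subgroups of tdlc groups\<close>

locale tdlc = topological_group +
  assumes totally_disconnected: "totally_disconnected T"
    and locally_compact: "locally_compact_space T"
begin

section \<open>Separation and small compact open subgroups\<close>

lemma closedin_one: "closedin T {\<one>}"
proof -
  have "connected_component_of_set T \<one> = {\<one>}"
    using totally_disconnected by (simp add: totally_disconnected_def topspace_eq)
  then show ?thesis
    using closedin_connected_component_of[of T \<one>] by simp
qed

text \<open>The diagonal is the preimage of the closed set \<open>{\<one>}\<close> under the map
  that sends \<open>(x, y)\<close> to \<open>inv x \<otimes> y\<close>.\<close>

lemma Hausdorff: "Hausdorff_space T"
proof -
  have "continuous_map (prod_topology T T) T (\<lambda>z. inv (fst z) \<otimes> snd z)"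
    by (intro continuous_group_intros)
  from closedin_continuous_map_preimage[OF this closedin_one]
  have "closedin (prod_topology T T) {z \<in> carrier G \<times> carrier G. inv (fst z) \<otimes> snd z = \<one>}"
    by (simp add: topspace_eq)
  moreover have "{z \<in> carrier G \<times> carrier G. inv (fst z) \<otimes> snd z = \<one>} = (\<lambda>x. (x, x)) ` topspace T"
  proof -
    have "inv x \<otimes> y = \<one> \<longleftrightarrow> x = y" if "x \<in> carrier G" "y \<in> carrier G" for x y
      using that by (metis inv_equality inv_inv inv_closed l_inv)
    then show ?thesis
      by (auto simp: topspace_eq image_iff)
  qed
  ultimately show ?thesis
    by (simp add: Hausdorff_space_closedin_diagonal)
qed

lemma compactin_closedin: "compactin T C \<Longrightarrow> closedin T C"
  using compactin_imp_closedin[OF Hausdorff] .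

text \<open>The left stabiliser of a compact open neighbourhood \<open>W\<close> of the identity is an open
  subgroup contained in \<open>W\<close>.\<close>

theorem van_Dantzig:
  assumes A: "openin T A" "\<one> \<in> A"
  shows "\<exists>U. compact_open_subgroup G T U \<and> U \<subseteq> A"
proof -
  have "neighbourhood_base_of (compactin T) T"
    using locally_compact Hausdorff by (simp add: locally_compact_space_neighbourhood_base)
  then obtain B C where BC: "openin T B" "compactin T C" "\<one> \<in> B" "B \<subseteq> C" "C \<subseteq> A"
    using A unfolding neighbourhood_base_of by meson
  let ?X = "subtopology T C"
  have cC: "closedin T C"
    using BC(2) by (rule compactin_closedin)
  \<comment> \<open>A connected set containing \<one> is a singleton, and \<one> is interior to
    \<open>C\<close>, so no connected set joins \<one> to the frontier. The resulting clopen part of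
    \<open>C\<close> avoids the frontier, hence is clopen in the whole space.\<close>
  have "separated_between ?X {\<one>} (T frontier_of C)"
  proof (rule cut_wire_fence_theorem)
    show "compact_space ?X"
      using BC by (simp add: compact_space_subtopology)
    show "Hausdorff_space ?X"
      using Hausdorff by (rule Hausdorff_space_subtopology)
    have "\<one> \<in> C"
      using BC by blast
    then show "closedin ?X {\<one>}"
      by (intro closedin_subset_topspace closedin_one) simp
    show "closedin ?X (T frontier_of C)"
      using cC by (intro closedin_subset_topspace closedin_frontier_of frontier_of_subset_closedin)
    show "disjnt D {\<one>} \<or> disjnt D (T frontier_of C)" if D: "connectedin ?X D" for D
    proof (cases "\<one> \<in> D")
      case True
      have "connectedin T D"
        using D by (simp add: connectedin_subtopology)
      then have "D \<subseteq> connected_component_of_set T \<one>"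
        using True by (meson connected_component_of_maximal)
      then have "D \<subseteq> {\<one>}"
        using totally_disconnected by (simp add: totally_disconnected_def topspace_eq)
      moreover have "\<one> \<in> T interior_of C"
        using interior_of_maximal[OF BC(4,1)] BC(3) by blast
      ultimately show ?thesis
        by (auto simp: disjnt_def frontier_of_def)
    qed (simp add: disjnt_def)
  qed
  then have "separated_between T {\<one>} (topspace T - C)"
    by (rule separated_between_from_frontier_of_closed_subtopology)
  then obtain W where W: "closedin T W" "openin T W" "\<one> \<in> W" "topspace T - C \<subseteq> topspace T - W"
    unfolding separated_between by auto
  have cW: "W \<subseteq> carrier G"
    using W(2) by (rule openin_subset_carrier)
  then have WC: "W \<subseteq> C"
    using W(4) topspace_eq by blast
  then have kW: "compactin T W"
    using closed_compactin[OF BC(2) _ W(1)] by simp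
  let ?f = "\<lambda>z. fst z \<otimes> snd z" and ?f' = "\<lambda>z. inv (fst z) \<otimes> snd z"
  \<comment> \<open>Both \<open>g\<close> and \<open>inv g\<close> are asked to map \<open>W\<close>
    into itself, which makes the set closed under inverses.\<close>
  define U where "U = {g \<in> carrier G. \<forall>w\<in>W. ?f (g, w) \<in> W} \<inter> {g \<in> carrier G. \<forall>w\<in>W. ?f' (g, w) \<in> W}"
  have U_iff: "g \<in> U \<longleftrightarrow> g \<in> carrier G \<and> (\<forall>w\<in>W. g \<otimes> w \<in> W) \<and> (\<forall>w\<in>W. inv g \<otimes> w \<in> W)" for g
    by (auto simp: U_def)
  have oU: "openin T U"
    unfolding U_def using kW W(2) by (intro openin_Int tube continuous_group_intros)
  have UW: "U \<subseteq> W"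
  proof
    fix g assume "g \<in> U"
    then have "g \<in> carrier G" "g \<otimes> \<one> \<in> W"
      using W(3) unfolding U_iff by blast+
    then show "g \<in> W"
      by simp
  qed
  have sU: "subgroup U G"
  proof (rule subgroupI)
    have "\<one> \<in> U"
      using cW by (auto simp: U_iff)
    then show "U \<noteq> {}"
      by blast
    show "a \<otimes> b \<in> U" if "a \<in> U" "b \<in> U" for a b
      using that cW subsetD[OF cW] by (simp add: U_iff m_assoc inv_mult_group)
  qed (auto simp: U_iff)
  have "compactin T U"
    using closed_compactin[OF kW UW open_subgroup_closed[OF sU oU]] .
  then have "compact_open_subgroup G T U"
    using sU oU by (simp add: compact_open_subgroup_def)
  moreover have "U \<subseteq> A"
    using UW WC BC(5) by blast
  ultimately show ?thesis
    by blast
qed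

section \<open>Closure properties of closed locally normal subgroups\<close>

abbreviation cln :: "'a set \<Rightarrow> bool" where
  "cln \<equiv> closed_locally_normal G T"

lemma clnD:
  assumes "cln H"
  shows "subgroup H G" "closedin T H" "H \<subseteq> carrier G" "\<one> \<in> H"
  using assms by (auto simp: closed_locally_normal_def subgroup.subset subgroup.one_closed)

text \<open>Local normality may be tested on any neighbourhood of the identity: it contains a
  compact open subgroup, so the normaliser contains an open subgroup and is open.\<close>

lemma clnI:
  assumes H: "subgroup H G" "closedin T H" and A: "openin T A" "\<one> \<in> A" "normalises G A H"
  shows "cln H"
proof -
  have c: "H \<subseteq> carrier G"
    using H(1) by (rule subgroup.subset)
  obtain V where V: "compact_open_subgroup G T V" "V \<subseteq> A"
    using van_Dantzig A by blast
  note V' = compact_open_subgroupD[OF V(1)]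
  have "normalises G V H"
    using A V by (auto simp: normalises_def)
  then have "V \<subseteq> normalizer G H"
    using V' c conjugate_eqI by (auto simp: normalizer_eq)
  then have "openin T (normalizer G H)"
    using open_subgroupI[OF normalizer_imp_subgroup[OF c]] V' by blast
  with H show ?thesis
    by (simp add: closed_locally_normal_def)
qed

text \<open>Converse to \<open>clnI\<close>, with the normalising group as small as desired; two
  subgroups can therefore be cut down to one open group that normalises both.\<close>

lemma cln_normaliser:
  assumes H: "cln H" and A: "openin T A" "\<one> \<in> A"
  shows "\<exists>V. compact_open_subgroup G T V \<and> V \<subseteq> A \<and> normalises G V H"
proof -
  note c = clnD(3)[OF H]
  have "openin T (A \<inter> normalizer G H)"
    using H A by (auto simp: closed_locally_normal_def)
  moreover have "\<one> \<in> A \<inter> normalizer G H"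
    using A c by (simp add: normalizer_eq conjugate_one)
  ultimately obtain V where V: "compact_open_subgroup G T V" "V \<subseteq> A \<inter> normalizer G H"
    using van_Dantzig by blast
  moreover have "normalises G V H"
    using V c unfolding normalises_def normalizer_eq[OF c] conjugate_def by blast
  ultimately show ?thesis
    by blast
qed

lemma cln_common_normaliser:
  assumes H: "cln H" "cln K" and A: "openin T A" "\<one> \<in> A"
  shows "\<exists>V. compact_open_subgroup G T V \<and> V \<subseteq> A \<and> normalises G V H \<and> normalises G V K"
proof -
  obtain V where V: "compact_open_subgroup G T V" "V \<subseteq> A" "normalises G V H"
    using cln_normaliser[OF H(1) A] by blast
  obtain W where W: "compact_open_subgroup G T W" "W \<subseteq> V" "normalises G W K"
    using cln_normaliser[OF H(2), of V] compact_open_subgroupD[OF V(1)] by blast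
  with V show ?thesis
    by (intro exI[of _ W]) (auto simp: normalises_def)
qed

lemma exists_compact_open: "\<exists>U. compact_open_subgroup G T U"
  using van_Dantzig[of "carrier G"] by auto

lemma cln_open:
  assumes "subgroup H G" "openin T H"
  shows "cln H"
  using assms open_subgroup_closed[OF assms] subgroup.one_closed[OF assms(1)]
  by (intro clnI[of H H]) (auto simp: normalises_def subgroup.m_closed subgroup.m_inv_closed)

lemma cln_trivial: "cln {\<one>}"
  using closedin_one triv_subgroup
  by (intro clnI[of _ "carrier G"]) (auto simp: normalises_def)

lemma cln_carrier: "cln (carrier G)"
  by (intro cln_open subgroup_self openin_carrier)

lemma cln_Int:
  assumes H: "cln H" and K: "cln K"
  shows "cln (H \<inter> K)"
proof -
  obtain V where V: "compact_open_subgroup G T V" "normalises G V H" "normalises G V K"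
    using cln_common_normaliser[OF H K, of "carrier G"] by auto
  have "normalises G V (H \<inter> K)"
    using V by (auto simp: normalises_def)
  with V clnD[OF H] clnD[OF K] compact_open_subgroupD[OF V(1)] show ?thesis
    by (intro clnI[of _ V] subgroups_Inter_pair closedin_Int)
qed

lemma cln_conjugate:
  assumes H: "cln H" and g: "g \<in> carrier G"
  shows "cln (conjugate G g H)"
proof -
  note H' = clnD[OF H]
  obtain V where V: "compact_open_subgroup G T V" "normalises G V H"
    using cln_normaliser[OF H, of "carrier G"] by auto
  note V' = compact_open_subgroupD[OF V(1)]
  have "normalises G (conjugate G g V) (conjugate G g H)"
    unfolding normalises_def
  proof (intro ballI)
    fix v h assume "v \<in> conjugate G g V" "h \<in> conjugate G g H"
    then obtain w k where wk: "w \<in> V" "v = g \<otimes> w \<otimes> inv g" "k \<in> H" "h = g \<otimes> k \<otimes> inv g"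
      by (auto simp: conjugate_def)
    then have "v \<otimes> h \<otimes> inv v = g \<otimes> (w \<otimes> k \<otimes> inv w) \<otimes> inv g"
      using g H'(3) V'(4) by (auto simp: m_assoc inv_mult_cancel inv_mult_group subset_iff)
    then show "v \<otimes> h \<otimes> inv v \<in> conjugate G g H"
      using normalisesD[OF V(2) wk(1,3)] by (simp add: conjugate_def)
  qed
  moreover have "\<one> \<in> conjugate G g V"
    using subgroup.one_closed[OF subgroup_conjugate[OF V'(1) g]] .
  ultimately show ?thesis
    using subgroup_conjugate[OF H'(1) g] closedin_conjugate[OF g H'(2)] openin_conjugate[OF g V'(3)]
    by (intro clnI) auto
qed

lemma centraliser_subgroup:
  assumes K: "K \<subseteq> carrier G"
  shows "subgroup (centraliser G K) G"
proof (rule subgroupI)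
  show "centraliser G K \<noteq> {}"
    using K by (auto simp: centraliser_def subset_iff intro!: exI[of _ \<one>])
  show "inv a \<in> centraliser G K" if a: "a \<in> centraliser G K" for a
  proof -
    have "inv a \<otimes> k = k \<otimes> inv a" if k: "k \<in> K" for k
    proof -
      have c: "a \<in> carrier G" "k \<in> carrier G" and e: "a \<otimes> k = k \<otimes> a"
        using a k K by (auto simp: centraliser_def)
      have "inv a \<otimes> k = inv a \<otimes> (k \<otimes> a) \<otimes> inv a"
        using c by (simp add: m_assoc)
      also have "\<dots> = k \<otimes> inv a"
        using c by (simp add: inv_mult_cancel flip: e)
      finally show ?thesis .
    qed
    with a show ?thesis
      by (auto simp: centraliser_def)
  qed
  show "a \<otimes> b \<in> centraliser G K" if a: "a \<in> centraliser G K" and b: "b \<in> centraliser G K" for a b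
  proof -
    have "a \<otimes> b \<otimes> k = k \<otimes> (a \<otimes> b)" if k: "k \<in> K" for k
    proof -
      have c: "a \<in> carrier G" "b \<in> carrier G" "k \<in> carrier G"
        and e: "a \<otimes> k = k \<otimes> a" "b \<otimes> k = k \<otimes> b"
        using a b k K by (auto simp: centraliser_def)
      have "a \<otimes> b \<otimes> k = a \<otimes> k \<otimes> b"
        using c by (simp add: m_assoc e(2))
      also have "\<dots> = k \<otimes> (a \<otimes> b)"
        using c by (simp add: e(1) m_assoc)
      finally show ?thesis .
    qed
    with a b show ?thesis
      by (auto simp: centraliser_def)
  qed
qed (auto simp: centraliser_def)

lemma closedin_centraliser:
  assumes K: "K \<subseteq> carrier G"
  shows "closedin T (centraliser G K)"
proof -
  have "centraliser G K = carrier G \<inter> (\<Inter>k\<in>K. {g \<in> carrier G. g \<otimes> k = k \<otimes> g})"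
    by (auto simp: centraliser_def)
  moreover have "closedin T {g \<in> carrier G. g \<otimes> k = k \<otimes> g}" if "k \<in> K" for k
  proof -
    have "continuous_map T T (\<lambda>g. g \<otimes> k)" "continuous_map T T (\<lambda>g. k \<otimes> g)"
      using that K by (auto intro!: continuous_group_intros)
    from closedin_continuous_maps_eq[OF Hausdorff this] show ?thesis
      by (simp add: topspace_eq)
  qed
  moreover have "closedin T (carrier G)"
    using closedin_topspace[of T] by (simp add: topspace_eq)
  \<comment> \<open>Over an empty index set the intersection is the whole type, so that case rests
    on the factor \<open>carrier G\<close>.\<close>
  ultimately show ?thesis
    by (cases "K = {}") (auto intro!: closedin_Int closedin_INT)
qed

lemma conjugate_centraliser:
  assumes g: "g \<in> carrier G" and K: "K \<subseteq> carrier G" and c: "c \<in> centraliser G K"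
  shows "g \<otimes> c \<otimes> inv g \<in> centraliser G (conjugate G g K)"
proof -
  have cc: "c \<in> carrier G"
    using c by (simp add: centraliser_def)
  have "g \<otimes> c \<otimes> inv g \<otimes> k = k \<otimes> (g \<otimes> c \<otimes> inv g)" if k': "k \<in> conjugate G g K" for k
  proof -
    obtain l where l: "l \<in> K" "k = g \<otimes> l \<otimes> inv g"
      using k' by (auto simp: conjugate_def)
    have lc: "l \<in> carrier G" and e: "c \<otimes> l = l \<otimes> c"
      using l K c by (auto simp: centraliser_def)
    have "g \<otimes> c \<otimes> inv g \<otimes> k = g \<otimes> (c \<otimes> l) \<otimes> inv g"
      using g cc lc by (simp add: l m_assoc inv_mult_cancel)
    also have "\<dots> = k \<otimes> (g \<otimes> c \<otimes> inv g)"
      using g cc lc by (simp add: l e m_assoc inv_mult_cancel)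
    finally show ?thesis .
  qed
  with g cc show ?thesis
    by (simp add: centraliser_def)
qed

text \<open>A group that normalises \<open>K\<close> permutes the elements of \<open>K\<close> and
  hence preserves the centraliser of \<open>K\<close>.\<close>

lemma cln_centraliser:
  assumes K: "cln K"
  shows "cln (centraliser G K)"
proof -
  note K' = clnD[OF K]
  obtain V where V: "compact_open_subgroup G T V" "normalises G V K"
    using cln_normaliser[OF K, of "carrier G"] by auto
  note V' = compact_open_subgroupD[OF V(1)]
  have "normalises G V (centraliser G K)"
    unfolding normalises_def
  proof (intro ballI)
    fix v c assume v: "v \<in> V" and c: "c \<in> centraliser G K"
    then have "v \<otimes> c \<otimes> inv v \<in> centraliser G (conjugate G v K)"
      using K' V' by (intro conjugate_centraliser) auto
    then show "v \<otimes> c \<otimes> inv v \<in> centraliser G K"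
      using conjugate_eqI[OF V'(1) V(2) v K'(3)] by simp
  qed
  then show ?thesis
    using centraliser_subgroup[OF K'(3)] closedin_centraliser[OF K'(3)] V' by (intro clnI)
qed

section \<open>The structure lattice in terms of representatives\<close>

lemma commensurability_iff:
  "(H, K) \<in> commensurability G T \<longleftrightarrow>
     cln H \<and> cln K \<and> virtually_contained G T H K \<and> virtually_contained G T K H"
  using openin_Int_iff_virtually_contained[OF clnD(1) clnD(1), of H K]
    openin_Int_iff_virtually_contained[OF clnD(1) clnD(1), of K H]
  by (auto simp: commensurability_def Int_commute)

lemma equiv_commensurability: "equiv {H. cln H} (commensurability G T)"
proof (rule equivI)
  show "commensurability G T \<subseteq> {H. cln H} \<times> {H. cln H}"
    by (auto simp: commensurability_iff)
  show "refl_on {H. cln H} (commensurability G T)"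
    by (auto simp: refl_on_def commensurability_iff virtually_contained_subset)
  show "sym (commensurability G T)"
    by (auto simp: sym_def commensurability_iff)
  show "trans (commensurability G T)"
    unfolding trans_def commensurability_iff by (blast intro: virtually_contained_trans)
qed

lemma local_class_eq_iff:
  assumes "cln H" "cln K"
  shows "local_class G T H = local_class G T K \<longleftrightarrow>
    virtually_contained G T H K \<and> virtually_contained G T K H"
  using eq_equiv_class_iff[OF equiv_commensurability, of H K] assms
  by (simp add: local_class_def commensurability_iff)

lemma mem_local_class_iff:
  "K \<in> local_class G T H \<longleftrightarrow>
    cln H \<and> cln K \<and> virtually_contained G T H K \<and> virtually_contained G T K H"
  by (simp add: local_class_def commensurability_iff)

lemma carrier_LN: "carrier (LN G T) = local_class G T ` {H. cln H}"
  by (auto simp: LN_def quotient_def local_class_def)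

text \<open>If the germ of \<open>H\<close> is contained in that of \<open>K\<close>, then
  \<open>H \<inter> K\<close> is commensurate with \<open>H\<close>, and
  \<open>H \<inter> K\<close>, \<open>K\<close> are the representatives that the order asks
  for.\<close>

lemma LN_le_iff:
  assumes H: "cln H" and K: "cln K"
  shows "local_class G T H \<sqsubseteq>\<^bsub>LN G T\<^esub> local_class G T K \<longleftrightarrow> virtually_contained G T H K"
proof -
  have "(\<exists>H'\<in>local_class G T H. \<exists>K'\<in>local_class G T K. H' \<subseteq> K') \<longleftrightarrow> virtually_contained G T H K"
  proof
    assume "\<exists>H'\<in>local_class G T H. \<exists>K'\<in>local_class G T K. H' \<subseteq> K'"
    then obtain H' K' where "virtually_contained G T H H'" "H' \<subseteq> K'" "virtually_contained G T K' K"
      by (auto simp: mem_local_class_iff)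
    then show "virtually_contained G T H K"
      by (meson virtually_contained_trans virtually_contained_subset)
  next
    assume HK: "virtually_contained G T H K"
    then have "H \<inter> K \<in> local_class G T H" "K \<in> local_class G T K"
      using H K by (auto simp: mem_local_class_iff cln_Int virtually_contained_Int virtually_contained_subset)
    then show "\<exists>H'\<in>local_class G T H. \<exists>K'\<in>local_class G T K. H' \<subseteq> K'"
      by blast
  qed
  then show ?thesis
    by (simp add: LN_def)
qed

text \<open>Any two compact open subgroups contain each other near \<one>, so the definite
  description is satisfied by one class only.\<close>

lemma LN_infty_eq:
  assumes U: "compact_open_subgroup G T U"
  shows "LN_infty G T = local_class G T U"
  unfolding LN_infty_def
proof (rule the_equality)
  fix \<alpha> assume "\<exists>V. compact_open_subgroup G T V \<and> \<alpha> = local_class G T V"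
  then obtain V where V: "compact_open_subgroup G T V" "\<alpha> = local_class G T V"
    by blast
  have "virtually_contained G T A B" if "compact_open_subgroup G T A" "compact_open_subgroup G T B" for A B
    using compact_open_subgroupD[OF that(2)] unfolding virtually_contained_def by blast
  then show "\<alpha> = local_class G T U"
    using U V compact_open_subgroupD cln_open by (simp add: local_class_eq_iff)
qed (use U in blast)

text \<open>Only germs at \<one> matter within a class: commensurability with a compact open
  subgroup means being a neighbourhood of \<one>, hence open. In particular \<open>carrier G\<close>
  represents \<infinity> even when it is not compact.\<close>

lemma LN_infty_iff:
  assumes H: "cln H"
  shows "local_class G T H = LN_infty G T \<longleftrightarrow> openin T H"
proof -
  obtain U where U: "compact_open_subgroup G T U"
    using exists_compact_open by blast
  note U' = compact_open_subgroupD[OF U]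
  have "local_class G T H = LN_infty G T \<longleftrightarrow>
      virtually_contained G T H U \<and> virtually_contained G T U H"
    using H U' cln_open by (simp add: LN_infty_eq[OF U] local_class_eq_iff)
  also have "\<dots> \<longleftrightarrow> openin T H"
  proof
    assume "virtually_contained G T H U \<and> virtually_contained G T U H"
    then obtain A where "openin T A" "\<one> \<in> A" "U \<inter> A \<subseteq> H"
      unfolding virtually_contained_def by blast
    then show "openin T H"
      using U' clnD[OF H] open_subgroupI[of H "U \<inter> A"] by auto
  next
    assume "openin T H"
    then show "virtually_contained G T H U \<and> virtually_contained G T U H"
      using U' clnD[OF H] unfolding virtually_contained_def by blast
  qed
  finally show ?thesis .
qed

lemma LN_infty_in_carrier: "LN_infty G T \<in> carrier (LN G T)"
  using exists_compact_open compact_open_subgroupD cln_open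
  by (auto simp: carrier_LN LN_infty_eq)

lemma LN_zero_in_carrier: "LN_zero G T \<in> carrier (LN G T)"
  using cln_trivial by (auto simp: carrier_LN LN_zero_def)

lemma LN_zero_le: "\<alpha> \<in> carrier (LN G T) \<Longrightarrow> LN_zero G T \<sqsubseteq>\<^bsub>LN G T\<^esub> \<alpha>"
  using cln_trivial clnD(4)
  by (auto simp: carrier_LN LN_zero_def LN_le_iff intro!: virtually_contained_subset)

lemma local_class_carrier: "local_class G T (carrier G) = LN_infty G T"
  using LN_infty_iff[OF cln_carrier] by simp

lemma le_LN_infty: "\<alpha> \<in> carrier (LN G T) \<Longrightarrow> \<alpha> \<sqsubseteq>\<^bsub>LN G T\<^esub> LN_infty G T"
  using cln_carrier clnD(3)
  by (auto simp: carrier_LN LN_le_iff virtually_contained_subset simp flip: local_class_carrier)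

lemma LN_antisym:
  assumes "\<alpha> \<in> carrier (LN G T)" "\<beta> \<in> carrier (LN G T)" "\<alpha> \<sqsubseteq>\<^bsub>LN G T\<^esub> \<beta>" "\<beta> \<sqsubseteq>\<^bsub>LN G T\<^esub> \<alpha>"
  shows "\<alpha> = \<beta>"
proof -
  obtain H K where "cln H" "\<alpha> = local_class G T H" "cln K" "\<beta> = local_class G T K"
    using assms(1,2) by (auto simp: carrier_LN)
  with assms(3,4) show ?thesis
    by (simp add: LN_le_iff local_class_eq_iff)
qed

text \<open>The meet is defined as some greatest lower bound. Antisymmetry makes it unique, and the
  class of \<open>H \<inter> K\<close> is one because virtual containment respects
  intersections.\<close>

lemma LN_meet:
  assumes H: "cln H" and K: "cln K"
  shows "local_class G T H \<sqinter>\<^bsub>LN G T\<^esub> local_class G T K = local_class G T (H \<inter> K)"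
proof -
  let ?L = "LN G T" and ?c = "local_class G T"
  have Lower: "Lower ?L {?c H, ?c K} = {x \<in> carrier ?L. x \<sqsubseteq>\<^bsub>?L\<^esub> ?c H \<and> x \<sqsubseteq>\<^bsub>?L\<^esub> ?c K}"
    using H K by (auto simp: Lower_def carrier_LN)
  have g: "greatest ?L (?c (H \<inter> K)) (Lower ?L {?c H, ?c K})"
    unfolding greatest_def Lower using cln_Int[OF H K] H K
    by (auto simp: carrier_LN LN_le_iff intro: virtually_contained_Int virtually_contained_subset)
  then have "x = ?c (H \<inter> K)" if "greatest ?L x (Lower ?L {?c H, ?c K})" for x
    using that unfolding greatest_def Lower by (intro LN_antisym) auto
  with g show ?thesis
    unfolding meet_def inf_def by (rule someI2)
qed

text \<open>The commutator map \<open>v \<mapsto> [d, v]\<close> takes values in \<open>L\<close> on the normaliser of \<open>L\<close>, and it is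
  continuous with value \<open>1\<close> at \<open>1\<close>.\<close>

lemma commutator_near_one:
  assumes L: "cln L" and d: "d \<in> L" and A: "openin T A" "\<one> \<in> A"
  shows "\<exists>V. compact_open_subgroup G T V \<and> (\<forall>v\<in>V. d \<otimes> v \<otimes> inv d \<otimes> inv v \<in> L \<inter> A)"
proof -
  note L' = clnD[OF L]
  have dc: "d \<in> carrier G"
    using d L' by blast
  let ?B = "{v \<in> carrier G. d \<otimes> v \<otimes> inv d \<otimes> inv v \<in> A}"
  have "openin T ?B"
    using dc A by (intro openin_preimage continuous_group_intros) auto
  moreover have "\<one> \<in> ?B"
    using dc A by simp
  ultimately obtain V where V: "compact_open_subgroup G T V" "V \<subseteq> ?B" "normalises G V L"
    using cln_normaliser[OF L] by blast
  have "d \<otimes> v \<otimes> inv d \<otimes> inv v \<in> L" if v: "v \<in> V" for v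
  proof -
    have "v \<otimes> inv d \<otimes> inv v \<in> L"
      using normalisesD[OF V(3) v subgroup.m_inv_closed[OF L'(1) d]] .
    then have "d \<otimes> (v \<otimes> inv d \<otimes> inv v) \<in> L"
      using d L' by (simp add: subgroup.m_closed)
    then show ?thesis
      using dc v compact_open_subgroupD(4)[OF V(1)] by (auto simp: m_assoc subset_iff)
  qed
  with V show ?thesis
    by blast
qed

end

section \<open>Simple groups\<close>

locale simple_tdlc = tdlc +
  assumes nondiscrete: "T \<noteq> discrete_topology (carrier G)"
    and compactly_generated: "compactly_generated G T"
    and topologically_simple: "topologically_simple G T"
begin

section \<open>Non-discreteness, non-compactness and generation\<close>

lemma not_openin_one: "\<not> openin T {\<one>}"
proof
  assume o: "openin T {\<one>}"
  have "openin T {g}" if "g \<in> carrier G" for g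
    using openin_lcoset[OF that o] that by (simp add: l_coset_def)
  then have "discrete_topology (carrier G) = T"
    by (simp add: discrete_topology_unique topspace_eq)
  then show False
    using nondiscrete by simp
qed

lemma closed_normal_cases: "N \<lhd> G \<Longrightarrow> closedin T N \<Longrightarrow> N = {\<one>} \<or> N = carrier G"
  using topologically_simple by (simp add: topologically_simple_def)

text \<open>In a compact group \<open>open_core\<close> gives an open normal subgroup inside any
  open subgroup; simplicity and non-discreteness leave no room for a proper one.\<close>

lemma not_compact: "\<not> compactin T (carrier G)"
proof
  assume "compactin T (carrier G)"
  then have c: "compact_open_subgroup G T (carrier G)"
    by (simp add: compact_open_subgroup_def subgroup_self)
  \<comment> \<open>The open normal subgroup will avoid \<open>x\<close>, which keeps it
    proper.\<close>
  obtain x where x: "x \<in> carrier G" "x \<noteq> \<one>"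
    using topologically_simple one_closed unfolding topologically_simple_def by blast
  have "closedin T {x}"
    using x closedin_lcoset[OF x(1) closedin_one] by (simp add: l_coset_def)
  then have "openin T (carrier G - {x})"
    using openin_diff[OF openin_carrier] by blast
  moreover have "\<one> \<in> carrier G - {x}"
    using x by simp
  ultimately obtain U where U: "compact_open_subgroup G T U" "U \<subseteq> carrier G - {x}"
    using van_Dantzig by blast
  note U' = compact_open_subgroupD[OF U(1)]
  obtain W where W: "compact_open_subgroup G T W" "W \<subseteq> carrier G \<inter> U" "normalises G (carrier G) W"
    using open_core[OF c U'(1,3)] by blast
  note W' = compact_open_subgroupD[OF W(1)]
  have "W \<lhd> G"
    using W'(1) W(3) by (intro normal_invI) (auto simp: normalises_def)
  then have "W = {\<one>} \<or> W = carrier G"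
    using W'(6) by (rule closed_normal_cases)
  then show False
    using W'(3) not_openin_one W(2) U(2) x(1) by blast
qed

text \<open>Finitely many cosets \<open>f <# U\<close> cover a compact generating set. Each is a
  non-empty open set, so it contains an element of the dense set \<open>D\<close>, which represents
  the same coset and can replace \<open>f\<close>.\<close>

lemma finitely_generated_over_open:
  assumes U: "compact_open_subgroup G T U" and D: "D \<subseteq> carrier G" "T closure_of D = carrier G"
  shows "\<exists>S. finite S \<and> S \<subseteq> D \<and> generate G (U \<union> S) = carrier G"
proof -
  note U' = compact_open_subgroupD[OF U]
  obtain K where K: "compactin T K" "generate G K = carrier G"
    using compactly_generated unfolding compactly_generated_def by blast
  have Kc: "K \<subseteq> carrier G"
    using compactin_subset_topspace[OF K(1)] topspace_eq by simp
  obtain F where F: "finite F" "F \<subseteq> K" "K \<subseteq> (\<Union>f\<in>F. f <# U)"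
    using finite_cosets_cover[OF K(1) U'(3,5)] by blast
  have "\<exists>s u. s \<in> D \<and> u \<in> U \<and> s = f \<otimes> u" if f: "f \<in> F" for f
  proof -
    have fc: "f \<in> carrier G"
      using f F Kc by blast
    have "openin T (f <# U)"
      using fc U'(3) by (rule openin_lcoset)
    moreover have "f <# U \<noteq> {}"
      using U'(5) by (auto simp: l_coset_def)
    ultimately have "D \<inter> (f <# U) \<noteq> {}"
      using D(2) dense_intersects_open[of T D] topspace_eq by auto
    then show ?thesis
      by (auto simp: l_coset_def)
  qed
  then obtain s u where su: "\<And>f. f \<in> F \<Longrightarrow> s f \<in> D \<and> u f \<in> U \<and> s f = f \<otimes> u f"
    by metis
  let ?S = "s ` F"
  have S: "?S \<subseteq> D"
    using su by blast
  have c: "U \<union> ?S \<subseteq> carrier G"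
    using U' S D by blast
  then have sg: "subgroup (generate G (U \<union> ?S)) G"
    by (rule generate_is_subgroup)
  have "K \<subseteq> generate G (U \<union> ?S)"
  proof
    fix k assume "k \<in> K"
    then obtain f v where f: "f \<in> F" "v \<in> U" "k = f \<otimes> v"
      using F by (auto simp: l_coset_def)
    have fc: "f \<in> carrier G" "v \<in> carrier G" "u f \<in> carrier G"
      using f F Kc U' su by blast+
    have "f = s f \<otimes> inv (u f)"
      using su[OF f(1)] fc by (simp add: m_assoc)
    moreover have "s f \<otimes> inv (u f) \<otimes> v \<in> generate G (U \<union> ?S)"
      using f(1,2) su[OF f(1)]
      by (intro subgroup.m_closed[OF sg] subgroup.m_inv_closed[OF sg] generate.incl UnI1 UnI2 imageI) auto
    ultimately show "k \<in> generate G (U \<union> ?S)"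
      using f(3) by simp
  qed
  then have "generate G K \<subseteq> generate G (U \<union> ?S)"
    using sg by (rule generate_subgroup_incl)
  then have "generate G (U \<union> ?S) = carrier G"
    using K(2) generate_incl[OF c] by blast
  then show ?thesis
    using F(1) S by blast
qed

text \<open>The union \<open>M\<close> of all centralisers of members of \<open>\<B>\<close> is a normal subgroup. If it were
  dense, then \<open>G\<close> would be generated by a compact open subgroup \<open>U\<close> and finitely many elements of
  \<open>M\<close>; a \<open>U\<close>-invariant member of \<open>\<B>\<close> inside \<open>U\<close> centralised by these elements would then be a
  compact normal subgroup of \<open>G\<close>.\<close>

lemma centraliser_trivial_of_family:
  assumes cln: "\<And>B. B \<in> \<B> \<Longrightarrow> cln B"
    and nontrivial: "{\<one>} \<notin> \<B>"
    and conj: "\<And>B g. B \<in> \<B> \<Longrightarrow> g \<in> carrier G \<Longrightarrow> conjugate G g B \<in> \<B>"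
    and Int: "\<And>B C. B \<in> \<B> \<Longrightarrow> C \<in> \<B> \<Longrightarrow> B \<inter> C \<in> \<B>"
    and compact_open: "\<And>U. compact_open_subgroup G T U \<Longrightarrow> U \<in> \<B>"
    and B: "B \<in> \<B>"
  shows "centraliser G B = {\<one>}"
proof (rule ccontr)
  assume B1: "centraliser G B \<noteq> {\<one>}"
  define M where "M = (\<Union>B\<in>\<B>. centraliser G B)"
  have sub: "C \<subseteq> carrier G" if "C \<in> \<B>" for C
    using clnD(3)[OF cln[OF that]] .
  have sg: "subgroup (centraliser G C) G" if "C \<in> \<B>" for C
    using centraliser_subgroup[OF sub[OF that]] .
  have Mc: "M \<subseteq> carrier G"
    by (auto simp: M_def centraliser_def)
  have "M \<lhd> G"
  proof (intro normal_invI subgroupI)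
    show "M \<noteq> {}"
      using subgroup.one_closed[OF sg[OF B]] B unfolding M_def by blast
    show "inv a \<in> M" if "a \<in> M" for a
      using that subgroup.m_inv_closed[OF sg] unfolding M_def by blast
    show "a \<otimes> b \<in> M" if ab: "a \<in> M" "b \<in> M" for a b
    proof -
      obtain C D where CD: "C \<in> \<B>" "D \<in> \<B>" "a \<in> centraliser G C" "b \<in> centraliser G D"
        using ab unfolding M_def by blast
      then have "a \<in> centraliser G (C \<inter> D)" "b \<in> centraliser G (C \<inter> D)"
        by (auto simp: centraliser_def)
      then show ?thesis
        using subgroup.m_closed[OF sg] Int[OF CD(1,2)] unfolding M_def by blast
    qed
    show "x \<otimes> h \<otimes> inv x \<in> M" if xh: "x \<in> carrier G" "h \<in> M" for x h
    proof -
      obtain C where C: "C \<in> \<B>" "h \<in> centraliser G C"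
        using xh unfolding M_def by blast
      then show ?thesis
        using conjugate_centraliser[OF xh(1) sub C(2)] conj[OF C(1) xh(1)] unfolding M_def by blast
    qed
  qed (rule Mc)
  then have "T closure_of M \<lhd> G"
    by (rule normal_closure_of)
  then have "T closure_of M = {\<one>} \<or> T closure_of M = carrier G"
    using closedin_closure_of by (rule closed_normal_cases)
  moreover have "M \<subseteq> T closure_of M"
    using Mc by (simp add: closure_of_subset topspace_eq)
  moreover have "\<one> \<in> centraliser G B" "centraliser G B \<subseteq> M"
    using subgroup.one_closed[OF sg[OF B]] B unfolding M_def by blast+
  ultimately have dense: "T closure_of M = carrier G"
    using B1 by blast
  obtain U where U: "compact_open_subgroup G T U"
    using exists_compact_open by blast
  note U' = compact_open_subgroupD[OF U]
  obtain S where S: "finite S" "S \<subseteq> M" "generate G (U \<union> S) = carrier G"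
    using finitely_generated_over_open[OF U Mc dense] by blast
  have "\<exists>C. C \<in> \<B> \<and> s \<in> centraliser G C" if "s \<in> S" for s
    using S(2) that unfolding M_def by blast
  then obtain C where C: "\<And>s. s \<in> S \<Longrightarrow> C s \<in> \<B> \<and> s \<in> centraliser G (C s)"
    by metis
  \<comment> \<open>Starting from \<open>U\<close> keeps the intersection inside \<open>U\<close>
    and makes the intersection over the empty set a member of the family.\<close>
  have finite_Int: "U \<inter> (\<Inter>s\<in>S. f s) \<in> \<B>" if "finite S" "\<And>s. s \<in> S \<Longrightarrow> f s \<in> \<B>" for S and f :: "'a \<Rightarrow> 'a set"
    using that
  proof (induction S rule: finite_induct)
    case empty
    show ?case
      using compact_open[OF U] by simp
  next
    case (insert x F)
    then have "f x \<inter> (U \<inter> (\<Inter>s\<in>F. f s)) \<in> \<B>"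
      by (intro Int[of "f x" "U \<inter> (\<Inter>s\<in>F. f s)"]) auto
    moreover have "f x \<inter> (U \<inter> (\<Inter>s\<in>F. f s)) = U \<inter> (\<Inter>s\<in>insert x F. f s)"
      by auto
    ultimately show ?case
      by simp
  qed
  define B0 where "B0 = U \<inter> (\<Inter>s\<in>S. C s)"
  have B0: "B0 \<in> \<B>"
    unfolding B0_def using C by (intro finite_Int S) auto
  obtain V where V: "compact_open_subgroup G T V" "V \<subseteq> U" "normalises G V B0"
    using cln_normaliser[OF cln[OF B0] U'(3,5)] by blast
  note V' = compact_open_subgroupD[OF V(1)]
  obtain F where F: "finite F" "F \<subseteq> U" "U \<subseteq> (\<Union>f\<in>F. f <# V)"
    using finite_cosets_cover[OF U'(2) V'(3,5)] by blast
  \<comment> \<open>This is the intersection of all conjugates of \<open>B0\<close> under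
    \<open>U\<close>. Since \<open>V\<close> normalises \<open>B0\<close>, the finitely many
    representatives of \<open>U\<close> modulo \<open>V\<close> give all of them, so
    \<open>B'\<close> is again a member of the family.\<close>
  define B' where "B' = U \<inter> (\<Inter>f\<in>F. conjugate G f B0)"
  have B': "B' \<in> \<B>"
    unfolding B'_def using F U' B0 by (intro finite_Int conj) auto
  have in_conj: "b \<in> conjugate G u B0" if b: "b \<in> B'" and u: "u \<in> U" for b u
  proof -
    obtain f v where f: "f \<in> F" "v \<in> V" "u = f \<otimes> v"
      using F(3) u by (auto simp: l_coset_def)
    then have "f \<in> carrier G" "v \<in> carrier G"
      using F U' V' by blast+
    then have "conjugate G u B0 = conjugate G f B0"
      using conjugate_mult[of f v B0] conjugate_eqI[OF V'(1) V(3) f(2) sub[OF B0]] sub[OF B0] f(3)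
      by simp
    then show ?thesis
      using b f by (auto simp: B'_def)
  qed
  have "normalises G U B'"
    unfolding normalises_def
  proof (intro ballI)
    fix u b assume u: "u \<in> U" and b: "b \<in> B'"
    have c: "u \<in> carrier G" "b \<in> carrier G" "b \<in> U"
      using u b U' by (auto simp: B'_def)
    have "u \<otimes> b \<otimes> inv u \<in> conjugate G w B0" if w: "w \<in> U" for w
    proof -
      have wc: "w \<in> carrier G"
        using w U' by blast
      have "inv u \<otimes> w \<in> U"
        using u w U'(1) by (simp add: subgroup.m_closed subgroup.m_inv_closed)
      then have "inv (inv u \<otimes> w) \<otimes> b \<otimes> (inv u \<otimes> w) \<in> B0"
        using in_conj[OF b] mem_conjugate_iff[of "inv u \<otimes> w" B0 b] c wc sub[OF B0] by simp
      then show ?thesis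
        using mem_conjugate_iff[of w B0 "u \<otimes> b \<otimes> inv u"] c wc sub[OF B0]
        by (simp add: m_assoc inv_mult_group)
    qed
    moreover have "u \<otimes> b \<otimes> inv u \<in> U"
      using u c U'(1) by (simp add: subgroup.m_closed subgroup.m_inv_closed)
    ultimately show "u \<otimes> b \<otimes> inv u \<in> B'"
      using F(2) by (auto simp: B'_def)
  qed
  then have inv_U: "conjugate G u B' = B'" if "u \<in> U" for u
    using that sub[OF B'] by (intro conjugate_eqI[OF U'(1)])
  \<comment> \<open>\<open>B'\<close> is contained in \<open>B0\<close>, hence in every
    \<open>C s\<close>, and so each element of \<open>S\<close> fixes it pointwise.\<close>
  have inv_S: "conjugate G s B' = B'" if s: "s \<in> S" for s
  proof -
    have sc: "s \<in> carrier G"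
      using s S Mc by blast
    have "s \<otimes> b \<otimes> inv s = b" if b: "b \<in> B'" for b
    proof -
      have "b \<in> B0"
        using in_conj[OF b U'(5)] conjugate_one[OF sub[OF B0]] by simp
      then have "b \<in> C s"
        using s by (simp add: B0_def)
      then have "s \<otimes> b = b \<otimes> s"
        using C[OF s] by (auto simp: centraliser_def)
      then show ?thesis
        using sc b sub[OF B'] by (auto simp: m_assoc)
    qed
    then show ?thesis
      by (simp add: conjugate_def)
  qed
  have "B' \<lhd> G"
    using inv_U inv_S clnD(1)[OF cln[OF B']] by (intro normal_if_generated[OF S(3)]) auto
  then have "B' = {\<one>} \<or> B' = carrier G"
    using clnD(2)[OF cln[OF B']] by (rule closed_normal_cases)
  \<comment> \<open>As a member of the family \<open>B'\<close> is not trivial, and it is contained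
    in \<open>U\<close>.\<close>
  then have "U = carrier G"
    using B' nontrivial U'(4) by (auto simp: B'_def)
  then show False
    using U'(2) not_compact by simp
qed

section \<open>Trivial quasi-centre and its consequences\<close>

theorem centraliser_open_trivial:
  assumes "subgroup U G" "openin T U"
  shows "centraliser G U = {\<one>}"
proof (rule centraliser_trivial_of_family)
  let ?\<B> = "{B. subgroup B G \<and> openin T B}"
  show "{\<one>} \<notin> ?\<B>"
    using not_openin_one by simp
  show "B \<in> ?\<B> \<Longrightarrow> g \<in> carrier G \<Longrightarrow> conjugate G g B \<in> ?\<B>" for B g
    by (simp add: subgroup_conjugate openin_conjugate)
  show "B \<in> ?\<B> \<Longrightarrow> C \<in> ?\<B> \<Longrightarrow> B \<inter> C \<in> ?\<B>" for B C
    by (simp add: subgroups_Inter_pair openin_Int)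
qed (use assms in \<open>auto simp: cln_open compact_open_subgroupD\<close>)

lemma commutes_near_one_trivial:
  assumes "g \<in> carrier G" "openin T A" "\<one> \<in> A" "\<And>a. a \<in> A \<Longrightarrow> g \<otimes> a = a \<otimes> g"
  shows "g = \<one>"
proof -
  obtain V where V: "compact_open_subgroup G T V" "V \<subseteq> A"
    using van_Dantzig assms by blast
  then have "g \<in> centraliser G V"
    using assms by (auto simp: centraliser_def)
  then show ?thesis
    using centraliser_open_trivial compact_open_subgroupD[OF V(1)] by simp
qed

text \<open>For \<open>d\<close> in \<open>H\<close> and \<open>v\<close> near \<one>, the
  commutator of \<open>d\<close> and \<open>v\<close> lies in \<open>H\<close> and is close to
  \<one>, so discreteness makes it trivial. Thus \<open>d\<close> commutes with a neighbourhood of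
  \<one>, and such an element is \<one>.\<close>

lemma discrete_cln_trivial:
  assumes H: "cln H" and discrete: "virtually_contained G T H {\<one>}"
  shows "H = {\<one>}"
proof -
  obtain A where A: "openin T A" "\<one> \<in> A" "H \<inter> A \<subseteq> {\<one>}"
    using discrete unfolding virtually_contained_def by blast
  have "d = \<one>" if d: "d \<in> H" for d
  proof -
    obtain V where V: "compact_open_subgroup G T V" "\<And>v. v \<in> V \<Longrightarrow> d \<otimes> v \<otimes> inv d \<otimes> inv v \<in> H \<inter> A"
      using commutator_near_one[OF H d A(1,2)] by blast
    note V' = compact_open_subgroupD[OF V(1)]
    have dc: "d \<in> carrier G"
      using d clnD(3)[OF H] by blast
    have "d \<otimes> v = v \<otimes> d" if v: "v \<in> V" for v
    proof -
      have vc: "v \<in> carrier G"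
        using v V' by blast
      have "d \<otimes> v \<otimes> inv d \<otimes> inv v = \<one>"
        using V(2)[OF v] A(3) by blast
      then have "d \<otimes> v \<otimes> inv (v \<otimes> d) = \<one>"
        using dc vc by (simp add: inv_mult_group m_assoc)
      then show ?thesis
        using dc vc by (metis inv_equality inv_inv m_closed inv_closed)
    qed
    then show ?thesis
      using commutes_near_one_trivial[OF dc V'(3,5)] by blast
  qed
  then show ?thesis
    using clnD(4)[OF H] by blast
qed

text \<open>The class 0 has \<open>{\<one>}\<close> as its only member, so whether two classes have
  meet 0 can be settled on arbitrary representatives.\<close>

lemma LN_zero_iff:
  assumes H: "cln H"
  shows "local_class G T H = LN_zero G T \<longleftrightarrow> H = {\<one>}"
  using discrete_cln_trivial[OF H] H
  by (auto simp: LN_zero_def local_class_eq_iff cln_trivial virtually_contained_subset)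

lemma zero_neq_infty: "LN_zero G T \<noteq> LN_infty G T"
  using LN_infty_iff[OF cln_trivial] not_openin_one by (simp add: LN_zero_def)

lemma Int_open_nontrivial:
  assumes H: "cln H" "H \<noteq> {\<one>}" and V: "compact_open_subgroup G T V"
  shows "H \<inter> V \<noteq> {\<one>}"
proof
  note V' = compact_open_subgroupD[OF V]
  assume "H \<inter> V = {\<one>}"
  then have "virtually_contained G T H {\<one>}"
    using virtually_contained_Int_open[OF V'(3,5), of H] by simp
  then show False
    using discrete_cln_trivial[OF H(1)] H(2) by simp
qed

section \<open>The centraliser lattice\<close>

text \<open>In the lattice: any two non-zero elements have a non-zero meet. In the present form it
  is the closure under intersection that the centraliser argument demands of the family of all
  non-trivial closed locally normal subgroups.\<close>

definition uniform :: bool where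
  "uniform \<longleftrightarrow> (\<forall>H K. cln H \<longrightarrow> cln K \<longrightarrow> H \<inter> K = {\<one>} \<longrightarrow> H = {\<one>} \<or> K = {\<one>})"

lemma zero_infty_in_LC: "{LN_zero G T, LN_infty G T} \<subseteq> LC G T"
proof -
  have "centraliser G {\<one>} = carrier G"
    by (auto simp: centraliser_def)
  then have "LN_infty G T \<in> LC G T"
    using cln_trivial local_class_carrier unfolding LC_def by (intro CollectI exI[of _ "{\<one>}"]) simp
  moreover have "centraliser G (carrier G) = {\<one>}"
    by (intro centraliser_open_trivial subgroup_self openin_carrier)
  then have "LN_zero G T \<in> LC G T"
    using cln_carrier unfolding LC_def LN_zero_def by (intro CollectI exI[of _ "carrier G"]) simp
  ultimately show ?thesis
    by simp
qed

text \<open>If non-trivial \<open>H\<close> and \<open>K\<close> meet trivially, suitable open parts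
  of them commute, so the centraliser of such a part of \<open>H\<close> is non-trivial. Were it
  open, every element of that part would commute with a neighbourhood of \<one>. For the converse,
  uniformity lets the centraliser argument run with all non-trivial closed locally normal
  subgroups.\<close>

lemma LC_trivial_iff: "LC G T = {LN_zero G T, LN_infty G T} \<longleftrightarrow> uniform"
proof
  assume LC: "LC G T = {LN_zero G T, LN_infty G T}"
  show uniform
    unfolding uniform_def
  proof (intro allI impI, rule ccontr)
    fix H K assume H: "cln H" and K: "cln K" and HK: "H \<inter> K = {\<one>}" and n: "\<not> (H = {\<one>} \<or> K = {\<one>})"
    obtain V where V: "compact_open_subgroup G T V" "normalises G V H" "normalises G V K"
      using cln_common_normaliser[OF H K, of "carrier G"] by auto
    note V' = compact_open_subgroupD[OF V(1)]
    note cV = cln_open[OF V'(1,3)]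
    \<comment> \<open>\<open>V\<close> normalises \<open>H\<close>, \<open>K\<close> and itself, so
      the parts inside \<open>V\<close> normalise each other.\<close>
    define H1 K1 where "H1 = H \<inter> V" and "K1 = K \<inter> V"
    have c: "cln H1" "cln K1"
      using H K cV by (auto simp: H1_def K1_def cln_Int)
    have "normalises G H1 K1" "normalises G K1 H1"
      using V(2,3) V'(1) by (auto simp: normalises_def H1_def K1_def subgroup.m_closed subgroup.m_inv_closed)
    moreover have "H1 \<inter> K1 = {\<one>}"
      using HK V'(5) by (auto simp: H1_def K1_def)
    ultimately have comm: "h \<otimes> k = k \<otimes> h" if "h \<in> H1" "k \<in> K1" for h k
      using commute_if_normalise_disjoint[OF clnD(1)[OF c(1)] clnD(1)[OF c(2)]] that by blast
    have n1: "H1 \<noteq> {\<one>}" "K1 \<noteq> {\<one>}"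
      using Int_open_nontrivial[OF H _ V(1)] Int_open_nontrivial[OF K _ V(1)] n
      by (auto simp: H1_def K1_def)
    have cC: "cln (centraliser G H1)"
      using c(1) by (rule cln_centraliser)
    have "K1 \<subseteq> centraliser G H1"
      using comm clnD(3)[OF c(2)] by (auto simp: centraliser_def)
    then have "centraliser G H1 \<noteq> {\<one>}"
      using n1(2) clnD(4)[OF c(2)] by blast
    moreover have "local_class G T (centraliser G H1) \<in> LC G T"
      using c(1) unfolding LC_def by blast
    ultimately have "openin T (centraliser G H1)"
      using LC LN_zero_iff[OF cC] LN_infty_iff[OF cC] by auto
    then have "h = \<one>" if "h \<in> H1" for h
      using that clnD(3)[OF c(1)] clnD(4)[OF cC]
      by (intro commutes_near_one_trivial[of h "centraliser G H1"]) (auto simp: centraliser_def)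
    then show False
      using n1(1) clnD(4)[OF c(1)] by blast
  qed
next
  assume u: uniform
  have "local_class G T (centraliser G K) \<in> {LN_zero G T, LN_infty G T}" if K: "cln K" for K
  proof (cases "K = {\<one>}")
    case True
    then have "centraliser G K = carrier G"
      by (auto simp: centraliser_def)
    then show ?thesis
      by (simp add: local_class_carrier)
  next
    case False
    have "centraliser G K = {\<one>}"
    proof (rule centraliser_trivial_of_family)
      let ?\<B> = "{B. cln B \<and> B \<noteq> {\<one>}}"
      show "K \<in> ?\<B>"
        using K False by simp
      show "B \<inter> C \<in> ?\<B>" if "B \<in> ?\<B>" "C \<in> ?\<B>" for B C
        using that u unfolding uniform_def by (auto simp: cln_Int)
      show "conjugate G g B \<in> ?\<B>" if "B \<in> ?\<B>" "g \<in> carrier G" for B g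
        using that conjugate_inv_cancel(1)[of g B] conjugate_trivial[of "inv g"] clnD(3)[of B]
        by (auto simp: cln_conjugate)
      show "U \<in> ?\<B>" if "compact_open_subgroup G T U" for U
        using compact_open_subgroupD[OF that] cln_open not_openin_one by auto
    qed auto
    then show ?thesis
      by (simp add: LN_zero_def)
  qed
  then have "LC G T \<subseteq> {LN_zero G T, LN_infty G T}"
    unfolding LC_def by blast
  then show "LC G T = {LN_zero G T, LN_infty G T}"
    using zero_infty_in_LC by blast
qed

end

section \<open>Compact open subgroups as profinite groups\<close>

lemma (in group) subgroup_of_subgroup_iff:
  assumes U: "subgroup U G"
  shows "subgroup K (G\<lparr>carrier := U\<rparr>) \<longleftrightarrow> subgroup K G \<and> K \<subseteq> U"
proof
  assume K: "subgroup K (G\<lparr>carrier := U\<rparr>)"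
  show "subgroup K G \<and> K \<subseteq> U"
    using incl_subgroup[OF U K] subgroup.subset[OF K] by simp
next
  assume "subgroup K G \<and> K \<subseteq> U"
  then show "subgroup K (G\<lparr>carrier := U\<rparr>)"
    using subgroup_incl[OF _ U] by blast
qed

lemma (in group) normal_in_subgroup_iff:
  assumes U: "subgroup U G"
  shows "K \<lhd> G\<lparr>carrier := U\<rparr> \<longleftrightarrow> subgroup K G \<and> K \<subseteq> U \<and> normalises G U K"
proof -
  interpret U: group "G\<lparr>carrier := U\<rparr>"
    using U by (rule subgroup_imp_group)
  have "inv\<^bsub>G\<lparr>carrier := U\<rparr>\<^esub> x = inv x" if "x \<in> U" for x
    using m_inv_consistent[OF U that] .
  then show ?thesis
    unfolding U.normal_inv_iff subgroup_of_subgroup_iff[OF U] by (auto simp: normalises_def)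
qed

lemma (in group) direct_factor_subgroup_iff:
  assumes U: "subgroup U G"
  shows "direct_factor (G\<lparr>carrier := U\<rparr>) K \<longleftrightarrow>
    (\<exists>L. subgroup K G \<and> K \<subseteq> U \<and> normalises G U K \<and> subgroup L G \<and> L \<subseteq> U \<and> normalises G U L \<and>
      K \<inter> L = {\<one>} \<and> K <#> L = U)"
  unfolding direct_factor_def normal_in_subgroup_iff[OF U] by (auto simp: set_mult_def)

context tdlc
begin

lemma topological_group_subgroup:
  assumes U: "subgroup U G"
  shows "topological_group (G\<lparr>carrier := U\<rparr>) (subtopology T U)"
proof -
  interpret U: group "G\<lparr>carrier := U\<rparr>"
    using U by (rule subgroup_imp_group)
  let ?X = "subtopology T U"
  have t: "topspace ?X = U"
    using subgroup.subset[OF U] topspace_eq by auto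
  have inv_eq: "inv\<^bsub>G\<lparr>carrier := U\<rparr>\<^esub> x = inv x" if "x \<in> U" for x
    using m_inv_consistent[OF U that] .
  have "continuous_map (prod_topology ?X ?X) T (\<lambda>(x, y). x \<otimes> y)"
    using continuous_map_from_subtopology[OF continuous_mult, of "U \<times> U"]
    by (simp only: subtopology_Times)
  then have m: "continuous_map (prod_topology ?X ?X) ?X (\<lambda>(x, y). x \<otimes> y)"
    unfolding continuous_map_in_subtopology topspace_prod_topology t
    using subgroup.m_closed[OF U] by auto
  have "continuous_map ?X T (\<lambda>x. inv x)"
    using continuous_inv by (rule continuous_map_from_subtopology)
  then have "continuous_map ?X ?X (\<lambda>x. inv x)"
    unfolding continuous_map_in_subtopology t using subgroup.m_inv_closed[OF U] by auto
  then have i: "continuous_map ?X ?X (\<lambda>x. inv\<^bsub>G\<lparr>carrier := U\<rparr>\<^esub> x)"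
    by (rule continuous_map_eq) (simp only: t inv_eq)
  show ?thesis
    by (intro topological_group.intro topological_group_axioms.intro U.is_group) (use t m i in simp_all)
qed

lemma profinite_compact_open:
  assumes U: "compact_open_subgroup G T U"
  shows "profinite_group (G\<lparr>carrier := U\<rparr>) (subtopology T U)"
proof -
  note U' = compact_open_subgroupD[OF U]
  have "connected_component_of_set (subtopology T U) x = {x}" if x: "x \<in> U" for x
  proof -
    have xt: "x \<in> topspace T"
      using x U'(4) topspace_eq by auto
    have "connectedin T (connected_component_of_set (subtopology T U) x)"
      using connectedin_connected_component_of[of "subtopology T U" x]
      unfolding connectedin_subtopology by simp
    moreover have "x \<in> connected_component_of_set (subtopology T U) x"
      using x xt by (simp add: connected_component_of_refl)
    ultimately have "connected_component_of_set (subtopology T U) x \<subseteq> connected_component_of_set T x"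
      by (rule connected_component_of_maximal)
    also have "\<dots> = {x}"
      using totally_disconnected xt by (simp add: totally_disconnected_def)
    finally show ?thesis
      using \<open>x \<in> connected_component_of_set (subtopology T U) x\<close> by blast
  qed
  then have "Defs.totally_disconnected (subtopology T U)"
    by (simp add: totally_disconnected_def)
  then show ?thesis
    using topological_group_subgroup[OF U'(1)] compact_space_subtopology[OF U'(2)]
    by (simp add: profinite_group_def)
qed

text \<open>\<open>U\<close> is both open and closed, so openness and closedness of subsets of
  \<open>U\<close> are the same in \<open>U\<close> and in \<open>G\<close>, and the normaliser in
  \<open>U\<close> is the part in \<open>U\<close> of the normaliser in \<open>G\<close>.\<close>

lemma cln_subgroup_iff:
  assumes U: "compact_open_subgroup G T U"
  shows "closed_locally_normal (G\<lparr>carrier := U\<rparr>) (subtopology T U) K \<longleftrightarrow> cln K \<and> K \<subseteq> U"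
proof -
  note U' = compact_open_subgroupD[OF U]
  interpret U: group "G\<lparr>carrier := U\<rparr>"
    using U'(1) by (rule subgroup_imp_group)
  have inv_eq: "inv\<^bsub>G\<lparr>carrier := U\<rparr>\<^esub> x = inv x" if "x \<in> U" for x
    using m_inv_consistent[OF U'(1) that] .
  note sub = subgroup_of_subgroup_iff[OF U'(1), of K]
  have cl: "closedin (subtopology T U) K \<longleftrightarrow> closedin T K \<and> K \<subseteq> U"
    using U'(6) by (rule closedin_closed_subtopology)
  have nrm: "normalizer (G\<lparr>carrier := U\<rparr>) K = {g \<in> U. conjugate G g K = K}" if "K \<subseteq> U"
    using U.normalizer_eq[of K] that inv_eq by (auto simp: conjugate_def)
  show ?thesis
  proof
    assume c: "closed_locally_normal (G\<lparr>carrier := U\<rparr>) (subtopology T U) K"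
    then have K: "subgroup K G" "K \<subseteq> U" "closedin T K"
      using sub cl by (auto simp: closed_locally_normal_def)
    then have Kc: "K \<subseteq> carrier G"
      using U'(4) by blast
    let ?N = "{g \<in> U. conjugate G g K = K}"
    have "openin (subtopology T U) ?N"
      using c nrm[OF K(2)] by (simp add: closed_locally_normal_def)
    then have "openin T ?N"
      using U'(3) by (simp add: openin_open_subtopology)
    moreover have "\<one> \<in> ?N"
      using U'(5) conjugate_one[OF Kc] by simp
    moreover have "normalises G ?N K"
      unfolding normalises_def conjugate_def by blast
    ultimately show "cln K \<and> K \<subseteq> U"
      using clnI[OF K(1,3)] K(2) by blast
  next
    assume c: "cln K \<and> K \<subseteq> U"
    then have "openin T (U \<inter> normalizer G K)"
      using U'(3) by (auto simp: closed_locally_normal_def)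
    moreover have "U \<inter> normalizer G K = normalizer (G\<lparr>carrier := U\<rparr>) K"
      using c nrm U'(4) normalizer_eq[of K] by auto
    ultimately have "openin (subtopology T U) (normalizer (G\<lparr>carrier := U\<rparr>) K)"
      using U'(3) by (simp add: openin_open_subtopology) blast
    then show "closed_locally_normal (G\<lparr>carrier := U\<rparr>) (subtopology T U) K"
      using c sub cl by (simp add: closed_locally_normal_def)
  qed
qed

end

context simple_tdlc
begin

lemma LN_trivial_iff:
  "carrier (LN G T) = {LN_zero G T, LN_infty G T} \<longleftrightarrow> (\<forall>H. cln H \<longrightarrow> H = {\<one>} \<or> openin T H)"
proof -
  have "carrier (LN G T) = {LN_zero G T, LN_infty G T} \<longleftrightarrow>
      carrier (LN G T) \<subseteq> {LN_zero G T, LN_infty G T}"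
    using LN_zero_in_carrier LN_infty_in_carrier by blast
  also have "\<dots> \<longleftrightarrow> (\<forall>H. cln H \<longrightarrow> H = {\<one>} \<or> openin T H)"
    by (auto simp: carrier_LN image_subset_iff LN_zero_iff LN_infty_iff)
  finally show ?thesis .
qed

text \<open>From right to left, a non-trivial \<open>H\<close> is cut down to
  \<open>H \<inter> U\<close>, which stays non-trivial because \<open>H\<close> is not discrete;
  once this part is open, so is \<open>H\<close>.\<close>

theorem LN_trivial_iff_hji:
  "carrier (LN G T) = {LN_zero G T, LN_infty G T} \<longleftrightarrow>
    (\<forall>U. compact_open_subgroup G T U \<longrightarrow>
      hereditarily_just_infinite (G\<lparr>carrier := U\<rparr>) (subtopology T U))"
proof -
  have hji: "hereditarily_just_infinite (G\<lparr>carrier := U\<rparr>) (subtopology T U) \<longleftrightarrow>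
      (\<forall>K. cln K \<and> K \<subseteq> U \<and> K \<noteq> {\<one>} \<longrightarrow> openin T K)" if U: "compact_open_subgroup G T U" for U
    using profinite_compact_open[OF U] compact_open_subgroupD(3)[OF U]
    by (auto simp: hereditarily_just_infinite_def cln_subgroup_iff[OF U] openin_open_subtopology)
  show ?thesis
    unfolding LN_trivial_iff
  proof (intro iffI allI impI)
    fix U assume "\<forall>H. cln H \<longrightarrow> H = {\<one>} \<or> openin T H" "compact_open_subgroup G T U"
    then show "hereditarily_just_infinite (G\<lparr>carrier := U\<rparr>) (subtopology T U)"
      by (auto simp: hji)
  next
    fix H
    assume all: "\<forall>U. compact_open_subgroup G T U \<longrightarrow>
        hereditarily_just_infinite (G\<lparr>carrier := U\<rparr>) (subtopology T U)" and H: "cln H"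
    obtain U where U: "compact_open_subgroup G T U"
      using exists_compact_open by blast
    note U' = compact_open_subgroupD[OF U]
    have HU: "cln (H \<inter> U)"
      using cln_Int[OF H cln_open[OF U'(1,3)]] .
    show "H = {\<one>} \<or> openin T H"
    proof (cases "H = {\<one>}")
      case False
      then have "H \<inter> U \<noteq> {\<one>}"
        using H U Int_open_nontrivial by blast
      then have "openin T (H \<inter> U)"
        using all U HU by (auto simp: hji)
      then show ?thesis
        using open_subgroupI[OF clnD(1)[OF H], of "H \<inter> U"] clnD(4)[OF HU] by blast
    qed simp
  qed
qed

section \<open>Direct factors as complements in the structure lattice\<close>

text \<open>Multiplication maps the compact set \<open>K \<times> L\<close> bijectively onto
  \<open>U\<close>. The pairs outside a neighbourhood \<open>A \<times> B\<close> of the identity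
  have a closed image that misses \<one>; the rest of \<open>U\<close> is a neighbourhood of \<one>
  inside \<open>M\<close>.\<close>

lemma open_if_contains_complements:
  assumes U: "compact_open_subgroup G T U"
    and K: "subgroup K G" "closedin T K" and L: "subgroup L G" "closedin T L"
    and KL: "K \<inter> L = {\<one>}" "K <#> L = U" and M: "subgroup M G"
    and vK: "virtually_contained G T K M" and vL: "virtually_contained G T L M"
  shows "openin T M"
proof -
  note U' = compact_open_subgroupD[OF U]
  have "k \<in> U" if "k \<in> K" for k
    using that subgroup.one_closed[OF L(1)] subgroup.mem_carrier[OF K(1)] r_one[of k] KL(2)
    unfolding set_mult_def by blast
  moreover have "l \<in> U" if "l \<in> L" for l
    using that subgroup.one_closed[OF K(1)] subgroup.mem_carrier[OF L(1)] l_one[of l] KL(2)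
    unfolding set_mult_def by blast
  ultimately have KL': "compactin T K" "compactin T L"
    using closed_compactin[OF U'(2) _ K(2)] closed_compactin[OF U'(2) _ L(2)] by (auto simp: subset_iff)
  obtain A B where AB: "openin T A" "\<one> \<in> A" "K \<inter> A \<subseteq> M" "openin T B" "\<one> \<in> B" "L \<inter> B \<subseteq> M"
    using vK vL unfolding virtually_contained_def by blast
  let ?Z = "(topspace (prod_topology T T) - A \<times> B) \<inter> (K \<times> L)"
  let ?m = "\<lambda>(x, y). x \<otimes> y"
  have "closedin (prod_topology T T) (topspace (prod_topology T T) - A \<times> B)"
    using AB by (intro closedin_diff closedin_topspace) (simp add: openin_prod_Times_iff)
  moreover have "compactin (prod_topology T T) (K \<times> L)"
    using KL' by (simp add: compactin_Times)
  ultimately have "compactin (prod_topology T T) ?Z"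
    by (rule closed_Int_compactin)
  then have "compactin T (?m ` ?Z)"
    using continuous_mult by (rule image_compactin)
  then have cl: "closedin T (?m ` ?Z)"
    by (rule compactin_closedin)
  have "\<one> \<notin> ?m ` ?Z"
  proof
    assume "\<one> \<in> ?m ` ?Z"
    then obtain z where z: "\<one> = ?m z" "z \<in> ?Z"
      by (rule imageE)
    obtain k l where "z = (k, l)"
      by (cases z)
    with z have kl: "k \<in> K" "l \<in> L" "k \<otimes> l = \<one>" "(k, l) \<notin> A \<times> B"
      by auto
    have "k \<in> carrier G" "l \<in> carrier G"
      using kl K L by (auto simp: subgroup.mem_carrier)
    then have "k = inv l"
      using kl(3) by (simp add: inv_equality)
    then have "k \<in> K \<inter> L"
      using kl L by (simp add: subgroup.m_inv_closed)
    then have "k = \<one>" "l = \<one>"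
      using KL(1) kl(3) \<open>l \<in> carrier G\<close> by auto
    then show False
      using kl(4) AB by simp
  qed
  moreover have "U - ?m ` ?Z \<subseteq> M"
  proof
    fix u assume u: "u \<in> U - ?m ` ?Z"
    then obtain k l where kl: "k \<in> K" "l \<in> L" "u = k \<otimes> l"
      using KL(2) by (auto simp: set_mult_def)
    then have "(k, l) \<notin> ?Z"
      using u by force
    then have "k \<in> A" "l \<in> B"
      using kl K L by (auto simp: topspace_eq subgroup.mem_carrier)
    then show "u \<in> M"
      using kl AB(3,6) subgroup.m_closed[OF M, of k l] by blast
  qed
  ultimately show ?thesis
    using U' openin_diff[OF U'(3) cl] by (intro open_subgroupI[OF M, of "U - ?m ` ?Z"]) auto
qed

text \<open>The classes are complements in the structure lattice: their meet is 0, and every common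
  upper bound is \<infinity>, with upper bounds standing in for a join.\<close>

definition complementary :: "'a set \<Rightarrow> 'a set \<Rightarrow> bool" where
  "complementary K L \<longleftrightarrow> K \<inter> L = {\<one>} \<and>
    (\<forall>M. cln M \<longrightarrow> virtually_contained G T K M \<longrightarrow> virtually_contained G T L M \<longrightarrow> openin T M)"

text \<open>Since \<open>U\<close> has trivial centre, a complement \<open>L\<close> of \<open>K\<close> in \<open>U\<close> is the centraliser of \<open>K\<close> in
  \<open>U\<close>, and so it is closed.\<close>

lemma complement_closed:
  assumes U: "compact_open_subgroup G T U"
    and K: "subgroup K G" "K \<subseteq> U" "normalises G U K"
    and L: "subgroup L G" "L \<subseteq> U" "normalises G U L"
    and KL: "K \<inter> L = {\<one>}" "K <#> L = U"
  shows "closedin T L"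
proof -
  note U' = compact_open_subgroupD[OF U]
  have c: "K \<subseteq> carrier G" "L \<subseteq> carrier G"
    using K L U' by blast+
  have "normalises G K L" "normalises G L K"
    using K L unfolding normalises_def by blast+
  then have comm: "k \<otimes> l = l \<otimes> k" if "k \<in> K" "l \<in> L" for k l
    using commute_if_normalise_disjoint[OF K(1) L(1) KL(1)] that by blast
  have "U \<inter> centraliser G K \<subseteq> L"
  proof
    fix u assume u: "u \<in> U \<inter> centraliser G K"
    then obtain k l where kl: "k \<in> K" "l \<in> L" "u = k \<otimes> l"
      using KL(2) by (auto simp: set_mult_def)
    have kc: "k \<in> carrier G" "l \<in> carrier G"
      using kl c by auto
    \<comment> \<open>\<open>u\<close> and \<open>l\<close> commute with \<open>K\<close>, hence so
      does \<open>k\<close>. Since \<open>k\<close> also commutes with \<open>L\<close>, it is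
      central in \<open>U\<close> and therefore trivial.\<close>
    have k_comm: "k \<otimes> x = x \<otimes> k" if x: "x \<in> K" for x
    proof -
      have xc: "x \<in> carrier G"
        using x c by blast
      have "k \<otimes> x \<otimes> l = k \<otimes> l \<otimes> x"
        using comm[OF x kl(2)] kc xc by (simp add: m_assoc)
      also have "\<dots> = x \<otimes> (k \<otimes> l)"
        using u x kl(3) by (simp add: centraliser_def)
      also have "\<dots> = x \<otimes> k \<otimes> l"
        using kc xc by (simp add: m_assoc)
      finally show ?thesis
        using kc xc by simp
    qed
    have "k \<otimes> v = v \<otimes> k" if v: "v \<in> U" for v
    proof -
      obtain x y where xy: "x \<in> K" "y \<in> L" "v = x \<otimes> y"
        using KL(2) v by (auto simp: set_mult_def)
      have xyc: "x \<in> carrier G" "y \<in> carrier G"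
        using xy c by auto
      have "k \<otimes> v = x \<otimes> k \<otimes> y"
        using xy xyc kc k_comm[OF xy(1)] by (simp flip: m_assoc)
      also have "\<dots> = v \<otimes> k"
        using xy xyc kc comm[OF kl(1) xy(2)] by (simp add: m_assoc)
      finally show ?thesis .
    qed
    then have "k = \<one>"
      using commutes_near_one_trivial[OF kc(1) U'(3,5)] by blast
    then show "u \<in> L"
      using kl kc by simp
  qed
  moreover have "L \<subseteq> U \<inter> centraliser G K"
    using L(2) c comm by (auto simp: centraliser_def)
  ultimately have "L = U \<inter> centraliser G K"
    by blast
  then show ?thesis
    using closedin_Int[OF U'(6) closedin_centraliser[OF c(1)]] by simp
qed

text \<open>Inside a common normaliser \<open>V\<close> the parts of \<open>K\<close> and
  \<open>L\<close> commute, so their product \<open>P\<close> is a compact subgroup, and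
  \<open>V\<close> normalises it. As a common upper bound of the two classes \<open>P\<close> is
  open, which makes it the compact open subgroup with factor \<open>K1\<close>.\<close>

lemma complementary_imp_direct_factor:
  assumes K: "cln K" and L: "cln L" and compl: "complementary K L"
  shows "local_class G T K \<in> LD G T"
proof -
  obtain V where V: "compact_open_subgroup G T V" "normalises G V K" "normalises G V L"
    using cln_common_normaliser[OF K L, of "carrier G"] by auto
  note V' = compact_open_subgroupD[OF V(1)]
  define K1 L1 where "K1 = K \<inter> V" and "L1 = L \<inter> V"
  define P where "P = K1 <#> L1"
  have cK: "cln K1" and cL: "cln L1"
    using K L V' by (auto simp: K1_def L1_def intro: cln_Int cln_open)
  note K1 = clnD[OF cK] and L1 = clnD[OF cL]
  have sub: "K1 \<subseteq> V" "L1 \<subseteq> V"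
    by (auto simp: K1_def L1_def)
  have nK: "normalises G V K1" and nL: "normalises G V L1"
    using V(2,3) V'(1) by (auto simp: normalises_def K1_def L1_def subgroup.m_closed subgroup.m_inv_closed)
  have KL1: "K1 \<inter> L1 = {\<one>}"
    using compl V'(5) by (auto simp: complementary_def K1_def L1_def)
  have "normalises G K1 L1" "normalises G L1 K1"
    using nK nL sub unfolding normalises_def by blast+
  then have comm: "k \<otimes> l = l \<otimes> k" if "k \<in> K1" "l \<in> L1" for k l
    using commute_if_normalise_disjoint[OF K1(1) L1(1) KL1] that by blast
  have P_iff: "p \<in> P \<longleftrightarrow> (\<exists>k\<in>K1. \<exists>l\<in>L1. p = k \<otimes> l)" for p
    by (auto simp: P_def set_mult_def)
  have PI: "k \<otimes> l \<in> P" if "k \<in> K1" "l \<in> L1" for k l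
    using that by (auto simp: P_iff)
  have PV: "P \<subseteq> V"
    using sub subgroup.m_closed[OF V'(1)] unfolding P_def set_mult_def by blast
  have KP: "K1 \<subseteq> P"
    using PI[OF _ L1(4)] K1(3) by (metis r_one subset_iff)
  have LP: "L1 \<subseteq> P"
    using PI[OF K1(4)] L1(3) by (metis l_one subset_iff)
  have sP: "subgroup P G"
  proof (rule subgroupI)
    show "P \<subseteq> carrier G"
      using PV V' by blast
    show "P \<noteq> {}"
      using KP K1(4) by blast
    show "inv a \<in> P" if a: "a \<in> P" for a
    proof -
      obtain k l where kl: "k \<in> K1" "l \<in> L1" "a = k \<otimes> l"
        using a by (auto simp: P_iff)
      then have "a = l \<otimes> k" "k \<in> carrier G" "l \<in> carrier G"
        using comm K1(3) L1(3) by auto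
      then have "inv a = inv k \<otimes> inv l"
        by (simp add: inv_mult_group)
      then show ?thesis
        using kl K1(1) L1(1) PI by (simp add: subgroup.m_inv_closed)
    qed
    show "a \<otimes> b \<in> P" if ab: "a \<in> P" "b \<in> P" for a b
    proof -
      obtain k l k' l' where kl: "k \<in> K1" "l \<in> L1" "a = k \<otimes> l" "k' \<in> K1" "l' \<in> L1" "b = k' \<otimes> l'"
        using ab by (auto simp: P_iff)
      then have c: "k \<in> carrier G" "l \<in> carrier G" "k' \<in> carrier G" "l' \<in> carrier G"
        using K1(3) L1(3) by auto
      have "a \<otimes> b = k \<otimes> (l \<otimes> k') \<otimes> l'"
        using kl c by (simp add: m_assoc)
      also have "\<dots> = k \<otimes> k' \<otimes> (l \<otimes> l')"
        using c by (simp add: m_assoc flip: comm[OF kl(4,2)])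
      finally show ?thesis
        using kl K1(1) L1(1) PI by (simp add: subgroup.m_closed)
    qed
  qed
  have kP: "compactin T P"
    unfolding P_def using closed_compactin[OF V'(2) sub(1) K1(2)] closed_compactin[OF V'(2) sub(2) L1(2)]
    by (rule compactin_set_mult)
  have "normalises G V P"
    unfolding normalises_def
  proof (intro ballI)
    fix v p assume v: "v \<in> V" and "p \<in> P"
    then obtain k l where kl: "k \<in> K1" "l \<in> L1" "p = k \<otimes> l"
      by (auto simp: P_iff)
    then have "v \<in> carrier G" "k \<in> carrier G" "l \<in> carrier G"
      using v V'(4) K1(3) L1(3) by auto
    then have "v \<otimes> p \<otimes> inv v = (v \<otimes> k \<otimes> inv v) \<otimes> (v \<otimes> l \<otimes> inv v)"
      using kl by (simp add: m_assoc inv_mult_cancel)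
    then show "v \<otimes> p \<otimes> inv v \<in> P"
      using PI normalisesD[OF nK v kl(1)] normalisesD[OF nL v kl(2)] by simp
  qed
  then have cP: "cln P"
    using clnI[OF sP compactin_closedin[OF kP] V'(3,5)] by simp
  have vK: "virtually_contained G T K K1" and vL: "virtually_contained G T L L1"
    unfolding K1_def L1_def using V'(3,5) by (rule virtually_contained_Int_open)+
  have "virtually_contained G T K P" "virtually_contained G T L P"
    using virtually_contained_trans[OF vK virtually_contained_subset[OF KP]]
      virtually_contained_trans[OF vL virtually_contained_subset[OF LP]] .
  then have "openin T P"
    using compl cP by (simp add: complementary_def)
  then have "compact_open_subgroup G T P"
    using sP kP by (simp add: compact_open_subgroup_def)
  moreover have "normalises G P K1" "normalises G P L1"
    using nK nL PV unfolding normalises_def by blast+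
  then have "direct_factor (G\<lparr>carrier := P\<rparr>) K1"
    unfolding direct_factor_subgroup_iff[OF sP]
    using K1(1) L1(1) KP LP KL1 P_def by (intro exI[of _ L1]) simp
  moreover have "local_class G T K = local_class G T K1"
    using K cK vK by (simp add: local_class_eq_iff K1_def virtually_contained_subset)
  ultimately show ?thesis
    using K1(2) unfolding LD_def by blast
qed

theorem LD_iff_complementary:
  "\<alpha> \<in> LD G T \<longleftrightarrow> (\<exists>K L. \<alpha> = local_class G T K \<and> cln K \<and> cln L \<and> complementary K L)"
proof
  assume "\<alpha> \<in> LD G T"
  then obtain K U where U: "compact_open_subgroup G T U" and K: "closedin T K" "\<alpha> = local_class G T K"
    and df: "direct_factor (G\<lparr>carrier := U\<rparr>) K"
    unfolding LD_def by blast
  note U' = compact_open_subgroupD[OF U]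
  obtain L where L: "subgroup K G" "K \<subseteq> U" "normalises G U K"
      "subgroup L G" "L \<subseteq> U" "normalises G U L" "K \<inter> L = {\<one>}" "K <#> L = U"
    using df unfolding direct_factor_subgroup_iff[OF U'(1)] by blast
  have clL: "closedin T L"
    using complement_closed[OF U L] .
  have "cln K" "cln L"
    using clnI[OF L(1) K(1) U'(3,5) L(3)] clnI[OF L(4) clL U'(3,5) L(6)] .
  moreover have "complementary K L"
    unfolding complementary_def
    using L(7) open_if_contains_complements[OF U L(1) K(1) L(4) clL L(7,8)] clnD(1) by simp
  ultimately show "\<exists>K L. \<alpha> = local_class G T K \<and> cln K \<and> cln L \<and> complementary K L"
    using K(2) by (intro exI[of _ K] exI[of _ L]) simp
next
  assume "\<exists>K L. \<alpha> = local_class G T K \<and> cln K \<and> cln L \<and> complementary K L"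
  then show "\<alpha> \<in> LD G T"
    using complementary_imp_direct_factor by blast
qed

lemma zero_infty_in_LD: "{LN_zero G T, LN_infty G T} \<subseteq> LD G T"
proof -
  have o: "openin T M" if M: "cln M" "virtually_contained G T (carrier G) M" for M
  proof -
    obtain A where "openin T A" "\<one> \<in> A" "carrier G \<inter> A \<subseteq> M"
      using M(2) unfolding virtually_contained_def by blast
    then show ?thesis
      using open_subgroupI[OF clnD(1)[OF M(1)], of A] openin_subset_carrier[of A] by blast
  qed
  have "complementary {\<one>} (carrier G)" "complementary (carrier G) {\<one>}"
    using o by (auto simp: complementary_def)
  then have "local_class G T {\<one>} \<in> LD G T" "local_class G T (carrier G) \<in> LD G T"
    using cln_trivial cln_carrier complementary_imp_direct_factor by simp_all
  then show ?thesis
    by (simp add: LN_zero_def local_class_carrier)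
qed

text \<open>If \<open>K\<close> is not trivial, its complement is, so \<open>K\<close> is itself a
  common upper bound and thus open.\<close>

lemma LD_trivial_if_uniform:
  assumes uniform
  shows "LD G T = {LN_zero G T, LN_infty G T}"
proof -
  have "local_class G T K \<in> {LN_zero G T, LN_infty G T}"
    if K: "cln K" and L: "cln L" and c: "complementary K L" for K L
  proof (cases "K = {\<one>}")
    case False
    then have "L = {\<one>}"
      using assms K L c unfolding uniform_def complementary_def by blast
    then have "openin T K"
      using c K clnD(4)[OF K] unfolding complementary_def
      by (auto intro: virtually_contained_subset)
    then show ?thesis
      using LN_infty_iff[OF K] by simp
  qed (simp add: LN_zero_def)
  then have "LD G T \<subseteq> {LN_zero G T, LN_infty G T}"
    unfolding subset_iff LD_iff_complementary by blast
  then show ?thesis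
    using zero_infty_in_LD by blast
qed

end

section \<open>The action on the structure lattice\<close>

context tdlc
begin

lemma local_class_conjugate_cong:
  assumes H: "cln H" and K: "cln K" and eq: "local_class G T H = local_class G T K"
    and g: "g \<in> carrier G"
  shows "local_class G T (conjugate G g H) = local_class G T (conjugate G g K)"
  using eq virtually_contained_conjugate[OF _ g clnD(3)[OF H], of K]
    virtually_contained_conjugate[OF _ g clnD(3)[OF K], of H]
  by (simp add: local_class_eq_iff H K cln_conjugate g)

lemma virtually_contained_conjugate_by_element:
  assumes L: "cln L" and d: "d \<in> L" and H: "cln H" and LH: "virtually_contained G T L H"
  shows "virtually_contained G T (conjugate G d H) H"
proof -
  have dc: "d \<in> carrier G"
    using d clnD(3)[OF L] by blast
  obtain A where A: "openin T A" "\<one> \<in> A" "L \<inter> A \<subseteq> H"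
    using LH unfolding virtually_contained_def by blast
  obtain V where V: "compact_open_subgroup G T V" "\<And>v. v \<in> V \<Longrightarrow> d \<otimes> v \<otimes> inv d \<otimes> inv v \<in> L \<inter> A"
    using commutator_near_one[OF L d A(1,2)] by blast
  note V' = compact_open_subgroupD[OF V(1)]
  have "d \<otimes> h \<otimes> inv d \<in> H" if h: "h \<in> H" "h \<in> V" for h
  proof -
    have "d \<otimes> h \<otimes> inv d = (d \<otimes> h \<otimes> inv d \<otimes> inv h) \<otimes> h"
      using dc h V' by (simp add: m_assoc subset_iff)
    then show ?thesis
      using V(2)[OF h(2)] A(3) h(1) subgroup.m_closed[OF clnD(1)[OF H]] by (metis subsetD)
  qed
  then have "conjugate G d (H \<inter> V) \<subseteq> H"
    unfolding conjugate_def by blast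
  then have "conjugate G d H \<inter> conjugate G d V \<subseteq> H"
    using conjugate_Int[OF dc clnD(3)[OF H] V'(4)] by simp
  moreover have "\<one> \<in> conjugate G d V"
    using subgroup.one_closed[OF subgroup_conjugate[OF V'(1) dc]] .
  ultimately show ?thesis
    using openin_conjugate[OF dc V'(3)] unfolding virtually_contained_def by blast
qed

section \<open>The kernel of the action is a closed normal subgroup\<close>

definition action_kernel :: "'a set" where
  "action_kernel =
    {g \<in> carrier G. \<forall>H. cln H \<longrightarrow> local_class G T (conjugate G g H) = local_class G T H}"

lemma action_kernelD:
  "g \<in> action_kernel \<Longrightarrow> cln H \<Longrightarrow> local_class G T (conjugate G g H) = local_class G T H"
  by (simp add: action_kernel_def)

lemma trivial_action_iff: "trivial_conjugation_action G T \<longleftrightarrow> action_kernel = carrier G"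
  by (auto simp: trivial_conjugation_action_def action_kernel_def conjugate_eq_cosets)

lemma normal_action_kernel: "action_kernel \<lhd> G"
proof (intro normal_invI subgroupI)
  show "action_kernel \<subseteq> carrier G"
    by (auto simp: action_kernel_def)
  have "\<one> \<in> action_kernel"
    by (simp add: action_kernel_def conjugate_one clnD)
  then show "action_kernel \<noteq> {}"
    by blast
  show "inv g \<in> action_kernel" if g: "g \<in> action_kernel" for g
  proof -
    have gc: "g \<in> carrier G"
      using g by (simp add: action_kernel_def)
    have "local_class G T (conjugate G (inv g) H) = local_class G T H" if H: "cln H" for H
      using action_kernelD[OF g cln_conjugate[OF H, of "inv g"]] gc clnD(3)[OF H]
      by (simp add: conjugate_inv_cancel)
    then show ?thesis
      using gc by (simp add: action_kernel_def)
  qed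
  show "g \<otimes> h \<in> action_kernel" if gh: "g \<in> action_kernel" "h \<in> action_kernel" for g h
  proof -
    have c: "g \<in> carrier G" "h \<in> carrier G"
      using gh by (simp_all add: action_kernel_def)
    have "local_class G T (conjugate G (g \<otimes> h) H) = local_class G T H" if H: "cln H" for H
      using local_class_conjugate_cong[OF cln_conjugate[OF H c(2)] H action_kernelD[OF gh(2) H] c(1)]
        action_kernelD[OF gh(1) H] c clnD(3)[OF H]
      by (simp add: conjugate_mult)
    then show ?thesis
      using c by (simp add: action_kernel_def)
  qed
  show "x \<otimes> g \<otimes> inv x \<in> action_kernel" if x: "x \<in> carrier G" and g: "g \<in> action_kernel" for x g
  proof -
    have gc: "g \<in> carrier G"
      using g by (simp add: action_kernel_def)
    have "local_class G T (conjugate G (x \<otimes> g \<otimes> inv x) H) = local_class G T H" if H: "cln H" for H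
    proof -
      \<comment> \<open>Conjugating by \<open>x\<close> reduces the action of
        \<open>x \<otimes> g \<otimes> inv x\<close> on \<open>H\<close> to that of \<open>g\<close>
        on \<open>?K\<close>.\<close>
      let ?K = "conjugate G (inv x) H"
      have K: "cln ?K"
        using H x by (simp add: cln_conjugate)
      have "local_class G T (conjugate G x (conjugate G g ?K)) = local_class G T (conjugate G x ?K)"
        using local_class_conjugate_cong[OF cln_conjugate[OF K gc] K action_kernelD[OF g K] x] .
      then show ?thesis
        using x gc clnD(3)[OF H] by (simp add: conjugate_mult conjugate_inv_cancel conjugate_in_carrier)
    qed
    then show ?thesis
      using x gc by (simp add: action_kernel_def)
  qed
qed

text \<open>If \<open>g\<close> moves the class of \<open>H\<close>, then so does all of
  \<open>g <# V\<close>, where \<open>V\<close> is an open group normalising \<open>H\<close>; the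
  complement is therefore open.\<close>

lemma closedin_action_kernel: "closedin T action_kernel"
proof -
  have "openin T (carrier G - action_kernel)"
  proof (subst openin_subopen, intro ballI)
    fix g assume g: "g \<in> carrier G - action_kernel"
    then obtain H where H: "cln H" "local_class G T (conjugate G g H) \<noteq> local_class G T H"
      by (auto simp: action_kernel_def)
    obtain V where V: "compact_open_subgroup G T V" "normalises G V H"
      using cln_normaliser[OF H(1), of "carrier G"] by auto
    note V' = compact_open_subgroupD[OF V(1)]
    have "g \<otimes> v \<in> carrier G - action_kernel" if v: "v \<in> V" for v
    proof -
      have vc: "v \<in> carrier G"
        using v V' by blast
      have "conjugate G (g \<otimes> v) H = conjugate G g H"
        using conjugate_mult[of g v H] conjugate_eqI[OF V'(1) V(2) v clnD(3)[OF H(1)]]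
          clnD(3)[OF H(1)] g vc by simp
      then show ?thesis
        using H g vc action_kernelD[of "g \<otimes> v" H] by auto
    qed
    then have "g <# V \<subseteq> carrier G - action_kernel"
      by (auto simp: l_coset_def)
    moreover have "g \<in> g <# V"
      using g V' by (force simp: l_coset_def)
    moreover have "openin T (g <# V)"
      using openin_lcoset[of g V] g V' by simp
    ultimately show "\<exists>A. openin T A \<and> g \<in> A \<and> A \<subseteq> carrier G - action_kernel"
      by blast
  qed
  then show ?thesis
    by (auto simp: closedin_def topspace_eq action_kernel_def)
qed

section \<open>Countable covers by cosets and the Baire category theorem\<close>

text \<open>For a compact open \<open>W\<close> and the whole group this follows from compact
  generation; for the small closed subgroup of the atomic case it is the size estimate that feeds
  the category argument.\<close>

definition countably_covered :: "'a set \<Rightarrow> 'a set \<Rightarrow> bool" where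
  "countably_covered W Y \<longleftrightarrow> (\<exists>C. countable C \<and> C \<subseteq> carrier G \<and> Y \<subseteq> (\<Union>c\<in>C. c <# W))"

lemma countably_covered_UN:
  assumes "countable I" "\<And>i. i \<in> I \<Longrightarrow> countably_covered W (Y i)"
  shows "countably_covered W (\<Union>i\<in>I. Y i)"
proof -
  obtain C where C: "\<And>i. i \<in> I \<Longrightarrow> countable (C i) \<and> C i \<subseteq> carrier G \<and> Y i \<subseteq> (\<Union>c\<in>C i. c <# W)"
    using assms(2) unfolding countably_covered_def by metis
  have "countable (\<Union>i\<in>I. C i)"
    using assms(1) C by (intro countable_UN) auto
  moreover have "(\<Union>i\<in>I. C i) \<subseteq> carrier G"
    using C by blast
  moreover have "(\<Union>i\<in>I. Y i) \<subseteq> (\<Union>c\<in>(\<Union>i\<in>I. C i). c <# W)"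
    using C by fastforce
  ultimately show ?thesis
    unfolding countably_covered_def by blast
qed

lemma countably_covered_mono: "countably_covered W Z \<Longrightarrow> Y \<subseteq> Z \<Longrightarrow> countably_covered W Y"
  unfolding countably_covered_def by (meson order_trans)

text \<open>Words of length \<open>n\<close> are covered by induction: a further letter is
  multiplied on the left of the cosets found so far, which is why \<open>step\<close> controls
  \<open>X\<close> times an arbitrary coset.\<close>

lemma countably_covered_generate:
  assumes X: "X \<subseteq> carrier G" "\<And>x. x \<in> X \<Longrightarrow> inv x \<in> X" and W: "subgroup W G"
    and step: "\<And>d. d \<in> carrier G \<Longrightarrow> countably_covered W (X <#> (d <# W))"
  shows "countably_covered W (generate G X)"
proof -
  define P where "P = rec_nat {\<one>} (\<lambda>n P. X <#> P)"
  have P0: "P 0 = {\<one>}" and PS: "P (Suc n) = X <#> P n" for n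
    by (simp_all add: P_def)
  have Pc: "P n \<subseteq> carrier G" for n
    by (induction n) (use X in \<open>auto simp: P0 PS set_mult_def\<close>)
  have "countably_covered W (P n)" for n
  proof (induction n)
    case 0
    have "P 0 \<subseteq> \<one> <# W"
      using subgroup.one_closed[OF W] by (force simp: P0 l_coset_def)
    then show ?case
      unfolding countably_covered_def by (intro exI[of _ "{\<one>}"]) auto
  next
    case (Suc n)
    then obtain C where C: "countable C" "C \<subseteq> carrier G" "P n \<subseteq> (\<Union>c\<in>C. c <# W)"
      unfolding countably_covered_def by blast
    have "countably_covered W (\<Union>c\<in>C. X <#> (c <# W))"
      using C step by (intro countably_covered_UN) auto
    moreover have "P (Suc n) \<subseteq> (\<Union>c\<in>C. X <#> (c <# W))"
      using C(3) unfolding PS set_mult_def by blast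
    ultimately show ?case
      by (rule countably_covered_mono)
  qed
  then have "countably_covered W (\<Union>n. P n)"
    by (intro countably_covered_UN) auto
  moreover have "generate G X \<subseteq> (\<Union>n. P n)"
  proof
    let ?Z = "\<Union>n. P n"
    have stepZ: "x \<otimes> z \<in> ?Z" if "x \<in> X" "z \<in> ?Z" for x z
    proof -
      obtain n where "z \<in> P n"
        using \<open>z \<in> ?Z\<close> by blast
      then have "x \<otimes> z \<in> P (Suc n)"
        using \<open>x \<in> X\<close> unfolding PS set_mult_def by blast
      then show ?thesis
        by blast
    qed
    \<comment> \<open>The union of the sets \<open>P n\<close> is stable under left multiplication
      by \<open>X\<close>, and by \<open>generate G X\<close> as \<open>X\<close> is closed under
      inverses. This is then applied to \<one>.\<close>
    have act: "g \<otimes> z \<in> ?Z" if "g \<in> generate G X" "z \<in> ?Z" for g z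
      using that
    proof (induction g arbitrary: z rule: generate.induct)
      case one
      then have "z \<in> carrier G"
        using Pc by blast
      with one show ?case
        by simp
    next
      case (incl h)
      then show ?case
        by (intro stepZ)
    next
      case (inv h)
      then show ?case
        using X(2) by (intro stepZ)
    next
      case (eng h1 h2)
      have "h1 \<in> carrier G" "h2 \<in> carrier G" "z \<in> carrier G"
        using eng generate_in_carrier[OF X(1)] Pc by blast+
      then have "h1 \<otimes> h2 \<otimes> z = h1 \<otimes> (h2 \<otimes> z)"
        by (rule m_assoc)
      then show ?case
        using eng by simp
    qed
    fix g assume g: "g \<in> generate G X"
    have "\<one> \<in> ?Z"
      using P0 by blast
    then show "g \<in> ?Z"
      using act[OF g] generate_in_carrier[OF X(1) g] by fastforce
  qed
  ultimately show ?thesis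
    by (rule countably_covered_mono)
qed

lemma countably_covered_compact:
  assumes "compactin T Y" "openin T U" "\<one> \<in> U"
  shows "countably_covered U Y"
proof -
  obtain F where "finite F" "F \<subseteq> Y" "Y \<subseteq> (\<Union>f\<in>F. f <# U)"
    using finite_cosets_cover[OF assms] by blast
  moreover have "Y \<subseteq> carrier G"
    using compactin_subset_topspace[OF assms(1)] topspace_eq by simp
  ultimately show ?thesis
    unfolding countably_covered_def by (intro exI[of _ F]) (auto intro: countable_finite)
qed

lemma compactin_lcoset:
  assumes "compactin T A" "g \<in> carrier G"
  shows "compactin T (g <# A)"
proof -
  have "compactin T ({g} <#> A)"
    using assms by (intro compactin_set_mult) (auto simp: topspace_eq)
  then show ?thesis
    by (simp add: set_mult_def l_coset_def)
qed

text \<open>A compact set \<open>?X\<close> times a coset of \<open>U\<close> is compact, so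
  finitely many cosets cover it at each step. The generating set is made symmetric so that the
  products of its elements exhaust the group.\<close>

lemma countably_covered_carrier:
  assumes "compactly_generated G T" and U: "compact_open_subgroup G T U"
  shows "countably_covered U (carrier G)"
proof -
  note U' = compact_open_subgroupD[OF U]
  obtain K where K: "compactin T K" "generate G K = carrier G"
    using assms(1) unfolding compactly_generated_def by blast
  have Kc: "K \<subseteq> carrier G"
    using compactin_subset_topspace[OF K(1)] topspace_eq by simp
  let ?X = "K \<union> (\<lambda>x. inv x) ` K"
  have Xc: "?X \<subseteq> carrier G"
    using Kc by auto
  have X: "compactin T ?X"
    using K(1) by (intro compactin_Un image_compactin[OF _ continuous_inv])
  have "countably_covered U (generate G ?X)"
  proof (rule countably_covered_generate[OF Xc _ U'(1)])
    show "inv x \<in> ?X" if "x \<in> ?X" for x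
      using that Kc by auto
    show "countably_covered U (?X <#> (d <# U))" if "d \<in> carrier G" for d
      using compactin_set_mult[OF X compactin_lcoset[OF U'(2) that]] U'(3,5)
      by (rule countably_covered_compact)
  qed
  moreover have "carrier G \<subseteq> generate G ?X"
    using mono_generate[of K ?X] K(2) by blast
  ultimately show ?thesis
    by (rule countably_covered_mono)
qed

text \<open>Baire category: one of the countably many closed cosets of \<open>W\<close> has non-empty interior.\<close>

lemma open_if_countably_covered:
  assumes W: "subgroup W G" "closedin T W" and cov: "countably_covered W (carrier G)"
  shows "openin T W"
proof -
  obtain C where C: "countable C" "C \<subseteq> carrier G" "carrier G \<subseteq> (\<Union>c\<in>C. c <# W)"
    using cov unfolding countably_covered_def by blast
  have Wc: "W \<subseteq> carrier G"
    using W(1) by (rule subgroup.subset)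
  have "\<exists>c\<in>C. T interior_of (c <# W) \<noteq> {}"
  proof (rule ccontr)
    assume "\<not> (\<exists>c\<in>C. T interior_of (c <# W) \<noteq> {})"
    then have "T interior_of \<Union>((\<lambda>c. c <# W) ` C) = {}"
      using C W(2) closedin_lcoset Hausdorff locally_compact
      by (intro Baire_category_alt) (auto simp: locally_compact_Hausdorff_imp_regular_space)
    moreover have "\<Union>((\<lambda>c. c <# W) ` C) = carrier G"
      using C l_coset_subset_G[OF Wc] by blast
    ultimately show False
      using interior_of_openin[OF openin_carrier] one_closed by simp
  qed
  then obtain c where c: "c \<in> C" "T interior_of (c <# W) \<noteq> {}"
    by blast
  let ?O = "T interior_of (c <# W)"
  obtain x where x: "x \<in> ?O"
    using c by blast
  have sub: "?O \<subseteq> c <# W"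
    by (rule interior_of_subset)
  have cc: "c \<in> carrier G"
    using c C by blast
  have xc: "x \<in> carrier G"
    using x sub l_coset_subset_G[OF Wc cc] by blast
  \<comment> \<open>Two elements \<open>x\<close>, \<open>z\<close> of one left coset differ by an
    element of \<open>W\<close>, so this translate of the interior is a neighbourhood of \<one> in
    \<open>W\<close>.\<close>
  have "inv x <# ?O \<subseteq> W"
  proof
    fix y assume "y \<in> inv x <# ?O"
    then obtain z where z: "z \<in> ?O" "y = inv x \<otimes> z"
      by (auto simp: l_coset_def)
    have "x \<in> c <# W" "z \<in> c <# W"
      using x z(1) sub by blast+
    then obtain v w where vw: "v \<in> W" "x = c \<otimes> v" "w \<in> W" "z = c \<otimes> w"
      unfolding l_coset_def by blast
    then have "y = inv v \<otimes> w"
      using z(2) cc Wc by (auto simp: inv_mult_group m_assoc inv_mult_cancel subset_iff)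
    then show "y \<in> W"
      using vw W(1) by (simp add: subgroup.m_closed subgroup.m_inv_closed)
  qed
  moreover have "openin T (inv x <# ?O)"
    using xc by (intro openin_lcoset) auto
  moreover have "\<one> \<in> inv x <# ?O"
    using x xc by (force simp: l_coset_def)
  ultimately show ?thesis
    using open_subgroupI[OF W(1)] by blast
qed

end

context simple_tdlc
begin

section \<open>Consequences of a least non-zero class\<close>

definition least_nontrivial :: "'a set \<Rightarrow> bool" where
  "least_nontrivial K \<longleftrightarrow> cln K \<and> K \<noteq> {\<one>} \<and>
    (\<forall>H. cln H \<longrightarrow> H \<noteq> {\<one>} \<longrightarrow> virtually_contained G T K H)"

lemma ex_least_iff:
  "(\<exists>\<alpha>. least (LN G T) \<alpha> (carrier (LN G T) - {LN_zero G T})) \<longleftrightarrow> (\<exists>K. least_nontrivial K)"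
proof -
  have F: "carrier (LN G T) - {LN_zero G T} = local_class G T ` {H. cln H \<and> H \<noteq> {\<one>}}"
    unfolding carrier_LN using LN_zero_iff by blast
  have least: "least (LN G T) (local_class G T K) (carrier (LN G T) - {LN_zero G T}) \<longleftrightarrow> least_nontrivial K"
    if "cln K" "K \<noteq> {\<one>}" for K
    using that unfolding least_def F by (auto simp: carrier_LN least_nontrivial_def LN_le_iff)
  show ?thesis
  proof
    assume "\<exists>\<alpha>. least (LN G T) \<alpha> (carrier (LN G T) - {LN_zero G T})"
    then obtain \<alpha> where \<alpha>: "least (LN G T) \<alpha> (carrier (LN G T) - {LN_zero G T})"
      by blast
    then have "\<alpha> \<in> local_class G T ` {H. cln H \<and> H \<noteq> {\<one>}}"
      unfolding F[symmetric] by (simp only: least_def)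
    then obtain K where "cln K" "K \<noteq> {\<one>}" "\<alpha> = local_class G T K"
      by blast
    with \<alpha> show "\<exists>K. least_nontrivial K"
      using least by blast
  next
    assume "\<exists>K. least_nontrivial K"
    then obtain K where K: "least_nontrivial K"
      by blast
    then have "cln K" "K \<noteq> {\<one>}"
      by (simp_all add: least_nontrivial_def)
    then show "\<exists>\<alpha>. least (LN G T) \<alpha> (carrier (LN G T) - {LN_zero G T})"
      using least K by blast
  qed
qed

theorem trivial_action_if_least:
  assumes K: "least_nontrivial K"
  shows "trivial_conjugation_action G T"
proof -
  have cK: "cln K" and K1: "K \<noteq> {\<one>}"
    using K by (simp_all add: least_nontrivial_def)
  have "K \<subseteq> action_kernel"
  proof
    fix d assume d: "d \<in> K"
    have dc: "d \<in> carrier G"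
      using d clnD(3)[OF cK] by blast
    have "local_class G T (conjugate G d H) = local_class G T H" if H: "cln H" for H
    proof (cases "H = {\<one>}")
      case True
      then show ?thesis
        using dc by (simp add: conjugate_trivial)
    next
      case False
      then have KH: "virtually_contained G T K H"
        using K H by (simp add: least_nontrivial_def)
      have "virtually_contained G T (conjugate G d H) H"
        using virtually_contained_conjugate_by_element[OF cK d H KH] .
      \<comment> \<open>The same containment for \<open>inv d\<close>, conjugated by
        \<open>d\<close>, is the reverse one.\<close>
      moreover have "virtually_contained G T (conjugate G (inv d) H) H"
        using virtually_contained_conjugate_by_element[OF cK _ H KH] subgroup.m_inv_closed[OF clnD(1)[OF cK] d]
        by blast
      then have "virtually_contained G T (conjugate G d (conjugate G (inv d) H)) (conjugate G d H)"
        using dc clnD(3)[OF H] by (intro virtually_contained_conjugate conjugate_in_carrier) auto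
      then have "virtually_contained G T H (conjugate G d H)"
        using dc clnD(3)[OF H] by (simp add: conjugate_inv_cancel)
      ultimately show ?thesis
        using H dc by (simp add: local_class_eq_iff cln_conjugate)
    qed
    then show "d \<in> action_kernel"
      using dc by (simp add: action_kernel_def)
  qed
  then have "action_kernel \<noteq> {\<one>}"
    using K1 clnD(4)[OF cK] by blast
  then show ?thesis
    using closed_normal_cases[OF normal_action_kernel closedin_action_kernel]
    by (simp add: trivial_action_iff)
qed

text \<open>All conjugates of \<open>K\<close> are commensurate with \<open>K\<close>, and there are countably many of them. Hence
  the abstract subgroup they generate is a countable union of cosets of \<open>K\<close>.\<close>

theorem not_abstractly_simple_if_least:
  assumes K0: "least_nontrivial K0" and not_open: "\<not> openin T K0"
  shows "\<not> abstractly_simple G"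
proof
  assume simple: "abstractly_simple G"
  have cK0: "cln K0" and K01: "K0 \<noteq> {\<one>}"
    using K0 by (simp_all add: least_nontrivial_def)
  obtain U where U: "compact_open_subgroup G T U" "normalises G U K0"
    using cln_normaliser[OF cK0, of "carrier G"] by auto
  note U' = compact_open_subgroupD[OF U(1)]
  \<comment> \<open>The part inside \<open>U\<close> is compact and normalised by \<open>U\<close>,
    and it still represents the least non-zero class.\<close>
  define K where "K = K0 \<inter> U"
  have cK: "cln K"
    unfolding K_def using cK0 cln_open[OF U'(1,3)] by (rule cln_Int)
  note K' = clnD[OF cK]
  have K1: "K \<noteq> {\<one>}"
    unfolding K_def using Int_open_nontrivial[OF cK0 K01 U(1)] .
  have kK: "compactin T K"
    using closed_compactin[OF U'(2) _ K'(2)] by (simp add: K_def)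
  have nK: "normalises G U K"
    using U(2) U'(1) by (auto simp: normalises_def K_def subgroup.m_closed subgroup.m_inv_closed)
  have least: "virtually_contained G T K H" if "cln H" "H \<noteq> {\<one>}" for H
    using K0 that virtually_contained_trans[OF virtually_contained_subset, of K K0 H]
    by (simp add: least_nontrivial_def K_def)
  \<comment> \<open>Leastness is applied to the conjugate by \<open>inv g\<close>, and the
    containment is moved back by \<open>g\<close>.\<close>
  have commensurate: "virtually_contained G T (conjugate G g K) K" if g: "g \<in> carrier G" for g
  proof -
    let ?H = "conjugate G (inv g) K"
    have "?H \<noteq> {\<one>}"
      using conjugate_inv_cancel(2)[OF g K'(3)] conjugate_trivial[OF g] K1 by auto
    then have "virtually_contained G T K ?H"
      using cln_conjugate[OF cK] g by (intro least) auto
    then show ?thesis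
      using virtually_contained_conjugate[OF _ g K'(3)] conjugate_inv_cancel(2)[OF g K'(3)] by metis
  qed
  obtain C where C: "countable C" "C \<subseteq> carrier G" "carrier G \<subseteq> (\<Union>c\<in>C. c <# U)"
    using countably_covered_carrier[OF compactly_generated U(1)] unfolding countably_covered_def by blast
  define X where "X = (\<Union>g\<in>carrier G. conjugate G g K)"
  have Xc: "X \<subseteq> carrier G"
    unfolding X_def using conjugate_in_carrier[OF _ K'(3)] by blast
  \<comment> \<open>\<open>U\<close> normalises \<open>K\<close> and has countably many left cosets,
    so the countable set \<open>C\<close> of representatives yields all conjugates.\<close>
  have X_C: "X = (\<Union>c\<in>C. conjugate G c K)"
  proof
    show "X \<subseteq> (\<Union>c\<in>C. conjugate G c K)"
    proof
      fix x assume "x \<in> X"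
      then obtain g where g: "g \<in> carrier G" "x \<in> conjugate G g K"
        unfolding X_def by blast
      then obtain c u where cu: "c \<in> C" "u \<in> U" "g = c \<otimes> u"
        using C(3) unfolding l_coset_def by blast
      then have "conjugate G g K = conjugate G c K"
        using conjugate_mult[of c u K] conjugate_eqI[OF U'(1) nK cu(2) K'(3)] C(2) U'(4) K'(3)
        by (simp add: subset_iff)
      then show "x \<in> (\<Union>c\<in>C. conjugate G c K)"
        using g cu by blast
    qed
  qed (use C(2) in \<open>auto simp: X_def\<close>)
  have "countably_covered K (conjugate G c K <#> (d <# K))" if c: "c \<in> carrier G" and d: "d \<in> carrier G" for c d
  proof -
    \<comment> \<open>\<open>conjugate G c K\<close> times \<open>d <# K\<close> equals
      \<open>d\<close> times \<open>?L\<close> times \<open>K\<close>. The compact group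
      \<open>?L\<close> has finitely many cosets modulo its intersection with \<open>K\<close>,
      since it is virtually contained in \<open>K\<close>.\<close>
    let ?L = "conjugate G (inv d \<otimes> c) K"
    have Lc: "inv d \<otimes> c \<in> carrier G"
      using c d by simp
    have sL: "subgroup ?L G"
      using subgroup_conjugate[OF K'(1) Lc] .
    obtain A where A: "openin T A" "\<one> \<in> A" "?L \<inter> A \<subseteq> K"
      using commensurate[OF Lc] unfolding virtually_contained_def by blast
    obtain F where F: "finite F" "F \<subseteq> ?L" "?L \<subseteq> (\<Union>f\<in>F. f <# A)"
      using finite_cosets_cover[OF compactin_conjugate[OF kK Lc] A(1,2)] by blast
    have Fc: "F \<subseteq> carrier G"
      using F(2) subgroup.subset[OF sL] by blast
    have "conjugate G c K <#> (d <# K) \<subseteq> (\<Union>e\<in>(\<lambda>f. d \<otimes> f) ` F. e <# K)"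
    proof
      fix y assume "y \<in> conjugate G c K <#> (d <# K)"
      then obtain k k' where k: "k \<in> K" "k' \<in> K" "y = (c \<otimes> k \<otimes> inv c) \<otimes> (d \<otimes> k')"
        unfolding set_mult_def l_coset_def conjugate_def by blast
      define l where "l = (inv d \<otimes> c) \<otimes> k \<otimes> inv (inv d \<otimes> c)"
      have kc: "k \<in> carrier G" "k' \<in> carrier G"
        using k K'(3) by blast+
      have y: "y = d \<otimes> (l \<otimes> k')"
        using kc c d by (simp add: k(3) l_def m_assoc inv_mult_group inv_mult_cancel)
      have lL: "l \<in> ?L"
        using k(1) by (simp add: l_def conjugate_def)
      then obtain f a where fa: "f \<in> F" "a \<in> A" "l = f \<otimes> a"
        using F(3) unfolding l_coset_def by blast
      have fc: "f \<in> carrier G" "a \<in> carrier G"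
        using fa Fc openin_subset_carrier[OF A(1)] by blast+
      have "a = inv f \<otimes> l"
        using fa fc by (simp add: inv_mult_cancel)
      moreover have "inv f \<otimes> l \<in> ?L"
        using fa(1) F(2) lL by (intro subgroup.m_closed[OF sL] subgroup.m_inv_closed[OF sL]) auto
      ultimately have "a \<in> K"
        using fa A(3) by blast
      then have "a \<otimes> k' \<in> K"
        using k(2) K'(1) by (simp add: subgroup.m_closed)
      moreover have "y = d \<otimes> f \<otimes> (a \<otimes> k')"
        using y fa(3) fc kc d by (simp add: m_assoc)
      ultimately show "y \<in> (\<Union>e\<in>(\<lambda>f. d \<otimes> f) ` F. e <# K)"
        using fa(1) unfolding l_coset_def by blast
    qed
    moreover have "countable ((\<lambda>f. d \<otimes> f) ` F)" "(\<lambda>f. d \<otimes> f) ` F \<subseteq> carrier G"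
      using F(1) Fc d by (auto intro: countable_finite)
    ultimately show ?thesis
      unfolding countably_covered_def by blast
  qed
  then have cov: "countably_covered K (X <#> (d <# K))" if "d \<in> carrier G" for d
  proof -
    have "X <#> (d <# K) \<subseteq> (\<Union>c\<in>C. conjugate G c K <#> (d <# K))"
      unfolding X_C set_mult_def by blast
    moreover have "countably_covered K (\<Union>c\<in>C. conjugate G c K <#> (d <# K))"
      using C \<open>\<And>d c. c \<in> carrier G \<Longrightarrow> d \<in> carrier G \<Longrightarrow> countably_covered K (conjugate G c K <#> (d <# K))\<close> that
      by (intro countably_covered_UN) auto
    ultimately show ?thesis
      using countably_covered_mono by blast
  qed
  have X_inv: "inv x \<in> X" if "x \<in> X" for x
    using that subgroup.m_inv_closed[OF subgroup_conjugate[OF K'(1)]] unfolding X_def by blast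
  have X_conj: "g \<otimes> x \<otimes> inv g \<in> X" if x: "x \<in> X" and g: "g \<in> carrier G" for x g
  proof -
    obtain h where h: "h \<in> carrier G" "x \<in> conjugate G h K"
      using x unfolding X_def by blast
    then have "g \<otimes> x \<otimes> inv g \<in> conjugate G g (conjugate G h K)"
      by (simp add: conjugate_def)
    then show ?thesis
      using g h conjugate_mult[OF g h(1) K'(3)] unfolding X_def by blast
  qed
  have "generate G X \<lhd> G"
    using Xc X_conj by (rule normal_generateI)
  moreover have "generate G X \<noteq> {\<one>}"
  proof -
    have "K \<subseteq> X"
      using conjugate_one[OF K'(3)] unfolding X_def by blast
    then show ?thesis
      using K1 K'(4) generate.incl[of _ X G] by blast
  qed
  ultimately have "generate G X = carrier G"
    using simple unfolding abstractly_simple_def by blast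
  then have "openin T K"
    using countably_covered_generate[OF Xc X_inv K'(1) cov] open_if_countably_covered[OF K'(1,2)] by simp
  then show False
    using not_open open_subgroupI[OF clnD(1)[OF cK0], of K] K'(4) by (auto simp: K_def)
qed

end

section \<open>Classification by the structure lattice\<close>

text \<open>A zero meet is expressed through lower bounds, so that only the order and the element
  \<open>z\<close> occur and an isomorphism preserves the property.\<close>

definition uniform_poset :: "('a, 'l) gorder_scheme \<Rightarrow> 'a \<Rightarrow> bool" where
  "uniform_poset L z \<longleftrightarrow> (\<forall>a\<in>carrier L. \<forall>b\<in>carrier L.
     (\<forall>c\<in>carrier L. c \<sqsubseteq>\<^bsub>L\<^esub> a \<and> c \<sqsubseteq>\<^bsub>L\<^esub> b \<longrightarrow> c = z) \<longrightarrow> a = z \<or> b = z)"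

definition has_least_nonzero :: "('a, 'l) gorder_scheme \<Rightarrow> 'a \<Rightarrow> bool" where
  "has_least_nonzero L z \<longleftrightarrow>
     (\<exists>a\<in>carrier L. a \<noteq> z \<and> (\<forall>b\<in>carrier L. b \<noteq> z \<longrightarrow> a \<sqsubseteq>\<^bsub>L\<^esub> b))"

definition indecomposable_poset :: "('a, 'l) gorder_scheme \<Rightarrow> 'a \<Rightarrow> 'a \<Rightarrow> bool" where
  "indecomposable_poset L z i \<longleftrightarrow> (\<forall>a\<in>carrier L. \<forall>b\<in>carrier L.
     (\<forall>c\<in>carrier L. c \<sqsubseteq>\<^bsub>L\<^esub> a \<and> c \<sqsubseteq>\<^bsub>L\<^esub> b \<longrightarrow> c = z) \<longrightarrow>
     (\<forall>c\<in>carrier L. a \<sqsubseteq>\<^bsub>L\<^esub> c \<and> b \<sqsubseteq>\<^bsub>L\<^esub> c \<longrightarrow> c = i) \<longrightarrow> a = z \<or> a = i)"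

text \<open>The conditions on \<open>LC\<close> and \<open>LD\<close> appear as
  \<open>uniform_poset\<close> and \<open>indecomposable_poset\<close>. In the atomic case, trivial
  action and failure of abstract simplicity are consequences of a least non-zero element in a
  lattice with more than two elements.\<close>

fun poset_type :: "('a, 'l) gorder_scheme \<Rightarrow> 'a \<Rightarrow> 'a \<Rightarrow> local_type \<Rightarrow> bool" where
  "poset_type L z i Locally_HJI \<longleftrightarrow> carrier L = {z, i}"
| "poset_type L z i Atomic \<longleftrightarrow> carrier L \<noteq> {z, i} \<and> uniform_poset L z \<and> has_least_nonzero L z"
| "poset_type L z i NPF \<longleftrightarrow> uniform_poset L z \<and> \<not> has_least_nonzero L z"
| "poset_type L z i Weakly_Decomposable \<longleftrightarrow> \<not> uniform_poset L z \<and> indecomposable_poset L z i"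
| "poset_type L z i Locally_Decomposable \<longleftrightarrow> \<not> indecomposable_poset L z i"

lemma poset_type_iso:
  assumes f: "bij_betw f (carrier L) (carrier M)"
    and le: "\<And>x y. x \<in> carrier L \<Longrightarrow> y \<in> carrier L \<Longrightarrow> x \<sqsubseteq>\<^bsub>L\<^esub> y \<longleftrightarrow> f x \<sqsubseteq>\<^bsub>M\<^esub> f y"
    and z: "z \<in> carrier L" and i: "i \<in> carrier L"
  shows "poset_type L z i t \<longleftrightarrow> poset_type M (f z) (f i) t"
proof -
  have M: "carrier M = f ` carrier L" and inj: "inj_on f (carrier L)"
    using f by (auto simp: bij_betw_def)
  have eq: "f x = f y \<longleftrightarrow> x = y" if "x \<in> carrier L" "y \<in> carrier L" for x y
    using inj that by (simp add: inj_on_eq_iff)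
  have ball: "(\<forall>y\<in>carrier M. P y) \<longleftrightarrow> (\<forall>x\<in>carrier L. P (f x))"
    and bex: "(\<exists>y\<in>carrier M. P y) \<longleftrightarrow> (\<exists>x\<in>carrier L. P (f x))" for P
    unfolding M by blast+
  have "uniform_poset M (f z) \<longleftrightarrow> uniform_poset L z"
    unfolding uniform_poset_def ball by (intro ball_cong refl) (simp add: eq z flip: le)
  moreover have "has_least_nonzero M (f z) \<longleftrightarrow> has_least_nonzero L z"
    unfolding has_least_nonzero_def ball bex by (intro bex_cong refl) (simp add: eq z flip: le)
  moreover have "indecomposable_poset M (f z) (f i) \<longleftrightarrow> indecomposable_poset L z i"
    unfolding indecomposable_poset_def ball by (intro ball_cong refl) (simp add: eq z i flip: le)
  moreover have "carrier M = {f z, f i} \<longleftrightarrow> carrier L = {z, i}"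
    using inj_on_image_eq_iff[OF inj, of "carrier L" "{z, i}"] z i by (simp add: M)
  ultimately show ?thesis
    by (cases t) simp_all
qed

lemma more_than_two_iff:
  assumes "a \<noteq> b" "{a, b} \<subseteq> A"
  shows "more_than_two A \<longleftrightarrow> A \<noteq> {a, b}"
proof
  show "A \<noteq> {a, b}" if "more_than_two A"
    using that assms(1) by (auto simp: more_than_two_def)
  assume "A \<noteq> {a, b}"
  then have "{a, b} \<subset> A"
    using assms(2) by blast
  then have "finite A \<Longrightarrow> card {a, b} < card A"
    by (rule psubset_card_mono[rotated])
  then show "more_than_two A"
    using assms(1) by (auto simp: more_than_two_def)
qed

context simple_tdlc
begin

section \<open>Reading the types off the order\<close>

lemma ball_LN: "(\<forall>c\<in>carrier (LN G T). P c) \<longleftrightarrow> (\<forall>H. cln H \<longrightarrow> P (local_class G T H))"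
  unfolding carrier_LN by blast

text \<open>A common lower bound is virtually contained in \<open>H \<inter> K\<close>; if this is
  trivial, the bound is discrete and therefore trivial.\<close>

lemma disjoint_classes_iff:
  assumes H: "cln H" and K: "cln K"
  shows "(\<forall>c\<in>carrier (LN G T). c \<sqsubseteq>\<^bsub>LN G T\<^esub> local_class G T H \<and> c \<sqsubseteq>\<^bsub>LN G T\<^esub> local_class G T K \<longrightarrow>
      c = LN_zero G T) \<longleftrightarrow> H \<inter> K = {\<one>}"
proof
  assume "\<forall>c\<in>carrier (LN G T). c \<sqsubseteq>\<^bsub>LN G T\<^esub> local_class G T H \<and> c \<sqsubseteq>\<^bsub>LN G T\<^esub> local_class G T K \<longrightarrow>
      c = LN_zero G T"
  then have "local_class G T (H \<inter> K) = LN_zero G T"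
    using cln_Int[OF H K] H K unfolding ball_LN by (simp add: LN_le_iff virtually_contained_subset)
  then show "H \<inter> K = {\<one>}"
    using LN_zero_iff[OF cln_Int[OF H K]] by simp
next
  assume HK: "H \<inter> K = {\<one>}"
  have "X = {\<one>}" if "cln X" "virtually_contained G T X H" "virtually_contained G T X K" for X
    using discrete_cln_trivial[OF that(1)] virtually_contained_Int[OF that(2,3)] HK by simp
  then show "\<forall>c\<in>carrier (LN G T). c \<sqsubseteq>\<^bsub>LN G T\<^esub> local_class G T H \<and> c \<sqsubseteq>\<^bsub>LN G T\<^esub> local_class G T K \<longrightarrow>
      c = LN_zero G T"
    using H K unfolding ball_LN by (simp add: LN_le_iff LN_zero_iff)
qed

lemma uniform_iff: "uniform \<longleftrightarrow> uniform_poset (LN G T) (LN_zero G T)"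
proof -
  have "uniform_poset (LN G T) (LN_zero G T) \<longleftrightarrow>
      (\<forall>H. cln H \<longrightarrow> (\<forall>K. cln K \<longrightarrow> H \<inter> K = {\<one>} \<longrightarrow> H = {\<one>} \<or> K = {\<one>}))"
    unfolding uniform_poset_def by (subst (1 2) ball_LN) (simp add: disjoint_classes_iff LN_zero_iff)
  then show ?thesis
    by (simp add: uniform_def)
qed

lemma LD_trivial_iff:
  "LD G T = {LN_zero G T, LN_infty G T} \<longleftrightarrow> indecomposable_poset (LN G T) (LN_zero G T) (LN_infty G T)"
proof -
  have join: "(\<forall>c\<in>carrier (LN G T). local_class G T H \<sqsubseteq>\<^bsub>LN G T\<^esub> c \<and> local_class G T K \<sqsubseteq>\<^bsub>LN G T\<^esub> c \<longrightarrow>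
      c = LN_infty G T) \<longleftrightarrow>
      (\<forall>M. cln M \<longrightarrow> virtually_contained G T H M \<longrightarrow> virtually_contained G T K M \<longrightarrow> openin T M)"
    if "cln H" "cln K" for H K
    unfolding ball_LN using that by (simp add: LN_le_iff LN_infty_iff imp_conjL)
  have "indecomposable_poset (LN G T) (LN_zero G T) (LN_infty G T) \<longleftrightarrow>
      (\<forall>H. cln H \<longrightarrow> (\<forall>K. cln K \<longrightarrow> complementary H K \<longrightarrow>
        local_class G T H = LN_zero G T \<or> local_class G T H = LN_infty G T))"
    unfolding indecomposable_poset_def
    by (subst (1 2) ball_LN) (simp add: disjoint_classes_iff join complementary_def, simp only: imp_conjL)
  also have "\<dots> \<longleftrightarrow> LD G T \<subseteq> {LN_zero G T, LN_infty G T}"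
    unfolding subset_iff LD_iff_complementary by blast
  finally show ?thesis
    using zero_infty_in_LD by blast
qed

lemma has_least_iff:
  "has_least_nonzero (LN G T) (LN_zero G T) \<longleftrightarrow>
    (\<exists>\<alpha>. least (LN G T) \<alpha> (carrier (LN G T) - {LN_zero G T}))"
  by (auto simp: has_least_nonzero_def least_def)

text \<open>Upward closure holds because 0 is the least element, so the filter condition amounts to
  non-zero elements having non-zero meets.\<close>

lemma order_filter_iff:
  "order_filter (LN G T) (carrier (LN G T) - {LN_zero G T}) \<longleftrightarrow> uniform"
proof
  assume F: "order_filter (LN G T) (carrier (LN G T) - {LN_zero G T})"
  show uniform
    unfolding uniform_def
  proof (intro allI impI, rule ccontr)
    fix H K assume H: "cln H" and K: "cln K" and HK: "H \<inter> K = {\<one>}" and n: "\<not> (H = {\<one>} \<or> K = {\<one>})"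
    have "local_class G T H \<in> carrier (LN G T) - {LN_zero G T}"
      "local_class G T K \<in> carrier (LN G T) - {LN_zero G T}"
      using H K n by (simp_all add: carrier_LN LN_zero_iff)
    then have "local_class G T H \<sqinter>\<^bsub>LN G T\<^esub> local_class G T K \<noteq> LN_zero G T"
      using F unfolding order_filter_def by blast
    then show False
      using H K HK by (simp add: LN_meet LN_zero_iff cln_trivial)
  qed
next
  assume u: uniform
  show "order_filter (LN G T) (carrier (LN G T) - {LN_zero G T})"
    unfolding order_filter_def
  proof (intro conjI ballI impI)
    fix x y assume x: "x \<in> carrier (LN G T) - {LN_zero G T}" and y: "y \<in> carrier (LN G T)"
      and xy: "x \<sqsubseteq>\<^bsub>LN G T\<^esub> y"
    have "y \<noteq> LN_zero G T"
      using x xy LN_antisym[OF _ LN_zero_in_carrier _ LN_zero_le] by blast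
    then show "y \<in> carrier (LN G T) - {LN_zero G T}"
      using y by blast
  next
    fix x y assume xy: "x \<in> carrier (LN G T) - {LN_zero G T}" "y \<in> carrier (LN G T) - {LN_zero G T}"
    then obtain H K where HK: "cln H" "x = local_class G T H" "cln K" "y = local_class G T K"
      by (auto simp: carrier_LN)
    then have "H \<noteq> {\<one>}" "K \<noteq> {\<one>}"
      using xy by (simp_all add: LN_zero_iff)
    then have "H \<inter> K \<noteq> {\<one>}"
      using HK u unfolding uniform_def by blast
    then show "x \<sqinter>\<^bsub>LN G T\<^esub> y \<in> carrier (LN G T) - {LN_zero G T}"
      using HK by (simp add: LN_meet carrier_LN LN_zero_iff cln_Int)
  qed blast
qed

lemma atomic_if_least:
  assumes least: "has_least_nonzero (LN G T) (LN_zero G T)"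
    and nontrivial: "carrier (LN G T) \<noteq> {LN_zero G T, LN_infty G T}"
  shows "trivial_conjugation_action G T" "\<not> abstractly_simple G"
    "\<exists>!\<alpha>. least (LN G T) \<alpha> (carrier (LN G T) - {LN_zero G T})"
proof -
  have ex: "\<exists>\<alpha>. least (LN G T) \<alpha> (carrier (LN G T) - {LN_zero G T})"
    using least by (simp add: has_least_iff)
  then obtain K where K: "least_nontrivial K"
    using ex_least_iff by blast
  then show "trivial_conjugation_action G T"
    by (rule trivial_action_if_least)
  \<comment> \<open>If the least non-zero class were \<infinity>, every non-trivial closed locally
    normal subgroup would contain a neighbourhood of \<one> and be open, which the size of the
    lattice forbids.\<close>
  have "\<not> openin T K"
  proof
    assume o: "openin T K"
    have "openin T H" if H: "cln H" "H \<noteq> {\<one>}" for H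
    proof -
      obtain A where A: "openin T A" "\<one> \<in> A" "K \<inter> A \<subseteq> H"
        using K H unfolding least_nontrivial_def virtually_contained_def by blast
      have "\<one> \<in> K"
        using K clnD(4) by (simp add: least_nontrivial_def)
      then show ?thesis
        using open_subgroupI[OF clnD(1)[OF H(1)] openin_Int[OF o A(1)] _ A(3)] A(2) by simp
    qed
    then show False
      using nontrivial LN_trivial_iff by blast
  qed
  then show "\<not> abstractly_simple G"
    using not_abstractly_simple_if_least[OF K] by simp
  show "\<exists>!\<alpha>. least (LN G T) \<alpha> (carrier (LN G T) - {LN_zero G T})"
  proof (rule ex_ex1I[OF ex])
    show "\<alpha> = \<beta>" if "least (LN G T) \<alpha> (carrier (LN G T) - {LN_zero G T})"
      "least (LN G T) \<beta> (carrier (LN G T) - {LN_zero G T})" for \<alpha> \<beta>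
      using that unfolding least_def by (intro LN_antisym) auto
  qed
qed

theorem of_type_iff_poset_type:
  "of_type G T t \<longleftrightarrow> poset_type (LN G T) (LN_zero G T) (LN_infty G T) t"
proof -
  note more = more_than_two_iff[OF zero_neq_infty]
  have LN_more: "more_than_two (carrier (LN G T)) \<longleftrightarrow> carrier (LN G T) \<noteq> {LN_zero G T, LN_infty G T}"
    using LN_zero_in_carrier LN_infty_in_carrier by (intro more) simp
  have LC_iff: "LC G T = {LN_zero G T, LN_infty G T} \<longleftrightarrow> uniform_poset (LN G T) (LN_zero G T)"
    by (simp add: LC_trivial_iff uniform_iff)
  show ?thesis
  proof (cases t)
    case Locally_HJI
    then show ?thesis
      by simp
  next
    case Atomic
    have "of_type G T Atomic \<longleftrightarrow> poset_type (LN G T) (LN_zero G T) (LN_infty G T) Atomic"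
      unfolding of_type.simps poset_type.simps LN_more LC_iff
      using atomic_if_least has_least_iff by blast
    with Atomic show ?thesis
      by simp
  next
    case NPF
    have "of_type G T NPF \<longleftrightarrow> poset_type (LN G T) (LN_zero G T) (LN_infty G T) NPF"
      unfolding of_type.simps poset_type.simps principal_filter_def LC_iff order_filter_iff uniform_iff
        has_least_iff by blast
    with NPF show ?thesis
      by simp
  next
    case Weakly_Decomposable
    then show ?thesis
      using more[OF zero_infty_in_LC] LC_iff LD_trivial_iff by simp
  next
    case Locally_Decomposable
    then show ?thesis
      using more[OF zero_infty_in_LD] LD_trivial_iff by simp
  qed
qed

text \<open>Facts \<open>1\<close> and \<open>2\<close> order the conditions: a two-element lattice
  is uniform with a least non-zero element, and uniformity forces indecomposability. The types then
  arise by asking in turn about decomposability, uniformity, a least non-zero element and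
  size.\<close>

theorem ex1_type: "\<exists>!t. of_type G T t"
proof -
  let ?L = "LN G T" and ?z = "LN_zero G T" and ?i = "LN_infty G T"
  have 1: "uniform_poset ?L ?z \<and> has_least_nonzero ?L ?z" if "carrier ?L = {?z, ?i}"
  proof -
    have "\<forall>H. cln H \<longrightarrow> H = {\<one>} \<or> openin T H"
      using that LN_trivial_iff by simp
    then have "H = {\<one>} \<or> K = {\<one>}" if "cln H" "cln K" "H \<inter> K = {\<one>}" for H K
      using that openin_Int[of T H K] not_openin_one by auto
    then have uniform
      by (simp add: uniform_def)
    moreover have "has_least_nonzero ?L ?z"
      using that le_LN_infty[OF LN_infty_in_carrier] zero_neq_infty by (auto simp: has_least_nonzero_def)
    ultimately show ?thesis
      by (simp add: uniform_iff)
  qed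
  have 2: "indecomposable_poset ?L ?z ?i" if "uniform_poset ?L ?z"
    using LD_trivial_if_uniform that by (simp add: uniform_iff LD_trivial_iff)
  have "\<exists>!t. poset_type ?L ?z ?i t"
  proof (rule ex_ex1I)
    show "\<exists>t. poset_type ?L ?z ?i t"
      using poset_type.simps[of ?L ?z ?i] by blast
    show "t = t'" if "poset_type ?L ?z ?i t" "poset_type ?L ?z ?i t'" for t t'
      using that 1 2 by (cases t; cases t') auto
  qed
  then show ?thesis
    by (simp add: of_type_iff_poset_type)
qed

lemma LN_zero_unique:
  "\<alpha> \<in> carrier (LN G T) \<Longrightarrow> (\<And>\<beta>. \<beta> \<in> carrier (LN G T) \<Longrightarrow> \<alpha> \<sqsubseteq>\<^bsub>LN G T\<^esub> \<beta>) \<Longrightarrow> \<alpha> = LN_zero G T"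
  using LN_antisym LN_zero_in_carrier LN_zero_le by blast

lemma LN_infty_unique:
  "\<alpha> \<in> carrier (LN G T) \<Longrightarrow> (\<And>\<beta>. \<beta> \<in> carrier (LN G T) \<Longrightarrow> \<beta> \<sqsubseteq>\<^bsub>LN G T\<^esub> \<alpha>) \<Longrightarrow> \<alpha> = LN_infty G T"
  using LN_antisym LN_infty_in_carrier le_LN_infty by blast

end

lemma class_S_simple_tdlc: "class_S G T \<Longrightarrow> simple_tdlc G T"
  by (simp add: class_S_def tdlc_group_def simple_tdlc_def simple_tdlc_axioms_def tdlc_def tdlc_axioms_def)

text \<open>Bottom and top are order-theoretic, so the isomorphism maps 0 to 0 and \<infinity> to
  \<infinity>, and the type is read off the order.\<close>

theorem type_determined_by_LN:
  assumes G: "class_S G T" and H: "class_S H S" and iso: "poset_isomorphic (LN G T) (LN H S)"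
  shows "of_type G T t \<longleftrightarrow> of_type H S t"
proof -
  interpret G: simple_tdlc G T
    using G by (rule class_S_simple_tdlc)
  interpret H: simple_tdlc H S
    using H by (rule class_S_simple_tdlc)
  obtain f where f: "bij_betw f (carrier (LN G T)) (carrier (LN H S))"
    and le: "\<And>x y. x \<in> carrier (LN G T) \<Longrightarrow> y \<in> carrier (LN G T) \<Longrightarrow>
      x \<sqsubseteq>\<^bsub>LN G T\<^esub> y \<longleftrightarrow> f x \<sqsubseteq>\<^bsub>LN H S\<^esub> f y"
    using iso unfolding poset_isomorphic_def by blast
  have im: "carrier (LN H S) = f ` carrier (LN G T)"
    using f by (simp add: bij_betw_def)
  have "f (LN_zero G T) = LN_zero H S"
    using G.LN_zero_in_carrier G.LN_zero_le le by (intro H.LN_zero_unique) (auto simp: im)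
  moreover have "f (LN_infty G T) = LN_infty H S"
    using G.LN_infty_in_carrier G.le_LN_infty le by (intro H.LN_infty_unique) (auto simp: im)
  ultimately show ?thesis
    using poset_type_iso[OF f le G.LN_zero_in_carrier G.LN_infty_in_carrier]
    by (simp add: G.of_type_iff_poset_type H.of_type_iff_poset_type)
qed

section \<open>Groups with isomorphic open subgroups\<close>

text \<open>The setting is symmetric in the two groups, so that every fact applies to the inverse
  map as well.\<close>

locale open_subgroup_iso = G: tdlc G T + H: tdlc H S
  for G (structure) and T :: "'a topology" and H (structure) and S :: "'b topology" +
  fixes U V f
  assumes U: "subgroup U G" "openin T U" and V: "subgroup V H" "openin S V"
    and iso: "f \<in> iso (G\<lparr>carrier := U\<rparr>) (H\<lparr>carrier := V\<rparr>)"
    and homeo: "homeomorphic_map (subtopology T U) (subtopology S V) f"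
begin

lemma bij: "bij_betw f U V"
  using iso by (simp add: iso_def)

lemma f_in: "x \<in> U \<Longrightarrow> f x \<in> V"
  using bij by (auto simp: bij_betw_def)

lemma f_mult: "x \<in> U \<Longrightarrow> y \<in> U \<Longrightarrow> f (x \<otimes>\<^bsub>G\<^esub> y) = f x \<otimes>\<^bsub>H\<^esub> f y"
  using iso by (simp add: iso_def hom_def)

lemma f_one: "f \<one>\<^bsub>G\<^esub> = \<one>\<^bsub>H\<^esub>"
proof -
  have "\<one>\<^bsub>G\<^esub> \<in> U"
    using U(1) by (rule subgroup.one_closed)
  moreover from this have "f \<one>\<^bsub>G\<^esub> \<in> carrier H"
    using f_in subgroup.mem_carrier[OF V(1)] by blast
  ultimately show ?thesis
    using f_mult[of "\<one>\<^bsub>G\<^esub>" "\<one>\<^bsub>G\<^esub>"] by (simp add: H.r_cancel_one')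
qed

lemma f_inv:
  assumes x: "x \<in> U"
  shows "f (inv\<^bsub>G\<^esub> x) = inv\<^bsub>H\<^esub> f x"
proof -
  have xi: "inv\<^bsub>G\<^esub> x \<in> U"
    using U(1) x by (rule subgroup.m_inv_closed)
  then have "f (inv\<^bsub>G\<^esub> x) \<otimes>\<^bsub>H\<^esub> f x = \<one>\<^bsub>H\<^esub>"
    using f_mult[OF xi x] f_one subgroup.mem_carrier[OF U(1) x] by simp
  then show ?thesis
    using f_in[OF x] f_in[OF xi] subgroup.mem_carrier[OF V(1)] H.inv_equality by metis
qed

text \<open>\<open>K\<close> may reach outside \<open>U\<close>, where \<open>f\<close> carries no
  information; its germ is that of \<open>K \<inter> U\<close>.\<close>

definition transport :: "'a set \<Rightarrow> 'b set" where
  "transport K = f ` (K \<inter> U)"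

lemma openin_transport:
  assumes "openin T A"
  shows "openin S (transport A)"
proof -
  have "openin (subtopology T U) (A \<inter> U)"
    using assms by (auto simp: openin_subtopology)
  then have "openin (subtopology S V) (transport A)"
    using homeomorphic_map_openness[OF homeo, of "A \<inter> U"] openin_subset
    unfolding transport_def by blast
  then show ?thesis
    using V(2) by (simp add: openin_open_subtopology)
qed

lemma closedin_transport:
  assumes "closedin T K"
  shows "closedin S (transport K)"
proof -
  have "closedin (subtopology T U) (K \<inter> U)"
    using assms by (auto simp: closedin_subtopology)
  then have "closedin (subtopology S V) (transport K)"
    using homeomorphic_map_closedness[OF homeo, of "K \<inter> U"] closedin_subset
    unfolding transport_def by blast
  then show ?thesis
    using closedin_closed_subtopology[OF H.open_subgroup_closed[OF V]] by blast
qed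

lemma one_in_transport: "\<one>\<^bsub>G\<^esub> \<in> A \<Longrightarrow> \<one>\<^bsub>H\<^esub> \<in> transport A"
  using subgroup.one_closed[OF U(1)] f_one unfolding transport_def by (metis IntI imageI)

lemma cln_transport:
  assumes K: "G.cln K"
  shows "H.cln (transport K)"
proof -
  note K' = G.clnD[OF K]
  obtain W where W: "compact_open_subgroup G T W" "W \<subseteq> U" "normalises G W K"
    using G.cln_normaliser[OF K U(2) subgroup.one_closed[OF U(1)]] by blast
  note W' = G.compact_open_subgroupD[OF W(1)]
  have KU: "subgroup (K \<inter> U) G"
    using K'(1) U(1) by (rule G.subgroups_Inter_pair)
  have "subgroup (transport K) H"
  proof (rule H.subgroupI)
    show "transport K \<subseteq> carrier H"
      using f_in subgroup.mem_carrier[OF V(1)] unfolding transport_def by blast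
    show "transport K \<noteq> {}"
      using one_in_transport[OF K'(4)] by blast
    show "inv\<^bsub>H\<^esub> a \<in> transport K" if a: "a \<in> transport K" for a
    proof -
      obtain k where k: "k \<in> K \<inter> U" "a = f k"
        using a unfolding transport_def by blast
      then have "inv\<^bsub>H\<^esub> a = f (inv\<^bsub>G\<^esub> k)"
        using f_inv by simp
      then show ?thesis
        using subgroup.m_inv_closed[OF KU k(1)] unfolding transport_def by blast
    qed
    show "a \<otimes>\<^bsub>H\<^esub> b \<in> transport K" if ab: "a \<in> transport K" "b \<in> transport K" for a b
    proof -
      obtain k l where k: "k \<in> K \<inter> U" "a = f k" "l \<in> K \<inter> U" "b = f l"
        using ab unfolding transport_def by blast
      then have "a \<otimes>\<^bsub>H\<^esub> b = f (k \<otimes>\<^bsub>G\<^esub> l)"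
        using f_mult by simp
      then show ?thesis
        using subgroup.m_closed[OF KU k(1,3)] unfolding transport_def by blast
    qed
  qed
  moreover have "normalises H (transport W) (transport K)"
    unfolding normalises_def
  proof (intro ballI)
    fix v h assume "v \<in> transport W" "h \<in> transport K"
    then obtain w k where wk: "w \<in> W" "w \<in> U" "v = f w" "k \<in> K" "k \<in> U" "h = f k"
      unfolding transport_def by blast
    have c: "w \<otimes>\<^bsub>G\<^esub> k \<in> U" "inv\<^bsub>G\<^esub> w \<in> U"
      using wk U(1) by (simp_all add: subgroup.m_closed subgroup.m_inv_closed)
    then have "v \<otimes>\<^bsub>H\<^esub> h \<otimes>\<^bsub>H\<^esub> inv\<^bsub>H\<^esub> v = f (w \<otimes>\<^bsub>G\<^esub> k \<otimes>\<^bsub>G\<^esub> inv\<^bsub>G\<^esub> w)"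
      using wk by (simp add: f_mult f_inv)
    moreover have "w \<otimes>\<^bsub>G\<^esub> k \<otimes>\<^bsub>G\<^esub> inv\<^bsub>G\<^esub> w \<in> K \<inter> U"
      using normalisesD[OF W(3) wk(1,4)] subgroup.m_closed[OF U(1) c] by blast
    ultimately show "v \<otimes>\<^bsub>H\<^esub> h \<otimes>\<^bsub>H\<^esub> inv\<^bsub>H\<^esub> v \<in> transport K"
      unfolding transport_def by blast
  qed
  ultimately show ?thesis
    using closedin_transport[OF K'(2)] openin_transport[OF W'(3)] one_in_transport[OF W'(5)]
    by (intro H.clnI)
qed

lemma virtually_contained_transport:
  assumes "virtually_contained G T K L"
  shows "virtually_contained H S (transport K) (transport L)"
proof -
  obtain A where A: "openin T A" "\<one>\<^bsub>G\<^esub> \<in> A" "K \<inter> A \<subseteq> L"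
    using assms unfolding virtually_contained_def by blast
  have "transport K \<inter> transport A = f ` (K \<inter> U \<inter> (A \<inter> U))"
    unfolding transport_def using bij by (intro inj_on_image_Int[symmetric]) (auto simp: bij_betw_def)
  also have "\<dots> \<subseteq> transport L"
    using A(3) unfolding transport_def by blast
  finally show ?thesis
    using openin_transport[OF A(1)] one_in_transport[OF A(2)] unfolding virtually_contained_def by blast
qed

lemma inverse: "open_subgroup_iso H S G T V U (inv_into U f)"
proof (intro open_subgroup_iso.intro open_subgroup_iso_axioms.intro)
  let ?g = "inv_into U f"
  show "?g \<in> iso (H\<lparr>carrier := V\<rparr>) (G\<lparr>carrier := U\<rparr>)"
    using group.iso_set_sym[OF G.subgroup_imp_group[OF U(1)] iso] by simp
  have t: "topspace (subtopology T U) = U" "topspace (subtopology S V) = V"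
    using openin_subset[OF U(2)] openin_subset[OF V(2)] by auto
  \<comment> \<open>The inverse homeomorphism is only known as some \<open>g\<close>; on
    \<open>V\<close> it agrees with \<open>inv_into U f\<close>.\<close>
  obtain g where g: "homeomorphic_maps (subtopology T U) (subtopology S V) f g"
    using homeo unfolding homeomorphic_map_maps by blast
  have "g y = ?g y" if y: "y \<in> V" for y
  proof -
    have "?g y \<in> U" "f (?g y) = y"
      using y bij by (auto simp: bij_betw_def inv_into_into f_inv_into_f)
    then show ?thesis
      using g unfolding homeomorphic_maps_def t by metis
  qed
  moreover have "homeomorphic_map (subtopology S V) (subtopology T U) g"
    using g homeomorphic_maps_map by blast
  ultimately show "homeomorphic_map (subtopology S V) (subtopology T U) ?g"
    using homeomorphic_map_eq[of "subtopology S V" "subtopology T U" g ?g] unfolding t by blast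
qed (use U V G.tdlc_axioms H.tdlc_axioms in auto)

end

lemma (in tdlc) virtually_contained_Int_open_iff:
  assumes A: "openin T A" "\<one> \<in> A"
  shows "virtually_contained G T (H \<inter> A) (K \<inter> A) \<longleftrightarrow> virtually_contained G T H K"
proof
  assume "virtually_contained G T (H \<inter> A) (K \<inter> A)"
  then show "virtually_contained G T H K"
    using virtually_contained_trans virtually_contained_Int_open[OF A]
      virtually_contained_subset[of "K \<inter> A" K] by blast
next
  assume "virtually_contained G T H K"
  then have "virtually_contained G T (H \<inter> A) K"
    using virtually_contained_trans virtually_contained_subset[of "H \<inter> A" H] by blast
  then show "virtually_contained G T (H \<inter> A) (K \<inter> A)"
    using virtually_contained_subset[of "H \<inter> A" A] by (intro virtually_contained_Int) simp_all
qed

section \<open>The induced isomorphism of structure lattices\<close>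

context open_subgroup_iso
begin

interpretation inverse: open_subgroup_iso H S G T V U "inv_into U f"
  by (rule inverse)

lemma inverse_transport: "inverse.transport (transport K) = K \<inter> U"
proof -
  have "transport K \<inter> V = transport K"
    using f_in unfolding transport_def by blast
  moreover have "inv_into U f ` f ` (K \<inter> U) = K \<inter> U"
    using bij by (intro inv_into_image_cancel) (auto simp: bij_betw_def)
  ultimately show ?thesis
    unfolding inverse.transport_def by (simp add: transport_def)
qed

lemma transport_inverse: "transport (inverse.transport M) = M \<inter> V"
proof -
  have "inverse.transport M \<inter> U = inverse.transport M"
    using inverse.f_in unfolding inverse.transport_def by blast
  moreover have "f ` inv_into U f ` (M \<inter> V) = M \<inter> V"
    using bij by (intro image_inv_into_cancel[where A = U]) (auto simp: bij_betw_def)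
  ultimately show ?thesis
    by (simp add: transport_def inverse.transport_def)
qed

lemma virtually_contained_transport_iff:
  "virtually_contained H S (transport K) (transport L) \<longleftrightarrow> virtually_contained G T K L"
proof
  assume "virtually_contained H S (transport K) (transport L)"
  then have "virtually_contained G T (K \<inter> U) (L \<inter> U)"
    using inverse.virtually_contained_transport by (metis inverse_transport)
  then show "virtually_contained G T K L"
    using G.virtually_contained_Int_open_iff[OF U(2) subgroup.one_closed[OF U(1)]] by simp
qed (rule virtually_contained_transport)

theorem poset_isomorphic_LN: "poset_isomorphic (LN G T) (LN H S)"
proof -
  \<comment> \<open>The choice of a representative is harmless because transport preserves and
    reflects virtual containment.\<close>
  define F where "F \<alpha> = local_class H S (transport (SOME K. K \<in> \<alpha>))" for \<alpha>
  have F: "F (local_class G T K) = local_class H S (transport K)" if K: "G.cln K" for K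
  proof -
    have "K \<in> local_class G T K"
      using K by (simp add: G.mem_local_class_iff G.virtually_contained_subset)
    then obtain L where L: "L \<in> local_class G T K" "F (local_class G T K) = local_class H S (transport L)"
      unfolding F_def by (metis someI)
    then show ?thesis
      using cln_transport
      by (simp add: G.mem_local_class_iff H.local_class_eq_iff virtually_contained_transport_iff)
  qed
  have "bij_betw F (carrier (LN G T)) (carrier (LN H S))"
  proof (rule bij_betw_imageI, rule inj_onI)
    fix x y assume xy: "x \<in> carrier (LN G T)" "y \<in> carrier (LN G T)" "F x = F y"
    then obtain K L where KL: "G.cln K" "x = local_class G T K" "G.cln L" "y = local_class G T L"
      by (auto simp: G.carrier_LN)
    then have "local_class H S (transport K) = local_class H S (transport L)"
      using xy(3) by (simp add: F)
    then show "x = y"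
      using KL cln_transport
      by (simp add: G.local_class_eq_iff H.local_class_eq_iff virtually_contained_transport_iff)
  next
    have "F ` carrier (LN G T) \<subseteq> carrier (LN H S)"
      using cln_transport by (auto simp: F G.carrier_LN H.carrier_LN)
    moreover have "y \<in> F ` carrier (LN G T)" if y: "y \<in> carrier (LN H S)" for y
    proof -
      obtain M where M: "H.cln M" "y = local_class H S M"
        using y by (auto simp: H.carrier_LN)
      have K: "G.cln (inverse.transport M)"
        using M(1) by (rule inverse.cln_transport)
      \<comment> \<open>\<open>M\<close> and \<open>M \<inter> V\<close> have the same germ, and
        \<open>M \<inter> V\<close> is the transport of its preimage in \<open>U\<close>.\<close>
      have "y = local_class H S (M \<inter> V)"
        using M H.cln_Int[OF M(1) H.cln_open[OF V]]
          H.virtually_contained_Int_open[OF V(2) subgroup.one_closed[OF V(1)], of M]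
        by (simp add: H.local_class_eq_iff H.virtually_contained_subset)
      then have "y = F (local_class G T (inverse.transport M))"
        by (simp add: F[OF K] transport_inverse)
      then show ?thesis
        using K by (auto simp: G.carrier_LN)
    qed
    ultimately show "F ` carrier (LN G T) = carrier (LN H S)"
      by blast
  qed
  moreover have "x \<sqsubseteq>\<^bsub>LN G T\<^esub> y \<longleftrightarrow> F x \<sqsubseteq>\<^bsub>LN H S\<^esub> F y"
    if xy: "x \<in> carrier (LN G T)" "y \<in> carrier (LN G T)" for x y
  proof -
    obtain K L where "G.cln K" "x = local_class G T K" "G.cln L" "y = local_class G T L"
      using xy by (auto simp: G.carrier_LN)
    then show ?thesis
      using cln_transport by (simp add: F G.LN_le_iff H.LN_le_iff virtually_contained_transport_iff)
  qed
  ultimately show ?thesis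
    unfolding poset_isomorphic_def by blast
qed

end

text \<open>The second group has its own carrier type. Isomorphic open subgroups induce an
  isomorphism of structure lattices, which reduces the last clause to the preceding one.\<close>

theorem theorem2:
  fixes G :: "('a, 'm) monoid_scheme" and T :: "'a topology"
  assumes "class_S G T"
  shows "(\<exists>!t. of_type G T t) \<and>
    (carrier (LN G T) = {LN_zero G T, LN_infty G T} \<longleftrightarrow>
      (\<forall>U. compact_open_subgroup G T U \<longrightarrow>
        hereditarily_just_infinite (G\<lparr>carrier := U\<rparr>) (subtopology T U))) \<and>
    (\<forall>(H :: ('b, 'n) monoid_scheme) S. class_S H S \<and> poset_isomorphic (LN G T) (LN H S) \<longrightarrow>
      (\<forall>t. of_type G T t \<longleftrightarrow> of_type H S t)) \<and>
    (\<forall>(H :: ('b, 'n) monoid_scheme) S. class_S H S \<and> isomorphic_open_subgroups G T H S \<longrightarrow>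
      (\<forall>t. of_type G T t \<longleftrightarrow> of_type H S t))"
proof (intro conjI allI impI)
  interpret simple_tdlc G T
    using assms by (rule class_S_simple_tdlc)
  show "\<exists>!t. of_type G T t"
    by (rule ex1_type)
  show "carrier (LN G T) = {LN_zero G T, LN_infty G T} \<longleftrightarrow>
      (\<forall>U. compact_open_subgroup G T U \<longrightarrow>
        hereditarily_just_infinite (G\<lparr>carrier := U\<rparr>) (subtopology T U))"
    by (rule LN_trivial_iff_hji)
  fix H :: "('b, 'n) monoid_scheme" and S t
  show "of_type G T t \<longleftrightarrow> of_type H S t" if "class_S H S \<and> poset_isomorphic (LN G T) (LN H S)"
    using type_determined_by_LN[OF assms] that by blast
  show "of_type G T t \<longleftrightarrow> of_type H S t" if H: "class_S H S \<and> isomorphic_open_subgroups G T H S"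
  proof -
    interpret H: simple_tdlc H S
      using H class_S_simple_tdlc by blast
    obtain U V f where "open_subgroup_iso G T H S U V f"
      using H tdlc_axioms H.tdlc_axioms
      unfolding isomorphic_open_subgroups_def open_subgroup_iso_def open_subgroup_iso_axioms_def by blast
    then have "poset_isomorphic (LN G T) (LN H S)"
      by (rule open_subgroup_iso.poset_isomorphic_LN)
    then show ?thesis
      using type_determined_by_LN[OF assms] H by blast
  qed
qed

end
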